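(* Let $G$ be a multisun. The following are equivalent: (1) $G$ is a sunoid; (2) $G$ satisfies the N-conditions and the s-word of $G$ is a sunword; (3) $G$ is HOH-free.
   Context: A graph is diamond-free if it has no induced subgraph isomorphic to $K_4$ minus an edge. An odd hole is an induced cycle of odd length at least $5$. A multisun is a diamond-free graph $G$ of odd order whose maximal cliques of size $2$ form the edge set of a Hamiltonian cycle $C$ of $G$ (the rim); all other maximal cliques consist of pairwise nonconsecutive vertices of $C$ and are called inscribed cliques. A sub-multisun of $G$ is the graph obtained by deleting the edge sets of some, but not all, inscribed cliques. $G$ is HOH-free if $G$ and all its sub-multisuns contain no odd hole as an induced subgraph. For inscribed cliques $A,B$ (not necessarily distinct), an $AB$-path is a subpath of $C$ with one endpoint in $A$ and the other in $B$ whose internal vertices lie in no inscribed clique; an $A$-path is an $AA$-path; for $v\in B$, an $Av$-path is an $AB$-path whose endpoint in $B$ is $v$. $G$ satisfies the N-conditions if: (N1) each $A$-path has an even number of vertices, at least four; (N2) every inscribed clique has odd size; (N3) all inscribed cliques contain a common vertex $\xi\in V(C)$ and are pairwise disjoint apart from $\xi$; (N4) every $A\xi$-path has an even number of vertices; (N5) for distinct inscribed cliques $A,B$, every $AB$-path has an odd number of vertices. A sunoid is a multisun such that it and every sub-multisun satisfy the N-conditions. Words: let $\Sigma$ be a finite alphabet with a distinguished letter $\epsilon$; $x^k$ denotes $k$ consecutive copies of $x$. The pattern $\pi(w)$ of a word $w$ is obtained by repeatedly deleting occurrences of $\epsilon\epsilon$. Write $v\sim w$ if $w$ is obtained from $v$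 by cyclic shifts and/or reversal; $u\approx v$ iff $\pi(u)\sim\pi(v)$; the class $[w]$ is a cyclic word with representative $w$. For a multisun $G$ satisfying the N-conditions, assign distinct letters to the inscribed cliques, and label each rim vertex by $\sigma$ if it lies in more than one inscribed clique, by the letter of $X$ if it lies in exactly the inscribed clique $X$, and by $\epsilon$ if it lies in none; reading the labels around the rim gives a word $w_G$, and the cyclic word $[w_G]$ (independent of the choices) is the s-word of $G$. A sunword is the s-word of a sunoid.
   Formalization: A multisun is required to have at least one inscribed clique (else odd cycles such as C5 are counterexamples); paths have at least two vertices; in (N5) the endpoints of an AB-path lie in A\B and B\A, i.e. differ from ξ, since otherwise (N1) and (N5) conflict whenever there are two cliques. *)

theory Defs
  imports Main
begin

definition simple_graph :: "'a set \<Rightarrow> 'a set set \<Rightarrow> bool" where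
  "simple_graph V E \<longleftrightarrow> finite V \<and>
     (\<forall>e\<in>E. \<exists>u v. e = {u, v} \<and> u \<noteq> v \<and> u \<in> V \<and> v \<in> V)"

definition clique :: "'a set \<Rightarrow> 'a set set \<Rightarrow> 'a set \<Rightarrow> bool" where
  "clique V E K \<longleftrightarrow> K \<subseteq> V \<and> (\<forall>u\<in>K. \<forall>v\<in>K. u \<noteq> v \<longrightarrow> {u, v} \<in> E)"

definition maximal_clique :: "'a set \<Rightarrow> 'a set set \<Rightarrow> 'a set \<Rightarrow> bool" where
  "maximal_clique V E K \<longleftrightarrow> clique V E K \<and> (\<forall>K'. clique V E K' \<and> K \<subseteq> K' \<longrightarrow> K' = K)"

definition diamond_free :: "'a set \<Rightarrow> 'a set set \<Rightarrow> bool" where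
  "diamond_free V E \<longleftrightarrow> \<not> (\<exists>a\<in>V. \<exists>b\<in>V. \<exists>c\<in>V. \<exists>d\<in>V. distinct [a, b, c, d] \<and>
      {a, b} \<in> E \<and> {a, c} \<in> E \<and> {a, d} \<in> E \<and> {b, c} \<in> E \<and> {b, d} \<in> E \<and> {c, d} \<notin> E)"

definition odd_hole :: "'a set \<Rightarrow> 'a set set \<Rightarrow> 'a list \<Rightarrow> bool" where
  "odd_hole V E vs \<longleftrightarrow> distinct vs \<and> set vs \<subseteq> V \<and> odd (length vs) \<and> length vs \<ge> 5 \<and>
     (\<forall>i < length vs. \<forall>j < length vs.
        ({vs ! i, vs ! j} \<in> E \<longleftrightarrow> (j = Suc i mod length vs \<or> i = Suc j mod length vs)))"

definition has_odd_hole :: "'a set \<Rightarrow> 'a set set \<Rightarrow> bool" where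
  "has_odd_hole V E \<longleftrightarrow> (\<exists>vs. odd_hole V E vs)"

definition cycle_edges :: "'a list \<Rightarrow> 'a set set" where
  "cycle_edges cs = {{cs ! i, cs ! (Suc i mod length cs)} | i. i < length cs}"

definition hamiltonian_list :: "'a set \<Rightarrow> 'a list \<Rightarrow> bool" where
  "hamiltonian_list V cs \<longleftrightarrow> distinct cs \<and> set cs = V \<and> length cs \<ge> 3"

definition rim_edges :: "'a set \<Rightarrow> 'a set set \<Rightarrow> 'a set set" where
  "rim_edges V E = {K. maximal_clique V E K \<and> card K = 2}"

definition inscribed :: "'a set \<Rightarrow> 'a set set \<Rightarrow> 'a set set" where
  "inscribed V E = {K. maximal_clique V E K \<and> card K \<noteq> 2}"

definition is_rim :: "'a set \<Rightarrow> 'a set set \<Rightarrow> 'a list \<Rightarrow> bool" where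
  "is_rim V E cs \<longleftrightarrow> hamiltonian_list V cs \<and> cycle_edges cs = rim_edges V E"

definition multisun :: "'a set \<Rightarrow> 'a set set \<Rightarrow> bool" where
  "multisun V E \<longleftrightarrow> simple_graph V E \<and> diamond_free V E \<and> odd (card V) \<and>
     inscribed V E \<noteq> {} \<and>
     (\<exists>cs. is_rim V E cs \<and>
        (\<forall>K\<in>inscribed V E. \<forall>u\<in>K. \<forall>v\<in>K. {u, v} \<notin> cycle_edges cs))"

definition sub_multisun :: "'a set \<Rightarrow> 'a set set \<Rightarrow> 'a set set \<Rightarrow> bool" where
  "sub_multisun V E E' \<longleftrightarrow> (\<exists>S. S \<subseteq> inscribed V E \<and> S \<noteq> {} \<and> S \<noteq> inscribed V E \<and>
      E' = E - {e. \<exists>K\<in>S. e \<subseteq> K})"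

definition HOH_free :: "'a set \<Rightarrow> 'a set set \<Rightarrow> bool" where
  "HOH_free V E \<longleftrightarrow> \<not> has_odd_hole V E \<and> (\<forall>E'. sub_multisun V E E' \<longrightarrow> \<not> has_odd_hole V E')"

definition rim_path :: "'a list \<Rightarrow> 'a list \<Rightarrow> bool" where
  "rim_path cs P \<longleftrightarrow> (\<exists>i < length cs. \<exists>l. 2 \<le> l \<and> l \<le> length cs \<and>
     (P = map (\<lambda>j. cs ! ((i + j) mod length cs)) [0..<l] \<or>
      P = rev (map (\<lambda>j. cs ! ((i + j) mod length cs)) [0..<l])))"

definition path_between :: "'a list \<Rightarrow> 'a set set \<Rightarrow> 'a set \<Rightarrow> 'a set \<Rightarrow> 'a list \<Rightarrow> bool" where
  "path_between cs I X Y P \<longleftrightarrow> rim_path cs P \<and>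
     ((hd P \<in> X \<and> last P \<in> Y) \<or> (hd P \<in> Y \<and> last P \<in> X)) \<and>
     (\<forall>x\<in>set (butlast (tl P)). \<forall>K\<in>I. x \<notin> K)"

definition N_conditions :: "'a set \<Rightarrow> 'a set set \<Rightarrow> bool" where
  "N_conditions V E \<longleftrightarrow> (\<exists>cs. is_rim V E cs \<and>
     \<comment> \<open>N1: A-paths\<close>
     (\<forall>A\<in>inscribed V E. \<forall>P. path_between cs (inscribed V E) A A P \<longrightarrow>
         even (length P) \<and> length P \<ge> 4) \<and>
     \<comment> \<open>N2\<close>
     (\<forall>A\<in>inscribed V E. odd (card A)) \<and>
     (\<exists>\<xi>\<in>set cs.
        \<comment> \<open>N3\<close>
        (\<forall>A\<in>inscribed V E. \<xi> \<in> A) \<and>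
        (\<forall>A\<in>inscribed V E. \<forall>B\<in>inscribed V E. A \<noteq> B \<longrightarrow> A \<inter> B = {\<xi>}) \<and>
        \<comment> \<open>N4: A-xi-paths\<close>
        (\<forall>A\<in>inscribed V E. \<forall>P. path_between cs (inscribed V E) A {\<xi>} P \<longrightarrow> even (length P))) \<and>
     \<comment> \<open>N5: AB-paths for distinct A, B (endpoints other than the shared vertex)\<close>
     (\<forall>A\<in>inscribed V E. \<forall>B\<in>inscribed V E. A \<noteq> B \<longrightarrow>
        (\<forall>P. path_between cs (inscribed V E) (A - B) (B - A) P \<longrightarrow> odd (length P))))"

definition sunoid :: "'a set \<Rightarrow> 'a set set \<Rightarrow> bool" where
  "sunoid V E \<longleftrightarrow> multisun V E \<and> N_conditions V E \<and>
     (\<forall>E'. sub_multisun V E E' \<longrightarrow> N_conditions V E')"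

datatype letter = Eps | Sig | Let nat

definition eps_step :: "letter list \<Rightarrow> letter list \<Rightarrow> bool" where
  "eps_step u v \<longleftrightarrow> (\<exists>x y. u = x @ [Eps, Eps] @ y \<and> v = x @ y)"

definition pattern :: "letter list \<Rightarrow> letter list" where
  "pattern w = (THE p. eps_step\<^sup>*\<^sup>* w p \<and> \<not> (\<exists>x y. p = x @ [Eps, Eps] @ y))"

definition cyc_equiv :: "letter list \<Rightarrow> letter list \<Rightarrow> bool" where
  "cyc_equiv v w \<longleftrightarrow> (\<exists>k. w = rotate k v \<or> w = rev (rotate k v))"

definition word_approx :: "letter list \<Rightarrow> letter list \<Rightarrow> bool" where
  "word_approx u v \<longleftrightarrow> cyc_equiv (pattern u) (pattern v)"

definition vertex_label :: "'a set \<Rightarrow> 'a set set \<Rightarrow> ('a set \<Rightarrow> nat) \<Rightarrow> 'a \<Rightarrow> letter" where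
  "vertex_label V E f v =
     (let Ks = {K\<in>inscribed V E. v \<in> K} in
        if Ks = {} then Eps
        else if (\<exists>K. Ks = {K}) then Let (f (the_elem Ks))
        else Sig)"

text \<open>w is a representative of the s-word of (V,E): read off around the rim from some
  start in some direction, for some choice of distinct letters.\<close>
definition sword_rep :: "'a set \<Rightarrow> 'a set set \<Rightarrow> letter list \<Rightarrow> bool" where
  "sword_rep V E w \<longleftrightarrow> (\<exists>cs f. is_rim V E cs \<and> inj_on f (inscribed V E) \<and>
      w = map (vertex_label V E f) cs)"

text \<open>A sunword: the s-word of some sunoid (any finite graph is isomorphic to one on nat).\<close>
definition sunword :: "letter list \<Rightarrow> bool" where
  "sunword w \<longleftrightarrow> (\<exists>(V :: nat set) E w'. sunoid V E \<and> sword_rep V E w' \<and> word_approx w' w)"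

end

theory Submission
  imports Defs
begin

text \<open>
  Deleting the edges of some inscribed cliques leaves the rim unchanged, so being a sunoid and being
  HOH-free are both conditions on all nonempty subfamilies of the inscribed cliques.

  HOH-free implies sunoid: an \<open>A\<close>-path closed by an edge of \<open>A\<close>, and an \<open>AB\<close>-path closed through the
  common vertex \<open>\<xi>\<close>, are holes. If \<open>A\<close> and \<open>B\<close> were disjoint, any two \<open>AB\<close>-paths with disjoint ends
  would have the same parity, whereas two sharing an end have different parities; counting along the
  rim of odd length shows that both parities occur, which forces \<open>|A| \<le> 2\<close> or \<open>|B| \<le> 2\<close>. Three pairwise
  intersecting cliques share a vertex since a triangle lies in one maximal clique.

  Sunoid implies HOH-free: cut the rim at \<open>\<xi>\<close>. For two cliques, with \<open>A\<close> occurring first, every vertex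
  of \<open>A\<close> is preceded by an even number of vertices of \<open>B\<close>, and every vertex of \<open>B\<close> by an odd number
  of vertices of \<open>A\<close>. So if \<open>A\<close>, \<open>B\<close>, \<open>C\<close> occur first in this order, \<open>B\<close> separates each vertex of \<open>A\<close>
  from each vertex of \<open>C\<close>. In an odd hole avoiding \<open>\<xi>\<close>, both rim segments leaving the outermost used
  clique thus end in the same clique and already close up to a cycle, which is even.

  For two or more cliques, the word read from \<open>\<sigma>\<close> determines (N1) and (N5) for each subfamily, and
  deleting \<open>\<epsilon>\<epsilon>\<close> does not affect them.
\<close>

section \<open>Cyclic enumerations of the rim\<close>

text \<open>Unrolling the rim onto the natural numbers makes a rim path an interval of positions and
  a full turn an addition of \<open>n\<close>, so parity arguments become counts over a window of
  length \<open>n\<close>. As \<xi> lies in every inscribed clique, no gap passes over it; cutting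
  there turns the cyclic conditions into linear ones without losing any. The conditions on
  subfamilies enter because a rim segment of a hole can run through vertices of cliques that
  contribute no edge to the hole. Only after deleting those cliques do these vertices count as
  internal ones of a path. A hole through \<xi> is of another kind: every clique vertex is adjacent
  to \<xi>, so such a hole is \<xi> together with a single rim path. A word contains \<sigma> only
  if there are at least two inscribed cliques. With one clique there is no proper nonempty
  subfamily, and the N-conditions decide alone. Finally, a sunword has to come from a graph on
  natural numbers, so a sunoid over another type is first copied along an injection.\<close>

text \<open>Throughout, a sequence \<open>c\<close> on the natural numbers, periodic modulo the order \<open>n\<close>,
  enumerates the rim.\<close>
definition rim_adj :: "(nat \<Rightarrow> 'a) \<Rightarrow> 'a \<Rightarrow> 'a \<Rightarrow> bool" where
  "rim_adj c u v \<longleftrightarrow> (\<exists>i. {u, v} = {c i, c (Suc i)})"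

definition adj :: "(nat \<Rightarrow> 'a) \<Rightarrow> 'a set set \<Rightarrow> 'a \<Rightarrow> 'a \<Rightarrow> bool" where
  "adj c F u v \<longleftrightarrow> rim_adj c u v \<or> u \<noteq> v \<and> (\<exists>A\<in>F. u \<in> A \<and> v \<in> A)"

text \<open>Only pairs \<open>i < j\<close> are listed. Symmetry and irreflexivity supply the
  others, and the closing edge becomes an explicit exception instead of a modular index.\<close>

definition ohole :: "('a \<Rightarrow> 'a \<Rightarrow> bool) \<Rightarrow> 'a list \<Rightarrow> bool" where
  "ohole R vs \<longleftrightarrow> distinct vs \<and> odd (length vs) \<and> 5 \<le> length vs \<and>
     (\<forall>i j. i < j \<and> j < length vs \<longrightarrow>
        (R (vs ! i) (vs ! j) \<longleftrightarrow> j = Suc i \<or> i = 0 \<and> Suc j = length vs))"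

text \<open>The number \<open>d\<close> counts edges, so the path has \<open>d + 1\<close> vertices
  and every parity in the N-conditions is flipped.\<close>

definition gap :: "(nat \<Rightarrow> 'a) \<Rightarrow> 'a set set \<Rightarrow> nat \<Rightarrow> nat \<Rightarrow> bool" where
  "gap c F i d \<longleftrightarrow> 0 < d \<and> c i \<in> \<Union>F \<and> c (i + d) \<in> \<Union>F \<and> (\<forall>t. 0 < t \<and> t < d \<longrightarrow> c (i + t) \<notin> \<Union>F)"

text \<open>The N-conditions in terms of positions along the rim. (N4) is omitted because it is an
  instance of (N1), the common vertex lying in every clique; the bound of four vertices in (N1) is
  automatic because vertices of an inscribed clique are not consecutive on the rim.\<close>
definition npos :: "nat \<Rightarrow> (nat \<Rightarrow> 'a) \<Rightarrow> 'a set set \<Rightarrow> bool" where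
  "npos n c F \<longleftrightarrow>
     (\<forall>A\<in>F. \<forall>i d. gap c F i d \<and> d < n \<and> c i \<in> A \<and> c (i + d) \<in> A \<longrightarrow> odd d) \<and>
     (\<forall>A\<in>F. odd (card A)) \<and>
     (\<exists>\<xi>\<in>range c. \<forall>A\<in>F. \<xi> \<in> A \<and> (\<forall>B\<in>F. A \<noteq> B \<longrightarrow> A \<inter> B = {\<xi>})) \<and>
     (\<forall>A\<in>F. \<forall>B\<in>F. \<forall>i d. A \<noteq> B \<and> gap c F i d \<and> d < n \<and> c i \<in> A - B \<and> c (i + d) \<in> B - A
        \<longrightarrow> even d)"

lemma npos_odd:
  assumes "npos n c F" "A \<in> F" "gap c F i d" "d < n" "c i \<in> A" "c (i + d) \<in> A"
  shows "odd d"
  using assms(1)[unfolded npos_def, THEN conjunct1, rule_format, of A i d] assms(2-) by blast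

lemma npos_even:
  assumes "npos n c F" "A \<in> F" "B \<in> F" "A \<noteq> B" "gap c F i d" "d < n" "c i \<in> A - B" "c (i + d) \<in> B - A"
  shows "even d"
  using assms(1)[unfolded npos_def, THEN conjunct2, THEN conjunct2, THEN conjunct2, rule_format, of A B i d]
    assms(2-) by blast

lemma npos_card: "npos n c F \<Longrightarrow> \<forall>A\<in>F. odd (card A)"
  unfolding npos_def by (elim conjE)

lemma npos_common:
  "npos n c F \<Longrightarrow> \<exists>\<xi>\<in>range c. \<forall>A\<in>F. \<xi> \<in> A \<and> (\<forall>B\<in>F. A \<noteq> B \<longrightarrow> A \<inter> B = {\<xi>})"
  unfolding npos_def by (elim conjE)

text \<open>With \<open>\<delta> = 0\<close> all gaps are odd; a nonzero \<open>\<delta>\<close> marks the points on one side of an even gap.\<close>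
lemma gap_parity:
  fixes P :: "nat \<Rightarrow> bool" and \<delta> :: "nat \<Rightarrow> nat"
  assumes "P 0"
    and step: "\<And>i j. i < j \<Longrightarrow> j \<le> m \<Longrightarrow> P i \<Longrightarrow> P j \<Longrightarrow> (\<And>t. i < t \<Longrightarrow> t < j \<Longrightarrow> \<not> P t) \<Longrightarrow>
      odd (j - i + \<delta> i + \<delta> j)"
  shows "P y \<Longrightarrow> y \<le> m \<Longrightarrow> even (y + card {t. 0 < t \<and> t \<le> y \<and> P t} + \<delta> 0 + \<delta> y)"
proof (induction y rule: less_induct)
  case (less y)
  show ?case
  proof (cases "y = 0")
    case True
    have "{t. 0 < t \<and> t \<le> y \<and> P t} = {}" using True by auto
    then have "card {t. 0 < t \<and> t \<le> y \<and> P t} = 0" by (simp only: card.empty)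
    then show ?thesis unfolding True by presburger
  next
    case False
    define x where "x = Max {t. t < y \<and> P t}"
    have fin: "finite {t. t < y \<and> P t}" by simp
    have ne: "{t. t < y \<and> P t} \<noteq> {}" using False \<open>P 0\<close> by auto
    have x: "x < y" "P x" using Max_in[OF fin ne] unfolding x_def by auto
    have nb: "\<not> P t" if "x < t" "t < y" for t
    proof
      assume "P t"
      then have "t \<le> x" unfolding x_def using that by (intro Max_ge[OF fin]) auto
      then show False using that by simp
    qed
    have IH: "even (x + card {t. 0 < t \<and> t \<le> x \<and> P t} + \<delta> 0 + \<delta> x)"
      using less x by auto
    have st: "odd (y - x + \<delta> x + \<delta> y)"
      using step[OF \<open>x < y\<close> _ \<open>P x\<close> \<open>P y\<close>] nb less.prems by auto
    have "{t. 0 < t \<and> t \<le> y \<and> P t} = insert y {t. 0 < t \<and> t \<le> x \<and> P t}"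
      using x nb less.prems False by (auto simp: not_le) (meson le_neq_implies_less not_le)
    then have "card {t. 0 < t \<and> t \<le> y \<and> P t} = Suc (card {t. 0 < t \<and> t \<le> x \<and> P t})"
      using x by simp
    then show ?thesis using IH st x by (auto simp: even_diff_nat)
  qed
qed

section \<open>Nearest marked positions on either side\<close>

lemma prev_ex:
  fixes P :: "nat \<Rightarrow> bool"
  assumes "P a" "a < b"
  obtains x where "a \<le> x" "x < b" "P x" "\<And>t. x < t \<Longrightarrow> t < b \<Longrightarrow> \<not> P t"
proof -
  define S where "S = {t. t < b \<and> P t}"
  have fin: "finite S" unfolding S_def by simp
  have a: "a \<in> S" using assms unfolding S_def by auto
  then have "Max S \<in> S" "a \<le> Max S" using Max_in[OF fin] Max_ge[OF fin a] by blast+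
  moreover have "\<not> P t" if "Max S < t" "t < b" for t
  proof
    assume "P t"
    then have "t \<le> Max S" using that unfolding S_def[symmetric] by (intro Max_ge[OF fin]) (auto simp: S_def)
    then show False using that by simp
  qed
  ultimately show ?thesis using that unfolding S_def by blast
qed

lemma next_ex:
  fixes P :: "nat \<Rightarrow> bool"
  assumes "P b" "a < b"
  obtains x where "a < x" "x \<le> b" "P x" "\<And>t. a < t \<Longrightarrow> t < x \<Longrightarrow> \<not> P t"
proof -
  define x where "x = (LEAST t. a < t \<and> P t)"
  have "a < x \<and> P x" unfolding x_def by (rule LeastI[of _ b]) (use assms in auto)
  moreover have "x \<le> b" unfolding x_def by (rule Least_le) (use assms in auto)
  moreover have "\<not> P t" if "a < t" "t < x" for t
    using not_less_Least[of t "\<lambda>t. a < t \<and> P t"] that unfolding x_def by auto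
  ultimately show ?thesis using that by auto
qed

section \<open>Periodic enumerations of an odd cycle\<close>

locale rim =
  fixes n :: nat and c :: "nat \<Rightarrow> 'a"
  assumes n_odd: "odd n" and n_ge: "3 \<le> n"
    and c_eq_iff: "c i = c j \<longleftrightarrow> i mod n = j mod n"
begin

lemma c_add_n [simp]: "c (i + n) = c i" "c (n + i) = c i" "c n = c 0"
  by (simp_all add: c_eq_iff)

lemma c_add_mult [simp]: "c (i + k * n) = c i"
  by (simp add: c_eq_iff)

lemma c_mod: "c (i mod n) = c i"
  by (simp add: c_eq_iff)

lemma c_neq:
  assumes "i < j" "j < i + n"
  shows "c i \<noteq> c j"
proof
  assume "c i = c j"
  then have "n dvd j - i" using assms by (metis c_eq_iff less_imp_le_nat mod_eq_dvd_iff_nat)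
  moreover have "0 < j - i" "j - i < n" using assms by auto
  ultimately show False by (simp add: nat_dvd_not_less)
qed

lemma rim_adj_near:
  assumes "i < j" "j < i + n"
  shows "rim_adj c (c i) (c j) \<longleftrightarrow> j = Suc i \<or> Suc j = i + n"
proof
  assume "rim_adj c (c i) (c j)"
  then obtain k where k: "{c i, c j} = {c k, c (Suc k)}" unfolding rim_adj_def by auto
  then consider "c i = c k" "c j = c (Suc k)" | "c j = c k" "c i = c (Suc k)"
    by (auto simp: doubleton_eq_iff)
  then show "j = Suc i \<or> Suc j = i + n"
  proof cases
    case 1
    then have "c j = c (Suc i)" by (metis c_eq_iff mod_Suc_eq)
    moreover have "c (Suc i) \<noteq> c j" if "j \<noteq> Suc i"
      by (rule c_neq) (use that assms in auto)
    ultimately show ?thesis by auto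
  next
    case 2
    then have "c (Suc j) = c (i + n)" unfolding c_add_n by (metis c_eq_iff mod_Suc_eq)
    moreover have "c (Suc j) \<noteq> c (i + n)" if "Suc j \<noteq> i + n"
      by (rule c_neq) (use that assms in auto)
    ultimately show ?thesis by auto
  qed
next
  assume "j = Suc i \<or> Suc j = i + n"
  then show "rim_adj c (c i) (c j)"
  proof
    assume "Suc j = i + n"
    then have "c (Suc j) = c i" by simp
    then have "{c i, c j} = {c j, c (Suc j)}" by auto
    then show ?thesis unfolding rim_adj_def by blast
  qed (auto simp: rim_adj_def)
qed

lemma rotate: "rim n (\<lambda>i. c (i + k))"
  proof unfold_locales
  fix i j
  have "(i + k) mod n = (j + k) mod n \<longleftrightarrow> i mod n = j mod n"
    by (simp add: nat_mod_eq_iff)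
  then show "c (i + k) = c (j + k) \<longleftrightarrow> i mod n = j mod n" by (simp add: c_eq_iff)
qed (use n_odd n_ge in auto)

lemma range_rotate: "range (\<lambda>i. c (i + k)) = range c"
proof -
  have "c i \<in> range (\<lambda>i. c (i + k))" for i
  proof -
    \<comment> \<open>Going \<open>k\<close> steps back is going \<open>k * (n - 1)\<close> steps
      forward, since the two shifts together make \<open>k\<close> full turns.\<close>
    have "i + k * (n - 1) + k = i + k * n" using n_ge by (cases n) auto
    then have "c i = c (i + k * (n - 1) + k)" by (metis c_add_mult)
    then show ?thesis by auto
  qed
  then show ?thesis by auto
qed

lemma rim_adj_rotate: "rim_adj (\<lambda>i. c (i + k)) = rim_adj c"
proof -
  have "\<exists>j. {c i, c (Suc i)} = {c (j + k), c (Suc j + k)}" for i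
  proof -
    have "i + k * (n - 1) + k = i + k * n" using n_ge by (cases n) auto
    then have "c i = c (i + k * (n - 1) + k)" "c (Suc i) = c (Suc (i + k * (n - 1)) + k)"
      by (metis c_add_mult add_Suc)+
    then show ?thesis by metis
  qed
  then show ?thesis unfolding rim_adj_def fun_eq_iff by (metis add_Suc)
qed

lemma adj_rotate: "adj (\<lambda>i. c (i + k)) F = adj c F"
  unfolding adj_def fun_eq_iff rim_adj_rotate by auto

lemma gap_mod: "gap c F (i mod n) d = gap c F i d"
proof -
  have "c (i mod n + t) = c (i + t)" for t by (simp add: c_eq_iff mod_add_left_eq)
  moreover have "c (i mod n) = c i" by (simp add: c_eq_iff)
  ultimately show ?thesis unfolding gap_def by simp
qed

lemma gap_rotate: "gap (\<lambda>i. c (i + k)) F i d = gap c F (i + k) d"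
  by (auto simp: gap_def ac_simps)

text \<open>Serves to find a given vertex or rim path again in the turn that begins at a chosen
  position \<open>k\<close>.\<close>

lemma obtain_shift:
  obtains j where "\<And>t. c (j + k + t) = c (i + t)"
proof -
  have "i + k * (n - 1) + k = i + k * n" using n_ge by (cases n) auto
  then have "c (i + k * (n - 1) + k + t) = c (i + t)" for t
    by (metis c_add_mult add.assoc add.commute)
  then show ?thesis using that by blast
qed

lemma npos_rotate_imp:
  assumes "npos n c F"
  shows "npos n (\<lambda>i. c (i + k)) F"
proof -
  have eq: "c (i + d + k) = c ((i + k) + d)" for i d by (simp add: ac_simps)
  note 1 = npos_odd[OF assms] and 2 = npos_even[OF assms]
  note 3 = assms[unfolded npos_def, THEN conjunct2, THEN conjunct1]
    assms[unfolded npos_def, THEN conjunct2, THEN conjunct2, THEN conjunct1]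
  show ?thesis
    unfolding npos_def gap_rotate range_rotate eq
    by (intro conjI 3 ballI allI impI; elim conjE) (rule 1 2; assumption)+
qed

lemma npos_rotate: "npos n (\<lambda>i. c (i + k)) F = npos n c F"
proof
  interpret r: rim n "\<lambda>i. c (i + k)" by (rule rotate)
  have "i + k * (n - 1) + k = i + k * n" for i using n_ge by (cases n) auto
  then have "(\<lambda>i. c (i + k * (n - 1) + k)) = c" by (simp only: c_add_mult)
  then show "npos n (\<lambda>i. c (i + k)) F \<Longrightarrow> npos n c F"
    using r.npos_rotate_imp[of F "k * (n - 1)"] by simp
qed (rule npos_rotate_imp)

text \<open>The window runs from \<open>1\<close> to \<open>n\<close> to match
  \<open>gap_parity\<close>: the vertex at position \<open>0\<close> is counted once, as its
  repetition at \<open>n\<close>.\<close>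

lemma card_positions:
  assumes "A \<subseteq> range c"
  shows "card {t. 0 < t \<and> t \<le> n \<and> c t \<in> A} = card A"
proof -
  have inj: "inj_on c {t. 0 < t \<and> t \<le> n \<and> c t \<in> A}"
  proof (rule inj_onI)
    fix x y assume *: "x \<in> {t. 0 < t \<and> t \<le> n \<and> c t \<in> A}" "y \<in> {t. 0 < t \<and> t \<le> n \<and> c t \<in> A}" "c x = c y"
    show "x = y"
      using c_neq[of x y] c_neq[of y x] * by (cases x y rule: linorder_cases) auto
  qed
  have "c ` {t. 0 < t \<and> t \<le> n \<and> c t \<in> A} = A"
  proof -
    have "u \<in> c ` {t. 0 < t \<and> t \<le> n \<and> c t \<in> A}" if "u \<in> A" for u
    proof -
      have "u \<in> range c" using that assms by blast
      then obtain i where i: "u = c i" by auto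
      show ?thesis
      proof (cases "i mod n = 0")
        case True
        then have "u = c n" using i by (simp add: c_eq_iff)
        moreover have "n \<in> {t. 0 < t \<and> t \<le> n \<and> c t \<in> A}" using that n_ge \<open>u = c n\<close> by auto
        ultimately show ?thesis by blast
      next
        case False
        have "u = c (i mod n)" "i mod n \<le> n" using i n_ge by (simp_all add: c_mod less_imp_le)
        then show ?thesis using that False by auto
      qed
    qed
    then show ?thesis by auto
  qed
  then show ?thesis using card_image[OF inj] by simp
qed

end

text \<open>What the combinatorial part uses of a multisun: \<open>meet\<close> and
  \<open>tri\<close> express diamond-freeness, \<open>indep\<close> that inscribed cliques avoid
  consecutive rim vertices. All of it passes to subfamilies, so every sub-multisun is an instance
  over the same rim.\<close>

locale sun = rim n c for n :: nat and c :: "nat \<Rightarrow> 'a" +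
  fixes I :: "'a set set"
  assumes sub: "A \<in> I \<Longrightarrow> A \<subseteq> range c"
    and card3: "A \<in> I \<Longrightarrow> 3 \<le> card A"
    and meet: "A \<in> I \<Longrightarrow> B \<in> I \<Longrightarrow> u \<in> A \<Longrightarrow> u \<in> B \<Longrightarrow> v \<in> A \<Longrightarrow> v \<in> B \<Longrightarrow> u \<noteq> v \<Longrightarrow> A = B"
    and indep: "A \<in> I \<Longrightarrow> c i \<in> A \<Longrightarrow> c (Suc i) \<notin> A"
    and tri: "adj c I u v \<Longrightarrow> adj c I v w \<Longrightarrow> adj c I u w \<Longrightarrow> u \<noteq> v \<Longrightarrow> v \<noteq> w \<Longrightarrow> u \<noteq> w \<Longrightarrow>
      \<exists>A\<in>I. u \<in> A \<and> v \<in> A \<and> w \<in> A"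
begin

lemma indep': "A \<in> I \<Longrightarrow> u \<in> A \<Longrightarrow> v \<in> A \<Longrightarrow> \<not> rim_adj c u v"
  unfolding rim_adj_def using indep by (auto simp: doubleton_eq_iff)

lemma rotate_sun: "sun n (\<lambda>i. c (i + k)) I"
proof -
  interpret r: rim n "\<lambda>i. c (i + k)" by (rule rotate)
  show ?thesis
    by unfold_locales (use range_rotate adj_rotate sub card3 meet tri indep in auto)
qed

text \<open>Only \<open>tri\<close> needs an argument. Two vertices of the triangle lie in a clique
  \<open>A\<close> of \<open>I\<close>, so they are not rim neighbours; their adjacency then comes
  from a clique of \<open>F\<close>, which is \<open>A\<close> by \<open>meet\<close>.\<close>

lemma subset_sun:
  assumes "F \<subseteq> I"
  shows "sun n c F"
proof unfold_locales
  fix u v w assume *: "adj c F u v" "adj c F v w" "adj c F u w" "u \<noteq> v" "v \<noteq> w" "u \<noteq> w"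
  then have "adj c I u v" "adj c I v w" "adj c I u w" using assms unfolding adj_def by blast+
  then obtain A where A: "A \<in> I" "u \<in> A" "v \<in> A" "w \<in> A" using tri *(4-6) by metis
  then have "A \<in> F" using *(1,4) indep'[OF A(1,2,3)] meet[of A _ u v] assms unfolding adj_def by blast
  then show "\<exists>A\<in>F. u \<in> A \<and> v \<in> A \<and> w \<in> A" using A by auto
next
  show "A \<in> F \<Longrightarrow> A \<subseteq> range c" "A \<in> F \<Longrightarrow> 3 \<le> card A" for A
    using assms sub card3 by blast+
  show "A = B" if "A \<in> F" "B \<in> F" "u \<in> A" "u \<in> B" "v \<in> A" "v \<in> B" "u \<noteq> v" for A B u v
    using meet[of A B u v] assms that by blast
  show "A \<in> F \<Longrightarrow> c i \<in> A \<Longrightarrow> c (Suc i) \<notin> A" for A i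
    using assms indep by blast
qed

lemma gap_odd:
  assumes nh: "\<And>vs. \<not> ohole (adj c I) vs" and g: "gap c I i d" "d < n"
    and A: "A \<in> I" "c i \<in> A" "c (i + d) \<in> A"
  shows "odd d"
proof (rule ccontr)
  assume "\<not> odd d"
  have inner: "c (i + t) \<notin> B" if "0 < t" "t < d" "B \<in> I" for t B
    using g that unfolding gap_def by auto
  have ne: "c (i + j) \<noteq> c (i + k)" if "j < k" "k \<le> d" for j k
    using c_neq[of "i + j" "i + k"] that g(2) by auto
  \<comment> \<open>For \<open>d = 2\<close> the closed path is a triangle and no hole; here
    \<open>tri\<close> puts the middle vertex into a clique, although it is inside a gap.\<close>
  have "d \<noteq> 2"
  proof
    assume d: "d = 2"
    have "adj c I (c i) (c (Suc i))" "adj c I (c (Suc i)) (c (i + d))"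
      using d rim_adj_near[of i "Suc i"] rim_adj_near[of "Suc i" "i + d"] n_ge unfolding adj_def by auto
    moreover have "adj c I (c i) (c (i + d))" using A ne[of 0 d] d unfolding adj_def by auto
    ultimately obtain B where "B \<in> I" "c (Suc i) \<in> B"
      using tri[of "c i" "c (Suc i)" "c (i + d)"] ne[of 0 1] ne[of 1 2] ne[of 0 2] d by auto
    then show False using inner[of 1 B] d by auto
  qed
  moreover have "0 < d" using g unfolding gap_def by blast
  ultimately have d: "4 \<le> d" using \<open>\<not> odd d\<close> by presburger
  \<comment> \<open>With \<open>d = n - 1\<close> the ends would be rim neighbours inside
    \<open>A\<close>. Excluding this also rules out a rim edge that wraps around and becomes a
    chord.\<close>
  have far: "Suc d \<noteq> n"
  proof
    assume "Suc d = n"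
    then have "c (Suc (i + d)) = c i" by (metis add_Suc_right c_add_n(1))
    then show False using indep[OF A(1,3)] A by auto
  qed
  define vs where "vs = map (\<lambda>j. c (i + j)) [0..<Suc d]"
  have nth: "vs ! j = c (i + j)" if "j \<le> d" for j
    using that unfolding vs_def by (auto simp del: upt_Suc)
  have len: "length vs = Suc d" unfolding vs_def by simp
  have "distinct vs"
    unfolding distinct_conv_nth len by (metis linorder_neqE_nat ne nth less_Suc_eq_le)
  moreover have "adj c I (vs ! j) (vs ! k) \<longleftrightarrow> k = Suc j \<or> j = 0 \<and> Suc k = length vs"
    if "j < k" "k < length vs" for j k
  proof -
    have k: "k \<le> d" using that len by auto
    have "rim_adj c (c (i + j)) (c (i + k)) \<longleftrightarrow> k = Suc j"
      using rim_adj_near[of "i + j" "i + k"] that k far g(2) by auto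
    moreover have "(\<exists>B\<in>I. c (i + j) \<in> B \<and> c (i + k) \<in> B) \<longleftrightarrow> j = 0 \<and> k = d"
      using A inner[of j] inner[of k] that k by (auto simp: le_less)
    ultimately show ?thesis using that k ne[OF that(1) k] by (simp add: adj_def nth len)
  qed
  ultimately have "ohole (adj c I) vs"
    using d \<open>\<not> odd d\<close> unfolding ohole_def len by auto
  then show False using nh by blast
qed

lemma cross_gap_even:
  assumes nh: "\<And>vs. \<not> ohole (adj c I) vs" and g: "gap c I i d" "d < n"
    and A: "A \<in> I" "B \<in> I" "A \<noteq> B" "c i \<in> A - {\<xi>}" "c (i + d) \<in> B - {\<xi>}"
    and xi: "\<And>A. A \<in> I \<Longrightarrow> \<xi> \<in> A"
  shows "even d"
proof (rule ccontr)
  assume "odd d"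
  have inner: "c (i + t) \<notin> C" if "0 < t" "t < d" "C \<in> I" for t C
    using g that unfolding gap_def by auto
  have ne: "c (i + j) \<noteq> c (i + k)" if "j < k" "k \<le> d" for j k
    using c_neq[of "i + j" "i + k"] that g(2) by auto
  have xiout: "c (i + j) \<noteq> \<xi>" if "j \<le> d" for j
    using inner[of j A] xi[OF A(1)] A that by (cases "j = 0 \<or> j = d") auto
  have common: "False" if "C \<in> I" "c i \<in> C" "c (i + d) \<in> C" for C
    using meet[OF that(1) A(1), of \<xi> "c i"] meet[OF that(1) A(2), of \<xi> "c (i + d)"] xi A that by auto
  \<comment> \<open>For \<open>d = 1\<close> the ends form a triangle with \<xi>. The clique
    containing it shares \<xi> and one end with each of \<open>A\<close> and \<open>B\<close>, hence
    equals both.\<close>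
  have "d \<noteq> 1"
  proof
    assume d: "d = 1"
    have "adj c I (c i) (c (i + d))" using d rim_adj_near[of i "i + d"] n_ge unfolding adj_def by auto
    moreover have "adj c I (c (i + d)) \<xi>" "adj c I (c i) \<xi>" using A xi unfolding adj_def by auto
    ultimately show False using tri[of "c i" "c (i + d)" \<xi>] common A ne[of 0 d] d by auto
  qed
  then have d: "3 \<le> d" using \<open>odd d\<close> by presburger
  obtain m where m: "\<xi> = c m" using xi[OF A(1)] sub[OF A(1)] by auto
  \<comment> \<open>The offset of \<xi> from the start of the gap. Once \<open>d < x < n\<close> is
    known, only the two ends of the path can be rim neighbours of \<xi>.\<close>
  obtain x where x: "\<xi> = c (i + x)" "x < n"
  proof -
    obtain j where j: "c (j + i + t) = c (m + t)" for t using obtain_shift by blast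
    have "c (i + j mod n) = c (j + i)" by (simp add: c_eq_iff mod_add_right_eq add.commute)
    also have "\<dots> = \<xi>" using j[of 0] m by simp
    finally show ?thesis using that[of "j mod n"] n_ge by auto
  qed
  have "d < x" using xiout[of x] x by (cases "x \<le> d") auto
  define vs where "vs = map (\<lambda>j. c (i + j)) [0..<Suc d] @ [\<xi>]"
  have nth: "vs ! j = c (i + j)" if "j \<le> d" for j
    using that unfolding vs_def by (auto simp: nth_append simp del: upt_Suc)
  have nthl: "vs ! (Suc d) = \<xi>" unfolding vs_def by (auto simp: nth_append simp del: upt_Suc)
  have len: "length vs = Suc (Suc d)" unfolding vs_def by simp
  have "vs ! j \<noteq> vs ! k" if "j < k" "k < length vs" for j k
  proof (cases "k = Suc d")
    case True then show ?thesis using xiout[of j] nth[of j] nthl that by auto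
  next
    case False then show ?thesis using ne[of j k] nth[of j] nth[of k] len that by auto
  qed
  then have "distinct vs"
    unfolding distinct_conv_nth by (metis linorder_neqE_nat)
  moreover have "adj c I (vs ! j) (vs ! k) \<longleftrightarrow> k = Suc j \<or> j = 0 \<and> Suc k = length vs"
    if "j < k" "k < length vs" for j k
  proof (cases "k = Suc d")
    case True
    have j: "j \<le> d" using that True by auto
    have eq: "vs ! j = c (i + j)" "vs ! k = \<xi>" using nth[OF j] nthl True by auto
    show ?thesis
    proof (cases "j = 0 \<or> j = d")
      case True
      then have "adj c I (vs ! j) (vs ! k)" using A xi unfolding eq adj_def by auto
      then show ?thesis using True \<open>k = Suc d\<close> len by auto
    next
      case False
      have "\<not> rim_adj c (c (i + j)) (c (i + x))"
        using rim_adj_near[of "i + j" "i + x"] False j \<open>d < x\<close> x(2) by auto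
      moreover have "c (i + j) \<notin> C" if "C \<in> I" for C using inner[of j C] False j that by auto
      ultimately show ?thesis using x False \<open>k = Suc d\<close> unfolding eq adj_def by auto
    qed
  next
    case False
    then have k: "k \<le> d" using that len by auto
    have "rim_adj c (c (i + j)) (c (i + k)) \<longleftrightarrow> k = Suc j"
      using rim_adj_near[of "i + j" "i + k"] that k \<open>d < x\<close> x(2) by auto
    moreover have "\<not> (\<exists>B\<in>I. c (i + j) \<in> B \<and> c (i + k) \<in> B)"
      using common inner[of j] inner[of k] that k by (cases "j = 0"; cases "k = d") auto
    ultimately show ?thesis using that k ne[OF that(1) k] by (auto simp add: adj_def nth len)
  qed
  ultimately have "ohole (adj c I) vs"
    using d \<open>odd d\<close> unfolding ohole_def len by auto
  then show False using nh by blast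
qed

end

section \<open>From hole-freeness to the N-conditions\<close>

lemma rim_adj_sym: "rim_adj c u v \<longleftrightarrow> rim_adj c v u"
  unfolding rim_adj_def by (simp add: insert_commute)

text \<open>An AB-path in the sub-multisun that keeps only \<open>A\<close> and \<open>B\<close>:
  vertices of other cliques may occur inside. Positions are not reduced modulo \<open>n\<close>, so
  a switch may cross the origin.\<close>

definition switch :: "(nat \<Rightarrow> 'a) \<Rightarrow> 'a set \<Rightarrow> 'a set \<Rightarrow> nat \<Rightarrow> nat \<Rightarrow> bool" where
  "switch c A B p q \<longleftrightarrow> p < q \<and> (c p \<in> A \<and> c q \<in> B \<or> c p \<in> B \<and> c q \<in> A) \<and>
     (\<forall>t. p < t \<and> t < q \<longrightarrow> c t \<notin> A \<union> B)"

lemma switch_sym: "switch c A B p q \<longleftrightarrow> switch c B A p q"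
  unfolding switch_def by auto

section \<open>Parities of the switches between two disjoint cliques\<close>

context sun
begin

lemma single_odd:
  assumes A: "A \<in> I" and nh: "\<And>vs. \<not> ohole (adj c {A}) vs"
    and ij: "i < j" "j \<le> i + n" "c i \<in> A" "c j \<in> A" "\<And>t. i < t \<Longrightarrow> t < j \<Longrightarrow> c t \<notin> A"
  shows "odd (j - i)"
proof (cases "j = i + n")
  case True then show ?thesis using n_odd by simp
next
  case False
  interpret S: sun n c "{A}" by (rule subset_sun) (use A in simp)
  have j: "i + (j - i) = j" using ij by simp
  have "c (i + t) \<notin> A" if "0 < t" "t < j - i" for t using ij(5)[of "i + t"] that by simp
  then have "gap c {A} i (j - i)" using ij(1,3,4) j unfolding gap_def by auto
  then show ?thesis using S.gap_odd[OF nh, of i "j - i" A] j ij False by auto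
qed

text \<open>The gaps of \<open>A\<close> alone are odd and add up to the odd number
  \<open>n\<close>, so their number is odd, and there is one for each vertex of
  \<open>A\<close>.\<close>

lemma odd_card:
  assumes A: "A \<in> I" and nh: "\<And>vs. \<not> ohole (adj c {A}) vs"
  shows "odd (card A)"
proof -
  have "A \<noteq> {}" using card3[OF A] by auto
  then obtain k where k: "c k \<in> A" using sub[OF A] by blast
  interpret r: rim n "\<lambda>t. c (t + k)" by (rule rotate)
  define P where "P = (\<lambda>t. c (t + k) \<in> A)"
  have "even (n + card {t. 0 < t \<and> t \<le> n \<and> P t} + 0 + 0)"
  proof (rule gap_parity[of P n "\<lambda>_. 0" n])
    show "P 0" "P n" unfolding P_def using k by auto
    fix i j assume *: "i < j" "j \<le> n" "P i" "P j" "\<And>t. i < t \<Longrightarrow> t < j \<Longrightarrow> \<not> P t"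
    have "c t \<notin> A" if "i + k < t" "t < j + k" for t
      using *(5)[of "t - k"] that unfolding P_def by auto
    then show "odd (j - i + 0 + 0)"
      using single_odd[OF A nh, of "i + k" "j + k"] * unfolding P_def by auto
  qed auto
  moreover have "card {t. 0 < t \<and> t \<le> n \<and> P t} = card A"
    unfolding P_def by (rule r.card_positions) (use range_rotate sub[OF A] in auto)
  ultimately show ?thesis using n_odd by auto
qed

lemma switch_lt:
  assumes "switch c A B p q" "A \<inter> B = {}"
  shows "q < p + n"
proof (rule ccontr)
  assume "\<not> q < p + n"
  moreover have "c (p + n) \<in> A \<union> B" "q \<noteq> p + n" using assms unfolding switch_def by auto
  moreover have "p < p + n" using n_ge by simp
  ultimately show False using assms unfolding switch_def by (metis linorder_neqE_nat)
qed

lemma switch_shift: "switch c A B (p + n) (q + n) \<longleftrightarrow> switch c A B p q"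
proof -
  have "(\<forall>t. p + n < t \<and> t < q + n \<longrightarrow> c t \<notin> A \<union> B) \<longleftrightarrow> (\<forall>t. p < t \<and> t < q \<longrightarrow> c t \<notin> A \<union> B)"
  proof (intro iffI allI impI)
    fix t assume "\<forall>t. p + n < t \<and> t < q + n \<longrightarrow> c t \<notin> A \<union> B" "p < t \<and> t < q"
    then show "c t \<notin> A \<union> B" by (metis add_less_cancel_right c_add_n(1))
  next
    fix t assume *: "\<forall>t. p < t \<and> t < q \<longrightarrow> c t \<notin> A \<union> B" "p + n < t \<and> t < q + n"
    then have "p < t - n \<and> t - n < q" by linarith
    then have "c (t - n + n) \<notin> A \<union> B" using *(1) unfolding c_add_n by blast
    then show "c t \<notin> A \<union> B" using *(2) by simp
  qed
  then show ?thesis unfolding switch_def by simp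
qed

text \<open>If the two paths have no rim edge between them, they form a hole together with one edge of \<open>A\<close>
  and one of \<open>B\<close>; otherwise the gaps of the single cliques \<open>A\<close> and \<open>B\<close> force both parities.\<close>
lemma switches_parity_aux:
  assumes AB: "A \<in> I" "B \<in> I" "A \<inter> B = {}"
    and nhA: "\<And>vs. \<not> ohole (adj c {A}) vs" and nhB: "\<And>vs. \<not> ohole (adj c {B}) vs"
    and nhAB: "\<And>vs. \<not> ohole (adj c {A, B}) vs"
    and sw: "switch c A B p q" "switch c A B r s" "q < r" "s < p + n"
    and pA: "c p \<in> A"
  shows "even (q - p) = even (s - r)"
proof -
  have qB: "c q \<in> B" and pq: "p < q" "\<And>t. p < t \<Longrightarrow> t < q \<Longrightarrow> c t \<notin> A \<union> B"
    using sw(1) pA AB(3) unfolding switch_def by auto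
  have rs: "r < s" "\<And>t. r < t \<Longrightarrow> t < s \<Longrightarrow> c t \<notin> A \<union> B"
    "c r \<in> A \<and> c s \<in> B \<or> c r \<in> B \<and> c s \<in> A"
    using sw(2) unfolding switch_def by auto
  show ?thesis
  \<comment> \<open>A rim edge that could become a chord joins the end of one path to the start of
    the other. Rim neighbours lie in different cliques, so both switches then run from
    \<open>A\<close> to \<open>B\<close>. Extending each across this edge gives a gap of
    \<open>A\<close> and a gap of \<open>B\<close>, both odd, so both switches are even.\<close>
  proof (cases "r = Suc q \<or> Suc s = p + n")
    case True
    moreover have "c s \<notin> A" if "Suc s = p + n" using indep[OF AB(1), of s] pA that by auto
    ultimately have r: "c r \<in> A" "c s \<in> B" using rs(3) indep[OF AB(2) qB] AB(3) by auto
    from True show ?thesis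
    proof
      assume rq: "r = Suc q"
      have "c t \<notin> A" if "p < t" "t < r" for t
        using pq(2)[of t] qB AB(3) that rq by (cases "t = q") auto
      then have 1: "odd (r - p)" using single_odd[OF AB(1) nhA, of p r] pA r sw rs(1) pq by auto
      have "c t \<notin> B" if "q < t" "t < s" for t
        using rs(2)[of t] r AB(3) that rq by (cases "t = r") auto
      then have "odd (s - q)" using single_odd[OF AB(2) nhB, of q s] qB r sw rs(1) pq by auto
      then show ?thesis using 1 rq pq rs(1) by (simp add: Suc_diff_le)
    next
      assume sp: "Suc s = p + n"
      have "c t \<notin> A" if "r < t" "t < p + n" for t
        using rs(2)[of t] r AB(3) that sp by (cases "t = s") auto
      then have 1: "odd (p + n - r)" using single_odd[OF AB(1) nhA, of r "p + n"] pA r sw rs(1) pq by auto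
      have "c t \<notin> B" if "s < t" "t < q + n" for t
      proof (cases "t = p + n")
        case True then show ?thesis using pA AB(3) by auto
      next
        case False
        then have "c (t - n + n) \<notin> B" unfolding c_add_n using pq(2)[of "t - n"] that sp by auto
        then show ?thesis using that sp pq n_ge by simp
      qed
      then have "odd (q + n - s)" using single_odd[OF AB(2) nhB, of s "q + n"] qB r sw rs(1) pq by auto
      moreover have "p + n - r = Suc (s - r)" "q + n - s = Suc (q - p)" using sp pq rs(1) by auto
      ultimately show ?thesis using 1 by simp
    qed
  next
    case False
    show ?thesis
    proof (rule ccontr)
      assume par: "even (q - p) \<noteq> even (s - r)"
      define d e where "d = q - p" and "e = s - r"
      have de: "0 < d" "0 < e" "q = p + d" "s = r + e" using pq rs(1) unfolding d_def e_def by auto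
      \<comment> \<open>This walks the second path from its end in \<open>B\<close> to its end in
        \<open>A\<close>, in whichever direction that is. The cycle is the first path, an edge of
        \<open>B\<close>, the walk \<rho>, and an edge of \<open>A\<close>; it has
        \<open>d + e + 2\<close> vertices.\<close>
      define \<rho> where "\<rho> = (\<lambda>j. if c s \<in> A then r + j else r + e - j)"
      have \<rho>_range: "r \<le> \<rho> j" "\<rho> j \<le> s" if "j \<le> e" for j using that de unfolding \<rho>_def by auto
      have \<rho>_dist: "\<rho> j < \<rho> k \<and> \<rho> k = \<rho> j + (k - j) \<or> \<rho> k < \<rho> j \<and> \<rho> j = \<rho> k + (k - j)"
        if "j < k" "k \<le> e" for j k
        using that unfolding \<rho>_def by auto
      have \<rho>_ends: "c (\<rho> 0) \<in> B" "c (\<rho> e) \<in> A" using rs(3) AB(3) de unfolding \<rho>_def by auto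
      have \<rho>_inner: "c (\<rho> j) \<notin> A \<union> B" if "0 < j" "j < e" for j
      proof -
        have "r < \<rho> j" "\<rho> j < s" using that de unfolding \<rho>_def by simp_all linarith+
        then show ?thesis using rs(2) by blast
      qed
      have p_inner: "c (p + j) \<notin> A \<union> B" if "0 < j" "j < d" for j
        using pq(2)[of "p + j"] that de by auto
      define \<pi> where "\<pi> = (\<lambda>j. if j \<le> d then p + j else \<rho> (j - Suc d))"
      define L where "L = Suc (Suc (d + e))"
      define vs where "vs = map (\<lambda>j. c (\<pi> j)) [0..<L]"
      have len: "length vs = L" unfolding vs_def by simp
      have nth: "vs ! j = c (\<pi> j)" if "j < L" for j using that unfolding vs_def by simp
      have *: "vs ! j \<noteq> vs ! k \<and> (adj c {A, B} (vs ! j) (vs ! k) \<longleftrightarrow> k = Suc j \<or> j = 0 \<and> Suc k = L)"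
        if jk: "j < k" "k < L" for j k
      proof -
        have eq: "vs ! j = c (\<pi> j)" "vs ! k = c (\<pi> k)" using nth jk by auto
        consider "k \<le> d" | "j \<le> d" "d < k" | "d < j" by linarith
        then show ?thesis
        proof cases
          case 1
          then have p: "\<pi> j = p + j" "\<pi> k = p + k" using jk unfolding \<pi>_def by auto
          have lt: "p + j < p + k" "p + k < p + j + n" using jk 1 sw rs(1) de by auto
          have "rim_adj c (c (p + j)) (c (p + k)) \<longleftrightarrow> k = Suc j"
            using rim_adj_near[OF lt] jk 1 sw rs(1) de by auto
          moreover have "\<not> (\<exists>X\<in>{A, B}. c (p + j) \<in> X \<and> c (p + k) \<in> X)"
            using pA qB AB(3) p_inner[of j] p_inner[of k] jk 1 de by (cases "j = 0"; cases "k = d") auto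
          ultimately show ?thesis using c_neq[OF lt] jk 1 p unfolding eq adj_def L_def by auto
        next
          case 2
          define k' where "k' = k - Suc d"
          have p: "\<pi> j = p + j" "\<pi> k = \<rho> k'" using jk 2 unfolding \<pi>_def k'_def by auto
          have k': "k' \<le> e" "k = Suc (d + k')" using jk 2 unfolding k'_def L_def by auto
          have lt: "p + j < \<rho> k'" "\<rho> k' < p + j + n" using \<rho>_range[OF k'(1)] 2 sw de by auto
          have "\<not> rim_adj c (c (p + j)) (c (\<rho> k'))"
            using rim_adj_near[OF lt] False sw de \<rho>_range[OF k'(1)] 2 by auto
          moreover have "(\<exists>X\<in>{A, B}. c (p + j) \<in> X \<and> c (\<rho> k') \<in> X) \<longleftrightarrow> j = 0 \<and> k' = e \<or> j = d \<and> k' = 0"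
            using pA qB AB(3) p_inner[of j] \<rho>_inner[of k'] \<rho>_ends 2 k' de
            by (cases "j = 0"; cases "j = d"; cases "k' = 0"; cases "k' = e") auto
          ultimately show ?thesis using c_neq[OF lt] jk 2 k' p unfolding eq adj_def L_def by auto
        next
          case 3
          define j' k' where "j' = j - Suc d" and "k' = k - Suc d"
          have p: "\<pi> j = \<rho> j'" "\<pi> k = \<rho> k'" using jk 3 unfolding \<pi>_def k'_def j'_def by auto
          have k': "j' < k'" "k' \<le> e" "k = Suc (d + k')" "j = Suc (d + j')"
            using jk 3 unfolding k'_def j'_def L_def by auto
          have m: "c (\<rho> j') \<noteq> c (\<rho> k') \<and> (rim_adj c (c (\<rho> j')) (c (\<rho> k')) \<longleftrightarrow> k' = Suc j')"
          proof -
            from \<rho>_dist[OF k'(1,2)] show ?thesis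
            proof
              assume *: "\<rho> j' < \<rho> k' \<and> \<rho> k' = \<rho> j' + (k' - j')"
              then have lt: "\<rho> j' < \<rho> k'" "\<rho> k' < \<rho> j' + n" using k' sw de pq by auto
              show ?thesis using rim_adj_near[OF lt] c_neq[OF lt] * k' sw de pq by auto
            next
              assume *: "\<rho> k' < \<rho> j' \<and> \<rho> j' = \<rho> k' + (k' - j')"
              then have lt: "\<rho> k' < \<rho> j'" "\<rho> j' < \<rho> k' + n" using k' sw de pq by auto
              show ?thesis using rim_adj_near[OF lt] rim_adj_sym[of c "c (\<rho> k')"] c_neq[OF lt] * k' sw de pq by auto
            qed
          qed
          moreover have "\<not> (\<exists>X\<in>{A, B}. c (\<rho> j') \<in> X \<and> c (\<rho> k') \<in> X)"
            using \<rho>_ends AB(3) \<rho>_inner[of j'] \<rho>_inner[of k'] k' de by (cases "j' = 0"; cases "k' = e") auto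
          ultimately show ?thesis using k' p unfolding eq adj_def L_def by auto
        qed
      qed
      have "distinct vs" unfolding distinct_conv_nth len by (metis * linorder_neqE_nat)
      moreover have "odd L" using par unfolding L_def d_def e_def by auto
      moreover have "5 \<le> L" using \<open>odd L\<close> de unfolding L_def by presburger
      ultimately have "ohole (adj c {A, B}) vs" unfolding ohole_def len using * by auto
      then show False using nhAB by blast
    qed
  qed
qed

lemma switches_parity:
  assumes AB: "A \<in> I" "B \<in> I" "A \<inter> B = {}"
    and nhA: "\<And>vs. \<not> ohole (adj c {A}) vs" and nhB: "\<And>vs. \<not> ohole (adj c {B}) vs"
    and nhAB: "\<And>vs. \<not> ohole (adj c {A, B}) vs"
    and sw: "switch c A B p q" "switch c A B r s" "q < r" "s < p + n"
  shows "even (q - p) = even (s - r)"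
proof (cases "c p \<in> A")
  case True then show ?thesis using switches_parity_aux[OF AB nhA nhB nhAB sw] by blast
next
  case False
  then have pB: "c p \<in> B" using sw(1) unfolding switch_def by auto
  have BA: "B \<inter> A = {}" "\<And>vs. \<not> ohole (adj c {B, A}) vs" using AB nhAB by (auto simp: insert_commute)
  show ?thesis
    by (rule switches_parity_aux[OF AB(2,1) BA(1) nhB nhA BA(2) _ _ sw(3,4) pB])
      (use sw switch_sym in blast)+
qed

text \<open>If all switches had one parity, a suitable weight would make all gaps of
  \<open>A \<union> B\<close> count as odd. Then \<open>n\<close> and \<open>card A + card B\<close>
  would have the same parity, but the former is odd and the latter a sum of two odd numbers.\<close>

lemma switches_differ:
  assumes AB: "A \<in> I" "B \<in> I" "A \<inter> B = {}"
    and nhA: "\<And>vs. \<not> ohole (adj c {A}) vs" and nhB: "\<And>vs. \<not> ohole (adj c {B}) vs"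
  shows "\<exists>p q r s. switch c A B p q \<and> switch c A B r s \<and> odd (q - p) \<and> even (s - r)"
proof (rule ccontr)
  assume "\<not> ?thesis"
  then obtain \<epsilon> where eps: "\<And>p q. switch c A B p q \<Longrightarrow> odd (q - p) = \<epsilon>" by metis
  have "A \<noteq> {}" using card3[OF AB(1)] by auto
  then obtain k where k: "c k \<in> A" using sub[OF AB(1)] by blast
  interpret r: rim n "\<lambda>t. c (t + k)" by (rule rotate)
  define P where "P = (\<lambda>t. c (t + k) \<in> A \<union> B)"
  \<comment> \<open>If all switches are even, marking the vertices of \<open>B\<close> corrects
    exactly the switches, because the ends of every other gap are marked alike.\<close>
  define \<delta> :: "nat \<Rightarrow> nat" where "\<delta> = (\<lambda>t. if \<not> \<epsilon> \<and> c (t + k) \<in> B then 1 else 0)"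
  have "even (n + card {t. 0 < t \<and> t \<le> n \<and> P t} + \<delta> 0 + \<delta> n)"
  proof (rule gap_parity[of P n \<delta> n])
    show "P 0" "P n" unfolding P_def using k by auto
    fix i j assume *: "i < j" "j \<le> n" "P i" "P j" "\<And>t. i < t \<Longrightarrow> t < j \<Longrightarrow> \<not> P t"
    have nb: "c t \<notin> A \<union> B" if "i + k < t" "t < j + k" for t
      using *(5)[of "t - k"] that unfolding P_def by auto
    consider "c (i + k) \<in> A" "c (j + k) \<in> A" | "c (i + k) \<in> B" "c (j + k) \<in> B" | "switch c A B (i + k) (j + k)"
      using *(1,3,4) nb unfolding P_def switch_def by auto
    then show "odd (j - i + \<delta> i + \<delta> j)"
    proof cases
      case 1
      then have "odd (j + k - (i + k))"
        using single_odd[OF AB(1) nhA, of "i + k" "j + k"] * nb by auto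
      then show ?thesis using 1 AB(3) unfolding \<delta>_def by auto
    next
      case 2
      then have "odd (j + k - (i + k))"
        using single_odd[OF AB(2) nhB, of "i + k" "j + k"] * nb by auto
      then show ?thesis using 2 AB(3) unfolding \<delta>_def by auto
    next
      case 3
      moreover have "c (i + k) \<in> B \<longleftrightarrow> c (j + k) \<notin> B" using 3 AB(3) unfolding switch_def by auto
      ultimately show ?thesis using eps[OF 3] unfolding \<delta>_def by auto
    qed
  qed auto
  moreover have "card {t. 0 < t \<and> t \<le> n \<and> P t} = card (A \<union> B)"
    unfolding P_def by (rule r.card_positions) (use range_rotate sub[OF AB(1)] sub[OF AB(2)] in auto)
  moreover have "card (A \<union> B) = card A + card B"
    using card3[OF AB(1)] card3[OF AB(2)] AB(3) by (intro card_Un_disjoint) (auto intro: card_ge_0_finite)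
  moreover have "\<delta> n = \<delta> 0" unfolding \<delta>_def by simp
  ultimately show False using n_odd odd_card[OF AB(1) nhA] odd_card[OF AB(2) nhB] by auto
qed

text \<open>No switch can be disjoint from both given ones, as it would have to agree with two
  different parities. Following the first and the last further vertex of \<open>A\<close> under this
  restriction forces them to coincide, which leaves at most two vertices in
  \<open>A\<close>.\<close>

lemma shared_switch_contradiction:
  assumes AB: "A \<in> I" "B \<in> I" "A \<inter> B = {}"
    and nhA: "\<And>vs. \<not> ohole (adj c {A}) vs" and nhB: "\<And>vs. \<not> ohole (adj c {B}) vs"
    and nhAB: "\<And>vs. \<not> ohole (adj c {A, B}) vs"
    and sw: "switch c A B x y" "switch c A B y z" "even (y - x) \<noteq> even (z - y)"
    and yA: "c y \<in> A"
  shows False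
proof -
  note sp = switches_parity[OF AB nhA nhB nhAB]
  have xz: "c x \<in> B" "c z \<in> B" "x < y" "y < z" and xy: "\<And>t. x < t \<Longrightarrow> t < y \<Longrightarrow> c t \<notin> A \<union> B"
    and yz: "\<And>t. y < t \<Longrightarrow> t < z \<Longrightarrow> c t \<notin> A \<union> B"
    using sw(1,2) yA AB(3) unfolding switch_def by auto
  have "y < x + n" using switch_lt[OF sw(1) AB(3)] .
  have zx: "z \<le> x + n"
  proof (rule ccontr)
    assume "\<not> z \<le> x + n"
    then show False using yz[of "x + n"] \<open>y < x + n\<close> xz by auto
  qed
  \<comment> \<open>In the turn that starts at \<open>y\<close>, the stretches before
    \<open>z\<close> and after \<open>x + n\<close> are the insides of the two switches, so any
    further vertex of \<open>A\<close> falls strictly between \<open>z\<close> and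
    \<open>x + n\<close>.\<close>
  have other: "\<exists>t. z < t \<and> t < x + n \<and> c t = a" if a: "a \<in> A" "a \<noteq> c y" for a
  proof -
    obtain i where i: "a = c i" using a(1) sub[OF AB(1)] by blast
    obtain j where j: "\<And>t. c (j + y + t) = c (i + t)" using obtain_shift by blast
    define t where "t = y + j mod n"
    have t: "c t = a" "y \<le> t" "t < y + n"
      using j[of 0] i n_ge unfolding t_def by (auto simp: c_eq_iff mod_add_right_eq add.commute)
    then have "y < t" using a by (cases "t = y") auto
    moreover have "\<not> t < z" using yz[of t] \<open>y < t\<close> t a by auto
    moreover have "t \<noteq> z" "t \<noteq> x + n" using t a xz AB(3) by auto
    moreover have "\<not> x + n < t"
    proof
      assume "x + n < t"
      then have "c (t - n) \<notin> A \<union> B" using xy[of "t - n"] t by auto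
      moreover have "c (t - n + n) = a" using \<open>x + n < t\<close> t by simp
      ultimately show False using a by auto
    qed
    ultimately have "z < t" "t < x + n" by linarith+
    then show ?thesis using t(1) by blast
  qed
  have "\<exists>a\<in>A. a \<noteq> c y"
  proof (rule ccontr)
    assume "\<not> ?thesis"
    then have "A \<subseteq> {c y}" by auto
    then have "card A \<le> 1" using card_mono[of "{c y}" A] by simp
    then show False using card3[OF AB(1)] by simp
  qed
  then obtain t0 where t0: "z < t0" "t0 < x + n" "c t0 \<in> A" using other by blast
  obtain t1 where t1: "z < t1" "t1 \<le> t0" "c t1 \<in> A" and t1': "\<And>t. z < t \<Longrightarrow> t < t1 \<Longrightarrow> c t \<notin> A"
    using next_ex[of "\<lambda>t. c t \<in> A" t0 z] t0 by blast
  obtain s1 where s1: "z \<le> s1" "s1 < t1" "c s1 \<in> B" and s1': "\<And>t. s1 < t \<Longrightarrow> t < t1 \<Longrightarrow> c t \<notin> B"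
    using prev_ex[of "\<lambda>t. c t \<in> B" z t1] t1 xz by blast
  have t1x: "t1 < x + n" and xnB: "c (x + n) \<in> B" using t1(2) t0(2) xz(1) by simp_all
  obtain t2 where t2: "t1 \<le> t2" "t2 < x + n" "c t2 \<in> A" and t2': "\<And>t. t2 < t \<Longrightarrow> t < x + n \<Longrightarrow> c t \<notin> A"
    by (rule prev_ex[where P = "\<lambda>t. c t \<in> A", OF t1(3) t1x]) (rule that)
  obtain s2 where s2: "t2 < s2" "s2 \<le> x + n" "c s2 \<in> B" and s2': "\<And>t. t2 < t \<Longrightarrow> t < s2 \<Longrightarrow> c t \<notin> B"
    by (rule next_ex[where P = "\<lambda>t. c t \<in> B", OF xnB t2(2)]) (rule that)
  have sw1: "switch c A B s1 t1" using s1 s1' t1 t1' unfolding switch_def by auto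
  have sw2: "switch c A B t2 s2" using s2 s2' t2 t2' unfolding switch_def by auto
  \<comment> \<open>A switch that ends at \<open>t1\<close> but starts after \<open>z\<close> would
    be disjoint from both given switches; the argument for \<open>s2\<close> is the mirror
    image.\<close>
  have "s1 = z"
  proof (rule ccontr)
    assume "s1 \<noteq> z"
    then have "even (z - y) = even (t1 - s1)" using sp[OF sw(2) sw1] s1 t1 t0 xz by auto
    moreover have "even (y - x) = even (t1 - s1)" using sp[OF sw(1) sw1] s1 t1 t0 xz by auto
    ultimately show False using sw(3) by auto
  qed
  have "s2 = x + n"
  proof (rule ccontr)
    assume "s2 \<noteq> x + n"
    then have "even (z - y) = even (s2 - t2)" using sp[OF sw(2) sw2] s2 t2 t1 xz by auto
    moreover have "even (y - x) = even (s2 - t2)"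
      using sp[OF sw(1) sw2] s2 t2 t1 xz \<open>s2 \<noteq> x + n\<close> by auto
    ultimately show False using sw(3) by auto
  qed
  \<comment> \<open>The switch from \<open>z\<close> to \<open>t1\<close> is disjoint from the first
    given switch, the one from \<open>t2\<close> to \<open>x + n\<close> from the second. If
    \<open>t1 < t2\<close>, they are also disjoint from each other, and the two unequal parities
    would be equal.\<close>
  have "even (y - x) = even (t1 - z)" using sp[OF sw(1) sw1] \<open>s1 = z\<close> s1 t1 t0 xz by auto
  moreover have "even (z - y) = even (s2 - t2)" using sp[OF sw(2) sw2] \<open>s2 = x + n\<close> t1 t2 xz by auto
  moreover have "even (t1 - z) = even (s2 - t2)" if "t1 < t2"
    using sp[OF sw1 sw2 that] \<open>s1 = z\<close> \<open>s2 = x + n\<close> xz by auto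
  ultimately have "t1 = t2" using sw(3) t2(1) by (meson le_neq_implies_less)
  have "A \<subseteq> {c y, c t1}"
  proof
    fix a assume a: "a \<in> A"
    show "a \<in> {c y, c t1}"
    proof (cases "a = c y")
      case False
      then obtain t where "z < t" "t < x + n" "c t = a" using other a by blast
      then have "t = t1" using t1'[of t] t2'[of t] \<open>t1 = t2\<close> a by (meson linorder_neqE_nat)
      then show ?thesis using \<open>c t = a\<close> by simp
    qed simp
  qed
  then have "card A \<le> card {c y, c t1}" by (rule card_mono[rotated]) simp
  also have "\<dots> \<le> 2" by (simp add: card_insert_if)
  finally show False using card3[OF AB(1)] by simp
qed

text \<open>An odd and an even switch both exist and cannot be disjoint, so within one turn they
  share an end. Then they are two consecutive switches of different parity, which is impossible as
  well.\<close>

lemma cliques_meet: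
  assumes AB: "A \<in> I" "B \<in> I"
    and nhA: "\<And>vs. \<not> ohole (adj c {A}) vs" and nhB: "\<And>vs. \<not> ohole (adj c {B}) vs"
    and nhAB: "\<And>vs. \<not> ohole (adj c {A, B}) vs"
  shows "A \<inter> B \<noteq> {}"
proof
  assume dj: "A \<inter> B = {}"
  note sp = switches_parity[OF AB dj nhA nhB nhAB]
  have contra: False if sw: "switch c A B x y" "switch c A B y z" "even (y - x) \<noteq> even (z - y)" for x y z
  proof (cases "c y \<in> A")
    case True
    then show False using shared_switch_contradiction[OF AB dj nhA nhB nhAB sw] by blast
  next
    case False
    then have yB: "c y \<in> B" using sw(1) unfolding switch_def by auto
    have BA: "B \<inter> A = {}" "\<And>vs. \<not> ohole (adj c {B, A}) vs" using dj nhAB by (auto simp: insert_commute)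
    show False
      by (rule shared_switch_contradiction[OF AB(2,1) BA(1) nhB nhA BA(2) _ _ sw(3) yB])
        (use sw switch_sym in blast)+
  qed
  obtain p q r0 s0 where pq: "switch c A B p q" "switch c A B r0 s0" "odd (q - p)" "even (s0 - r0)"
    using switches_differ[OF AB dj nhA nhB] by blast
  obtain j where j: "\<And>t. c (j + p + t) = c (r0 + t)" using obtain_shift by blast
  \<comment> \<open>The even switch, moved into the turn that begins at \<open>p\<close>.\<close>
  define r s where "r = p + j mod n" and "s = r + (s0 - r0)"
  have ct: "c (r + t) = c (r0 + t)" for t
    using j[of t] unfolding r_def
    by (metis add.assoc add.commute c_eq_iff mod_add_right_eq)
  have "switch c A B r s" unfolding switch_def
  proof (intro conjI)
    show "r < s" using pq(2) unfolding s_def switch_def by linarith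
    have "c s = c s0" "c r = c r0" using ct[of "s0 - r0"] ct[of 0] pq(2) unfolding s_def switch_def by simp_all
    then show "c r \<in> A \<and> c s \<in> B \<or> c r \<in> B \<and> c s \<in> A" using pq(2) unfolding switch_def by simp
    show "\<forall>t. r < t \<and> t < s \<longrightarrow> c t \<notin> A \<union> B"
    proof (intro allI impI)
      fix t assume "r < t \<and> t < s"
      then have "c t = c (r0 + (t - r))" "r0 < r0 + (t - r)" "r0 + (t - r) < s0"
        using ct[of "t - r"] unfolding s_def by auto
      then show "c t \<notin> A \<union> B" using pq(2) unfolding switch_def by auto
    qed
  qed
  moreover have "even (s - r)" using pq(4) unfolding s_def by simp
  moreover have "p \<le> r" "r < p + n" unfolding r_def using n_ge by auto
  ultimately have rs: "switch c A B r s" "even (s - r)" "p \<le> r" "r < p + n" by auto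
  have "r \<noteq> p"
  proof
    assume "r = p"
    then have "s = q" using rs(1) pq(1) unfolding switch_def by (metis UnCI linorder_neqE_nat)
    then show False using \<open>r = p\<close> rs(2) pq(3) by simp
  qed
  then have "q \<le> r" using rs pq(1) unfolding switch_def by (metis UnCI le_neq_implies_less not_less)
  have "c (p + n) \<in> A \<union> B" using pq(1) unfolding switch_def by auto
  then have "s \<le> p + n" using rs(1,4) unfolding switch_def by (meson not_less)
  consider "q < r" "s < p + n" | "q = r" | "s = p + n"
    using \<open>q \<le> r\<close> \<open>s \<le> p + n\<close> by linarith
  then show False
  proof cases
    case 1 then show False using sp[OF pq(1) rs(1)] pq(3) rs(2) by auto
  next
    case 2 then show False using contra[of p q s] pq rs by auto
  next
    case 3
    have "switch c A B (p + n) (q + n)" using pq(1) switch_shift by blast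
    then show False using contra[of r "p + n" "q + n"] rs pq(3) 3 by auto
  qed
qed

theorem npos_if_hole_free:
  assumes nh: "\<And>F vs. F \<subseteq> I \<Longrightarrow> F \<noteq> {} \<Longrightarrow> \<not> ohole (adj c F) vs" and "I \<noteq> {}"
  shows "npos n c I"
proof -
  have nhI: "\<not> ohole (adj c I) vs" for vs using nh \<open>I \<noteq> {}\<close> by blast
  have nh1: "\<not> ohole (adj c {A}) vs" if "A \<in> I" for A vs using nh[of "{A}"] that by blast
  have nh2: "\<not> ohole (adj c {A, B}) vs" if "A \<in> I" "B \<in> I" for A B vs using nh[of "{A, B}"] that by blast
  have meets: "A \<inter> B \<noteq> {}" if "A \<in> I" "B \<in> I" for A B
    using cliques_meet[OF that nh1 nh1 nh2] that by blast
  obtain A0 where A0: "A0 \<in> I" using \<open>I \<noteq> {}\<close> by blast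
  have ex_xi: "\<exists>\<xi>. \<forall>A\<in>I. \<xi> \<in> A"
  proof (cases "I = {A0}")
    case True
    then show ?thesis using card3[OF A0] by (auto intro: ccontr)
  next
    case False
    then obtain B0 where B0: "B0 \<in> I" "B0 \<noteq> A0" using A0 by blast
    obtain \<xi> where xi: "\<xi> \<in> A0" "\<xi> \<in> B0" using meets[OF A0 B0(1)] by blast
    have "\<xi> \<in> C" if C: "C \<in> I" for C
    proof (rule ccontr)
      assume "\<xi> \<notin> C"
      obtain u v where u: "u \<in> A0" "u \<in> C" and v: "v \<in> B0" "v \<in> C"
        using meets[OF A0 C] meets[OF B0(1) C] by blast
      have ne: "u \<noteq> \<xi>" "v \<noteq> \<xi>" using u v \<open>\<xi> \<notin> C\<close> by auto
      have "u \<noteq> v" using meet[OF A0 B0(1), of \<xi> u] xi u v ne B0(2) by auto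
      moreover have "adj c I \<xi> u" "adj c I u v" "adj c I \<xi> v"
        using ne xi u v A0 B0 C \<open>u \<noteq> v\<close> unfolding adj_def by auto
      ultimately obtain D where "D \<in> I" "\<xi> \<in> D" "u \<in> D" "v \<in> D" using tri ne by metis
      then show False
        using meet[OF A0, of D \<xi> u] meet[OF B0(1), of D \<xi> v] xi u v ne B0(2) by auto
    qed
    then show ?thesis by blast
  qed
  then obtain \<xi> where xi: "\<And>A. A \<in> I \<Longrightarrow> \<xi> \<in> A" by blast
  have int: "A \<inter> B = {\<xi>}" if "A \<in> I" "B \<in> I" "A \<noteq> B" for A B
    using meet[of A B \<xi>] xi that by blast
  show ?thesis unfolding npos_def
  proof (intro conjI ballI allI impI)
    show "odd d" if "A \<in> I" "gap c I i d \<and> d < n \<and> c i \<in> A \<and> c (i + d) \<in> A" for A i d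
      using gap_odd[OF nhI, of i d A] that by blast
    show "odd (card A)" if "A \<in> I" for A using odd_card[OF that nh1[OF that]] .
    show "\<exists>\<xi>\<in>range c. \<forall>A\<in>I. \<xi> \<in> A \<and> (\<forall>B\<in>I. A \<noteq> B \<longrightarrow> A \<inter> B = {\<xi>})"
      using xi int sub[OF A0] A0 by (intro bexI[of _ \<xi>]) auto
    show "even d" if "A \<in> I" "B \<in> I"
      "A \<noteq> B \<and> gap c I i d \<and> d < n \<and> c i \<in> A - B \<and> c (i + d) \<in> B - A" for A B i d
      using cross_gap_even[OF nhI, of i d A B \<xi>] that xi by auto
  qed
qed

end

section \<open>From the N-conditions to hole-freeness\<close>

text \<open>(N1) and (N5) after cutting the rim open at the common vertex \<open>c 0 = c n\<close>.\<close>
definition lin :: "nat \<Rightarrow> (nat \<Rightarrow> 'a) \<Rightarrow> 'a set set \<Rightarrow> bool" where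
  "lin n c F \<longleftrightarrow> (\<forall>i j. i < j \<and> j \<le> n \<and> c i \<in> \<Union>F \<and> c j \<in> \<Union>F \<and> (\<forall>t. i < t \<and> t < j \<longrightarrow> c t \<notin> \<Union>F) \<longrightarrow>
     (odd (j - i) \<longleftrightarrow> (\<exists>A\<in>F. c i \<in> A \<and> c j \<in> A)))"

section \<open>Cyclic and linear form of the N-conditions\<close>

context sun
begin

lemma npos_imp_lin:
  assumes np: "npos n c F" and xi: "\<And>A. A \<in> F \<Longrightarrow> c 0 \<in> A"
  shows "lin n c F"
  unfolding lin_def
proof (intro allI impI, elim conjE)
  fix i j assume ij: "i < j" "j \<le> n" "c i \<in> \<Union>F" "c j \<in> \<Union>F" "\<forall>t. i < t \<and> t < j \<longrightarrow> c t \<notin> \<Union>F"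
  have j: "i + (j - i) = j" using ij by simp
  show "odd (j - i) \<longleftrightarrow> (\<exists>A\<in>F. c i \<in> A \<and> c j \<in> A)"
  \<comment> \<open>A full turn is not covered by \<open>npos\<close>. Here both ends are the common
    vertex, hence share a clique, and \<open>n\<close> is odd.\<close>
  proof (cases "j - i = n")
    case True
    then have "i = 0" "j = n" using ij n_ge by auto
    then show ?thesis using ij n_odd by auto
  next
    case False
    then have lt: "j - i < n" using ij by auto
    have g: "gap c F i (j - i)" using ij j unfolding gap_def by auto
    show ?thesis
    proof (cases "\<exists>A\<in>F. c i \<in> A \<and> c j \<in> A")
      case True
      then show ?thesis using npos_odd[OF np _ g lt] j by auto
    next
      case False
      then obtain A B where "A \<in> F" "B \<in> F" "c i \<in> A" "c j \<in> B" "c i \<notin> B" "c j \<notin> A" using ij by blast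
      then show ?thesis using npos_even[OF np, of A B i "j - i"] g lt j False by auto
    qed
  qed
qed

lemma lin_imp_npos:
  assumes "F \<subseteq> I" and xi: "\<And>A. A \<in> F \<Longrightarrow> c 0 \<in> A" and l: "lin n c F"
    and card: "\<And>A. A \<in> F \<Longrightarrow> odd (card A)"
  shows "npos n c F"
proof -
  have key: "odd d \<longleftrightarrow> (\<exists>A\<in>F. c i \<in> A \<and> c (i + d) \<in> A)" if g: "gap c F i d" "d < n" for i d
  proof -
    define i0 where "i0 = i mod n"
    have g0: "gap c F i0 d" and eq: "c i0 = c i" "c (i0 + d) = c (i + d)"
      using g gap_mod unfolding i0_def by (auto simp: c_eq_iff mod_add_left_eq)
    obtain A where A: "A \<in> F" using g unfolding gap_def by blast
    have "i0 < n" unfolding i0_def using n_ge by simp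
    \<comment> \<open>No gap runs across the cut: the vertex there lies in every clique of
      \<open>F\<close> and would be inside the gap.\<close>
    have "i0 + d \<le> n"
    proof (rule ccontr)
      assume "\<not> i0 + d \<le> n"
      then have "0 < n - i0" "n - i0 < d" using \<open>i0 < n\<close> by auto
      then have "c (i0 + (n - i0)) \<notin> \<Union>F" using g0 unfolding gap_def by blast
      moreover have "c (i0 + (n - i0)) = c 0" using \<open>i0 < n\<close> by simp
      ultimately show False using xi[OF A] A by auto
    qed
    moreover have "c t \<notin> \<Union>F" if "i0 < t" "t < i0 + d" for t
    proof -
      have "0 < t - i0" "t - i0 < d" using that by auto
      then have "c (i0 + (t - i0)) \<notin> \<Union>F" using g0 unfolding gap_def by blast
      then show ?thesis using that by simp
    qed
    moreover have "i0 < i0 + d" "c i0 \<in> \<Union>F" "c (i0 + d) \<in> \<Union>F" using g0 unfolding gap_def by simp_all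
    ultimately have "odd (i0 + d - i0) \<longleftrightarrow> (\<exists>A\<in>F. c i0 \<in> A \<and> c (i0 + d) \<in> A)"
      using l[unfolded lin_def, rule_format, of i0 "i0 + d"] by simp
    then show ?thesis using eq by simp
  qed
  have int: "A \<inter> B = {c 0}" if "A \<in> F" "B \<in> F" "A \<noteq> B" for A B
    using meet[of A B "c 0"] xi that assms(1) by blast
  show ?thesis unfolding npos_def
  proof (intro conjI ballI allI impI)
    show "odd d" if "A \<in> F" "gap c F i d \<and> d < n \<and> c i \<in> A \<and> c (i + d) \<in> A" for A i d
      using key[of i d] that by blast
    show "odd (card A)" if "A \<in> F" for A using card[OF that] .
    show "\<exists>\<xi>\<in>range c. \<forall>A\<in>F. \<xi> \<in> A \<and> (\<forall>B\<in>F. A \<noteq> B \<longrightarrow> A \<inter> B = {\<xi>})"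
      using xi int by (intro bexI[of _ "c 0"]) auto
    show "even d" if *: "A \<in> F" "B \<in> F"
      "A \<noteq> B \<and> gap c F i d \<and> d < n \<and> c i \<in> A - B \<and> c (i + d) \<in> B - A" for A B i d
    proof (rule ccontr)
      assume "odd d"
      then obtain C where C: "C \<in> F" "c i \<in> C" "c (i + d) \<in> C" using key * by blast
      have "C = A \<or> c i = c 0" "C = B \<or> c (i + d) = c 0" using int[OF C(1)] C * by blast+
      then show False using C * xi by auto
    qed
  qed
qed

end

section \<open>Maximal runs of positions and the local structure of a hole\<close>

lemma interval_ex:
  fixes S :: "nat set"
  assumes "i \<in> S" "0 \<notin> S" "finite S"
  obtains lo hi where "0 < lo" "lo \<le> i" "i \<le> hi" "{lo..hi} \<subseteq> S" "lo - 1 \<notin> S" "Suc hi \<notin> S"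
proof -
  have "0 < i" using assms by (cases i) auto
  obtain x where x: "x < i" "x \<notin> S" and x': "\<And>t. x < t \<Longrightarrow> t < i \<Longrightarrow> \<not> t \<notin> S"
    using prev_ex[of "\<lambda>t. t \<notin> S" 0 i] assms \<open>0 < i\<close> by blast
  have "Suc (Max S) \<notin> S"
  proof
    assume "Suc (Max S) \<in> S"
    then have "Suc (Max S) \<le> Max S" by (rule Max_ge[OF assms(3)])
    then show False by simp
  qed
  moreover have "i < Suc (Max S)" using Max_ge[OF assms(3,1)] by simp
  ultimately obtain y where y: "i < y" "y \<notin> S" and y': "\<And>t. i < t \<Longrightarrow> t < y \<Longrightarrow> \<not> t \<notin> S"
    using next_ex[of "\<lambda>t. t \<notin> S" "Suc (Max S)" i] by blast
  have "t \<in> S" if "x < t" "t < y" for t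
    using x'[of t] y'[of t] assms that by (cases t i rule: linorder_cases) auto
  then have "{Suc x..y - 1} \<subseteq> S" using x y by auto
  moreover have "i \<le> y - 1" using y by simp
  ultimately show ?thesis using that[of "Suc x" "y - 1"] x y by simp
qed

text \<open>From here on the cyclic order of \<open>vs\<close> can be forgotten. Two neighbours for
  each vertex, no triangle, and connectedness are properties of the vertex set alone, which can then
  be examined in rim order.\<close>

lemma ohole_neighbours:
  assumes h: "ohole R vs" and symp: "symp R" and irr: "irreflp R"
  shows "v \<in> set vs \<Longrightarrow> \<exists>u w. u \<noteq> w \<and> {x \<in> set vs. R v x} = {u, w}"
    and "x \<in> set vs \<Longrightarrow> y \<in> set vs \<Longrightarrow> z \<in> set vs \<Longrightarrow> R x y \<Longrightarrow> R y z \<Longrightarrow> R x z \<Longrightarrow> False"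
    and "Z \<subseteq> set vs \<Longrightarrow> Z \<noteq> {} \<Longrightarrow> (\<And>x y. x \<in> Z \<Longrightarrow> y \<in> set vs \<Longrightarrow> R x y \<Longrightarrow> y \<in> Z) \<Longrightarrow> Z = set vs"
proof -
  have sym: "R u v \<Longrightarrow> R v u" for u v using symp by (rule sympD)
  define m where "m = length vs"
  have m: "5 \<le> m" and d: "distinct vs" using h unfolding ohole_def m_def by auto
  have E: "R (vs ! i) (vs ! j) \<longleftrightarrow> j = Suc i \<or> i = Suc j \<or> i = 0 \<and> Suc j = m \<or> j = 0 \<and> Suc i = m"
    if "i < m" "j < m" for i j
  proof (cases i j rule: linorder_cases)
    case less
    then show ?thesis using h that m unfolding ohole_def m_def[symmetric] by auto
  next
    case equal then show ?thesis using irr m by (auto dest: irreflpD)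
  next
    case greater
    then have "R (vs ! j) (vs ! i) \<longleftrightarrow> i = Suc j \<or> j = 0 \<and> Suc i = m"
      using h that m unfolding ohole_def m_def[symmetric] by auto
    then show ?thesis using sym greater m by auto
  qed
  have idx: "\<exists>i<m. v = vs ! i" if "v \<in> set vs" for v using that unfolding m_def by (metis in_set_conv_nth)
  have mem: "vs ! i \<in> set vs" if "i < m" for i using that unfolding m_def by simp
  show "\<exists>u w. u \<noteq> w \<and> {x \<in> set vs. R v x} = {u, w}" if "v \<in> set vs"
  proof -
    obtain i where i: "i < m" "v = vs ! i" using idx \<open>v \<in> set vs\<close> by blast
    define a b where "a = (if Suc i = m then 0 else Suc i)" and "b = (if i = 0 then m - 1 else i - 1)"
    have ab: "a < m" "b < m" "a \<noteq> b" using i m unfolding a_def b_def by auto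
    have "R v (vs ! j) \<longleftrightarrow> j = a \<or> j = b" if "j < m" for j
      using E[OF i(1) that] i m that unfolding a_def b_def by auto
    then have "{x \<in> set vs. R v x} = {vs ! a, vs ! b}" using idx mem ab by blast
    moreover have "vs ! a \<noteq> vs ! b" using d ab unfolding m_def by (simp add: nth_eq_iff_index_eq)
    ultimately show ?thesis by blast
  qed
  show False if "x \<in> set vs" "y \<in> set vs" "z \<in> set vs" "R x y" "R y z" "R x z"
  proof -
    obtain i where i: "i < m" "x = vs ! i" using idx \<open>x \<in> set vs\<close> by blast
    obtain j where j: "j < m" "y = vs ! j" using idx \<open>y \<in> set vs\<close> by blast
    obtain k where k: "k < m" "z = vs ! k" using idx \<open>z \<in> set vs\<close> by blast
    note E[OF i(1) j(1), folded i(2) j(2), THEN iffD1, OF that(4)]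
      E[OF j(1) k(1), folded j(2) k(2), THEN iffD1, OF that(5)]
      E[OF i(1) k(1), folded i(2) k(2), THEN iffD1, OF that(6)]
    then show False using m by (elim disjE conjE) linarith+
  qed
  show "Z = set vs" if Z: "Z \<subseteq> set vs" "Z \<noteq> {}" "\<And>x y. x \<in> Z \<Longrightarrow> y \<in> set vs \<Longrightarrow> R x y \<Longrightarrow> y \<in> Z"
  proof -
    obtain z where "z \<in> Z" using Z by blast
    then obtain i where i: "i < m" "vs ! i \<in> Z" using idx Z by blast
    \<comment> \<open>Closure carries \<open>Z\<close> forward to the end of the list; the closing
      edge brings it to index \<open>0\<close>, from where it covers everything.\<close>
    have up: "vs ! (j + k) \<in> Z" if "vs ! j \<in> Z" "j + k < m" for j k
      using that(2)
    proof (induction k)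
      case (Suc k)
      then show ?case using Z(3)[of "vs ! (j + k)" "vs ! Suc (j + k)"] E[of "j + k" "Suc (j + k)"] mem by auto
    qed (use that in simp)
    have "vs ! (m - 1) \<in> Z" using up[OF i(2), of "m - 1 - i"] i by simp
    then have "vs ! 0 \<in> Z" using Z(3)[of "vs ! (m - 1)" "vs ! 0"] E[of "m - 1" 0] mem[of 0] m by auto
    then have "vs ! k \<in> Z" if "k < m" for k using up[of 0 k] that by simp
    then show ?thesis using Z(1) idx by blast
  qed
qed

section \<open>Order and interleaving of the cliques after the cut\<close>

locale rooted = sun n c I for n :: nat and c :: "nat \<Rightarrow> 'a" and I +
  assumes root: "A \<in> I \<Longrightarrow> c 0 \<in> A"
    and lin_sub: "F \<subseteq> I \<Longrightarrow> F \<noteq> {} \<Longrightarrow> lin n c F"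
begin

lemma unique: "A \<in> I \<Longrightarrow> B \<in> I \<Longrightarrow> c i \<in> A \<Longrightarrow> c i \<in> B \<Longrightarrow> 0 < i \<Longrightarrow> i < n \<Longrightarrow> A = B"
  using meet[of A B "c 0" "c i"] root c_neq[of 0 i] by auto

text \<open>Leaving out position \<open>0\<close> keeps the root from being counted, so for a vertex
  of \<open>A\<close> before position \<open>n\<close> this is its index in \<open>A\<close> after
  the root.\<close>

definition cnt :: "'a set \<Rightarrow> nat \<Rightarrow> nat" where
  "cnt A p = card {t. 0 < t \<and> t \<le> p \<and> c t \<in> A}"

lemma cnt_same: "q \<le> p \<Longrightarrow> (\<And>t. q < t \<Longrightarrow> t \<le> p \<Longrightarrow> c t \<notin> A) \<Longrightarrow> cnt A p = cnt A q"
  unfolding cnt_def by (metis le_trans not_less)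

lemma cnt_step:
  assumes "q < p" "c p \<in> A" "\<And>t. q < t \<Longrightarrow> t < p \<Longrightarrow> c t \<notin> A"
  shows "cnt A p = Suc (cnt A q)"
proof -
  have "{t. 0 < t \<and> t \<le> p \<and> c t \<in> A} = insert p {t. 0 < t \<and> t \<le> q \<and> c t \<in> A}"
    using assms by (auto simp: not_le) (meson le_neq_implies_less not_le)
  then show ?thesis using assms(1) unfolding cnt_def by simp
qed

lemma parity_cnt:
  assumes "A \<in> I" "c p \<in> A" "p \<le> n"
  shows "even p \<longleftrightarrow> even (cnt A p)"
proof -
  have "even (p + card {t. 0 < t \<and> t \<le> p \<and> c t \<in> A} + 0 + 0)"
  proof (rule gap_parity[of "\<lambda>t. c t \<in> A" n "\<lambda>_. 0"])
    fix i j assume *: "i < j" "j \<le> n" "c i \<in> A" "c j \<in> A" "\<And>t. i < t \<Longrightarrow> t < j \<Longrightarrow> c t \<notin> A"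
    then show "odd (j - i + 0 + 0)"
      using lin_sub[of "{A}", unfolded lin_def, rule_format, of i j] assms(1) by auto
  qed (use assms root in auto)
  then show ?thesis unfolding cnt_def by auto
qed

text \<open>Orders the cliques. Since distinct cliques share only the root, no two have the same
  first vertex.\<close>

definition first :: "'a set \<Rightarrow> nat" where
  "first A = (LEAST t. 0 < t \<and> c t \<in> A)"

lemma first:
  assumes A: "A \<in> I"
  shows "0 < first A" "first A < n" "c (first A) \<in> A" "0 < t \<Longrightarrow> t < first A \<Longrightarrow> c t \<notin> A"
proof -
  have "\<not> A \<subseteq> {c 0}"
  proof
    assume "A \<subseteq> {c 0}"
    then have "card A \<le> 1" using card_mono[of "{c 0}" A] by simp
    then show False using card3[OF A] by simp
  qed
  then obtain a where a: "a \<in> A" "a \<noteq> c 0" by blast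
  then obtain i where "a = c i" using sub[OF A] by blast
  then have i: "c (i mod n) \<in> A" "c (i mod n) \<noteq> c 0" using a by (simp_all add: c_mod)
  have i': "i mod n \<noteq> 0" "i mod n < n" using i(2) n_ge by (auto intro: ccontr)
  show "0 < first A" "c (first A) \<in> A"
    using LeastI[of "\<lambda>t. 0 < t \<and> c t \<in> A" "i mod n"] i i' unfolding first_def by auto
  show "first A < n"
    using Least_le[of "\<lambda>t. 0 < t \<and> c t \<in> A" "i mod n"] i i' unfolding first_def by auto
  show "c t \<notin> A" if "0 < t" "t < first A"
    using not_less_Least[of t "\<lambda>t. 0 < t \<and> c t \<in> A"] that unfolding first_def by auto
qed

lemma first_inj: "A \<in> I \<Longrightarrow> B \<in> I \<Longrightarrow> first A = first B \<Longrightarrow> A = B"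
  using unique[of A B "first A"] first[of A] first[of B] by auto

text \<open>\<open>A\<close> is the outer clique. By \<open>parity_cnt\<close>, the parity of a position in a clique is the parity of
  its index within the clique, so (N5) relates the indices at every switch between \<open>A\<close> and \<open>B\<close>.\<close>
lemma nested:
  assumes AB: "A \<in> I" "B \<in> I" "first A < first B"
  shows "0 < p \<Longrightarrow> p < n \<Longrightarrow> (c p \<in> A \<longrightarrow> even (cnt B p)) \<and> (c p \<in> B \<longrightarrow> odd (cnt A p))"
proof (induction p rule: less_induct)
  case (less p)
  have ne: "A \<noteq> B" using AB by auto
  have no_both: "\<not> (c t \<in> A \<and> c t \<in> B)" if "0 < t" "t < n" for t
    using unique[OF AB(1,2), of t] ne that by auto
  have zero: "cnt X p = 0" if "\<And>t. 0 < t \<Longrightarrow> t \<le> p \<Longrightarrow> c t \<notin> X" for X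
    using that unfolding cnt_def by (metis (mono_tags, lifting) card.empty empty_Collect_eq)
  show ?case
  proof (cases "\<exists>q. 0 < q \<and> q < p \<and> c q \<in> A \<union> B")
    case False
    have "even (cnt B p)" if "c p \<in> A"
    proof -
      have "cnt B p = 0" using False no_both[of p] that less.prems by (intro zero) (metis UnCI le_neq_implies_less)
      then show ?thesis by simp
    qed
    moreover have "c p \<notin> B"
    proof
      assume "c p \<in> B"
      then have "first B \<le> p" using first(4)[OF AB(2), of p] less.prems by (meson not_less)
      then show False using False first(1,3)[OF AB(1)] AB(3) by (metis UnCI le_less_trans less_le_trans)
    qed
    ultimately show ?thesis by blast
  next
    case True
    then obtain q0 where q0: "0 < q0" "q0 < p" "c q0 \<in> A \<union> B" by blast
    obtain q where q: "q0 \<le> q" "q < p" "c q \<in> A \<union> B" and q': "\<And>t. q < t \<Longrightarrow> t < p \<Longrightarrow> c t \<notin> A \<union> B"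
      by (rule prev_ex[where P = "\<lambda>t. c t \<in> A \<union> B", OF q0(3,2)]) (rule that)
    have q0': "0 < q" "q < n" using q q0 less.prems by auto
    note IH = less.IH[OF q(2) q0']
    have same: "cnt X p = cnt X q" if "X = A \<or> X = B" "c p \<notin> X" for X
      using q' that q(2) by (intro cnt_same) (auto simp: le_less)
    have step: "cnt X p = Suc (cnt X q)" if "X = A \<or> X = B" "c p \<in> X" for X
      using q' that q(2) by (intro cnt_step) auto
    have cross: "even (p - q)" if "c p \<in> A \<and> c q \<in> B \<or> c p \<in> B \<and> c q \<in> A"
    proof -
      have "lin n c {A, B}" using lin_sub AB by auto
      moreover have "c q \<in> \<Union>{A, B}" "c p \<in> \<Union>{A, B}" "p \<le> n" using that less.prems by auto
      moreover have "\<forall>t. q < t \<and> t < p \<longrightarrow> c t \<notin> \<Union>{A, B}" using q' by auto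
      ultimately have "odd (p - q) \<longleftrightarrow> (\<exists>X\<in>{A, B}. c q \<in> X \<and> c p \<in> X)"
        using q(2) unfolding lin_def by blast
      then show ?thesis using that no_both[of p] no_both[of q] q0' less.prems by auto
    qed
    note par = parity_cnt[OF AB(1), of p] parity_cnt[OF AB(1), of q] parity_cnt[OF AB(2), of p] parity_cnt[OF AB(2), of q]
    show ?thesis
    proof (intro conjI impI)
      assume p: "c p \<in> A"
      then have "c p \<notin> B" using no_both less.prems by blast
      then have B: "cnt B p = cnt B q" using same by blast
      show "even (cnt B p)"
      proof (cases "c q \<in> A")
        case True then show ?thesis using IH B by auto
      next
        case False
        then have "c q \<in> B" using q by auto
        \<comment> \<open>The index of \<open>p\<close> in \<open>A\<close> is one more than the odd
          number \<open>cnt A q\<close>, hence even. The index of \<open>q\<close> in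
          \<open>B\<close> has the same parity because \<open>p - q\<close> is even.\<close>
        then show ?thesis using IH B step[of A] p cross par q less.prems by auto
      qed
    next
      assume p: "c p \<in> B"
      then have "c p \<notin> A" using no_both less.prems by blast
      then have A: "cnt A p = cnt A q" using same by blast
      show "odd (cnt A p)"
      proof (cases "c q \<in> B")
        case True then show ?thesis using IH A by auto
      next
        case False
        then have "c q \<in> A" using q by auto
        then show ?thesis using IH A step[of B] p cross par q less.prems by auto
      qed
    qed
  qed
qed

text \<open>The count of \<open>B\<close> is even at \<open>p\<close>, as \<open>B\<close> comes
  after \<open>A\<close>, and odd at \<open>q\<close>, as it comes before \<open>C\<close>; so it
  changes in between.\<close>

lemma between:
  assumes "A \<in> I" "B \<in> I" "C \<in> I" "first A < first B" "first B < first C"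
    and p: "0 < p" "p < n" "c p \<in> A" and q: "0 < q" "q < n" "c q \<in> C"
  shows "\<exists>t. min p q < t \<and> t < max p q \<and> c t \<in> B"
proof (rule ccontr)
  assume "\<not> ?thesis"
  then have no: "c t \<notin> B" if "min p q < t" "t < max p q" for t using that by blast
  have "c p \<notin> B" "c q \<notin> B"
    using unique[of A B p] unique[of B C q] assms by auto
  then have nB: "c t \<notin> B" if "min p q < t" "t \<le> max p q" for t
    using no[of t] that by (auto simp: le_less max_def split: if_splits)
  have "cnt B (max p q) = cnt B (min p q)" by (rule cnt_same) (use nB in auto)
  moreover have "even (cnt B p)" using nested[of A B p] assms by blast
  moreover have "odd (cnt B q)" using nested[of B C q] assms by blast
  ultimately show False by (auto simp: max_def min_def split: if_splits)
qed

section \<open>Excluding odd holes\<close>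

lemma adj_near:
  assumes "i < j" "j < n"
  shows "adj c I (c i) (c j) \<longleftrightarrow> j = Suc i \<or> i = 0 \<and> Suc j = n \<or> (\<exists>A\<in>I. c i \<in> A \<and> c j \<in> A)"
proof -
  have lt: "j < i + n" using assms by simp
  have "Suc j = i + n \<longleftrightarrow> i = 0 \<and> Suc j = n" using assms by linarith
  then show ?thesis
    unfolding adj_def rim_adj_near[OF assms(1) lt] using c_neq[OF assms(1) lt] by blast
qed

lemma adj_sym: "adj c I u v \<Longrightarrow> adj c I v u"
  unfolding adj_def using rim_adj_sym[of c u v] by blast

lemma adj_irrefl: "\<not> adj c I u u"
proof
  assume "adj c I u u"
  then obtain i where "{u, u} = {c i, c (Suc i)}" unfolding adj_def rim_adj_def by auto
  then have "c i = c (Suc i)" by (auto simp: doubleton_eq_iff)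
  then show False using c_neq[of i "Suc i"] n_ge by simp
qed

text \<open>Off the root the hole has only rim edges, since a clique edge would form a triangle with
  the root. So the hole is the root together with one run \<open>lo..hi\<close>, where
  \<open>hi - lo\<close> is odd, and each way for the ends of the run to be adjacent to the root
  contradicts a gap parity or the absence of triangles.\<close>

lemma no_hole_at_root:
  assumes Y: "Y \<subseteq> {..<n}" "odd (card Y)" "0 \<in> Y"
    and two: "\<And>i. i \<in> Y \<Longrightarrow> \<exists>j k. j \<noteq> k \<and> {x \<in> Y. adj c I (c i) (c x)} = {j, k}"
    and tri_free: "\<And>i j k. i \<in> Y \<Longrightarrow> j \<in> Y \<Longrightarrow> k \<in> Y \<Longrightarrow> adj c I (c i) (c j) \<Longrightarrow> adj c I (c j) (c k) \<Longrightarrow>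
      adj c I (c i) (c k) \<Longrightarrow> False"
    and conn: "\<And>Z. Z \<subseteq> Y \<Longrightarrow> Z \<noteq> {} \<Longrightarrow> (\<And>x y. x \<in> Z \<Longrightarrow> y \<in> Y \<Longrightarrow> adj c I (c x) (c y) \<Longrightarrow> y \<in> Z) \<Longrightarrow> Z = Y"
    and "I \<noteq> {}"
  shows False
proof -
  define S where "S = Y - {0}"
  have S: "0 < i" "i < n" "i \<in> Y" if "i \<in> S" for i using that Y unfolding S_def by auto
  have finS: "finite S" using Y(1) finite_subset unfolding S_def by auto
  have lettered: "adj c I (c i) (c 0)" if "i \<in> S" "A \<in> I" "c i \<in> A" for i A
    using root that c_neq[of 0 i] S[OF that(1)] unfolding adj_def by auto
  have near: "j = Suc i \<or> i = Suc j" if ij: "i \<in> S" "j \<in> S" "adj c I (c i) (c j)" for i j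
  proof (rule ccontr)
    assume no: "\<not> ?thesis"
    have "i \<noteq> j" using ij(3) adj_irrefl by auto
    then obtain A where A: "A \<in> I" "c i \<in> A" "c j \<in> A"
      using adj_near[of i j] adj_near[of j i] adj_sym[OF ij(3)] ij no S by (cases i j rule: linorder_cases) auto
    then show False
      using tri_free[of i j 0] lettered[OF ij(1) A(1,2)] lettered[OF ij(2) A(1,3)] ij S Y(3) by blast
  qed
  have rim_edge: "adj c I (c i) (c (Suc i))" for i unfolding adj_def rim_adj_def by auto
  obtain i where i: "i \<in> S" using two[OF Y(3)] unfolding S_def by blast
  obtain lo hi where lh: "0 < lo" "lo \<le> i" "i \<le> hi" "{lo..hi} \<subseteq> S" "lo - 1 \<notin> S" "Suc hi \<notin> S"
    by (rule interval_ex[OF i _ finS]) (auto simp: S_def)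
  have loS: "lo \<in> S" and hiS: "hi \<in> S" using lh by auto
  have nb0: "y = 0 \<or> y \<in> S" if "y \<in> Y" for y using that unfolding S_def by auto
  have lo: "adj c I (c lo) (c 0)" "Suc lo \<in> S"
  proof -
    obtain j k where jk: "j \<noteq> k" "{x \<in> Y. adj c I (c lo) (c x)} = {j, k}" using two[OF S(3)[OF loS]] by blast
    have "x \<in> {0, Suc lo} \<and> (x = 0 \<or> x \<in> S)" if "x \<in> {j, k}" for x
    proof -
      have x: "x \<in> Y" "adj c I (c lo) (c x)" using that jk(2) by blast+
      then show ?thesis using nb0[OF x(1)] near[OF loS, of x] lh(5) by auto
    qed
    then have "{j, k} = {0, Suc lo}" "Suc lo \<in> S" using jk(1) by auto
    then show "adj c I (c lo) (c 0)" "Suc lo \<in> S" using jk(2) by blast+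
  qed
  have hi: "adj c I (c hi) (c 0)"
  proof -
    obtain j k where jk: "j \<noteq> k" "{x \<in> Y. adj c I (c hi) (c x)} = {j, k}" using two[OF S(3)[OF hiS]] by blast
    have "x \<in> {0, hi - 1}" if "x \<in> {j, k}" for x
    proof -
      have x: "x \<in> Y" "adj c I (c hi) (c x)" using that jk(2) by blast+
      then show ?thesis using nb0[OF x(1)] near[OF hiS, of x] lh(6) by auto
    qed
    then have "0 \<in> {j, k}" using jk(1) by blast
    then show ?thesis using jk(2) by blast
  qed
  have lohi: "lo < hi" using lh lo(2) by (metis le_antisym le_trans nat_less_le)
  \<comment> \<open>A clique vertex inside the run would have three neighbours in the hole: the root
    and both rim neighbours.\<close>
  have inner: "c t \<notin> \<Union>I" if t: "lo < t" "t < hi" for t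
  proof
    assume "c t \<in> \<Union>I"
    have "{t - 1, t, Suc t} \<subseteq> {lo..hi}" using t by auto
    then have tS: "t \<in> S" "t - 1 \<in> S" "Suc t \<in> S" using lh(4) by blast+
    then have "adj c I (c t) (c 0)" using \<open>c t \<in> \<Union>I\<close> lettered by blast
    moreover have "adj c I (c t) (c (Suc t))" by (rule rim_edge)
    moreover have "adj c I (c t) (c (t - 1))" using adj_sym[OF rim_edge[of "t - 1"]] t by simp
    ultimately have "{0, Suc t, t - 1} \<subseteq> {x \<in> Y. adj c I (c t) (c x)}" using Y(3) tS S by auto
    moreover obtain j k where "{x \<in> Y. adj c I (c t) (c x)} = {j, k}" using two[OF S(3)[OF tS(1)]] by blast
    ultimately have "{0, Suc t, t - 1} \<subseteq> {j, k}" by simp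
    moreover have "card {0, Suc t, t - 1} = 3" using t lh(1) by auto
    ultimately show False using card_mono[of "{j, k}" "{0, Suc t, t - 1}"] by (auto simp: card_insert_if split: if_splits)
  qed
  have nbr0: "x = lo \<or> x = hi" if "x \<in> Y" "adj c I (c 0) (c x)" for x
  proof -
    obtain j k where jk: "{x \<in> Y. adj c I (c 0) (c x)} = {j, k}" using two[OF Y(3)] by blast
    have "lo \<in> {j, k}" "hi \<in> {j, k}" "x \<in> {j, k}"
      unfolding jk[symmetric] using adj_sym lo hi S loS hiS that by auto
    then show ?thesis using lohi by auto
  qed
  have "insert 0 {lo..hi} = Y"
  proof (rule conn)
    show "insert 0 {lo..hi} \<subseteq> Y" using lh(4) S Y(3) by auto
    fix x y assume x: "x \<in> insert 0 {lo..hi}" and y: "y \<in> Y" "adj c I (c x) (c y)"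
    show "y \<in> insert 0 {lo..hi}"
    proof (cases "x = 0")
      case True then show ?thesis using nbr0[OF y(1)] y(2) lohi by auto
    next
      case False
      then have xS: "x \<in> S" "lo \<le> x" "x \<le> hi" using x lh(4) by auto
      show ?thesis
      proof (cases "y = 0")
        case False
        then have yS: "y \<in> S" using y unfolding S_def by auto
        then have "y \<noteq> lo - 1" "y \<noteq> Suc hi" using lh by auto
        then show ?thesis using near[OF xS(1) yS y(2)] xS by auto
      qed simp
    qed
  qed simp
  moreover have "card (insert 0 {lo..hi}) = hi - lo + 2" using lh(1) lohi by simp
  ultimately have par: "odd (hi - lo)" using Y(2) by auto
  have hin: "hi < n" using S hiS by blast
  have endpoint: "p = 1 \<or> Suc p = n \<or> (\<exists>A\<in>I. c p \<in> A)" if "adj c I (c p) (c 0)" "0 < p" "p < n" for p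
    using adj_near[of 0 p] adj_sym[OF that(1)] that by auto
  have linI: "odd (q - p) \<longleftrightarrow> (\<exists>A\<in>I. c p \<in> A \<and> c q \<in> A)"
    if "p < q" "q \<le> n" "c p \<in> \<Union>I" "c q \<in> \<Union>I" "\<forall>t. p < t \<and> t < q \<longrightarrow> c t \<notin> \<Union>I" for p q
    using lin_sub[of I, unfolded lin_def] \<open>I \<noteq> {}\<close> that by blast
  have rootU: "c 0 \<in> \<Union>I" using root \<open>I \<noteq> {}\<close> by blast
  show False
  \<comment> \<open>An end is adjacent to the root through a clique or as position \<open>1\<close>
    or \<open>n - 1\<close>. If both ends lie in cliques, their odd gap puts them into the same one,
    giving a triangle. If only one does, the gap from it past the other end to the root is even,
    though its ends share a clique. If neither does, no clique has a vertex besides the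
    root.\<close>
  proof (cases "c lo \<in> \<Union>I")
    case loU: True
    show False
    proof (cases "c hi \<in> \<Union>I")
      case True
      then obtain A where A: "A \<in> I" "c lo \<in> A" "c hi \<in> A"
        using linI[of lo hi] loU inner lohi hin par by auto
      then have "adj c I (c lo) (c hi)" using lohi hin c_neq[of lo hi] unfolding adj_def by auto
      then show False using tri_free[of lo hi 0] lo hi Y(3) S loS hiS by blast
    next
      case False
      then have "Suc hi = n" using endpoint[OF hi] hin lohi lh(1) by auto
      then have "c t \<notin> \<Union>I" if "lo < t" "t < n" for t using inner[of t] that False by (cases "t = hi") auto
      moreover have "\<exists>A\<in>I. c lo \<in> A \<and> c n \<in> A" using loU root by auto
      ultimately have "odd (n - lo)" using linI[of lo n] loU rootU lohi hin by auto
      moreover have "n - lo = Suc (hi - lo)" using \<open>Suc hi = n\<close> lohi by auto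
      ultimately show False using par by simp
    qed
  next
    case loN: False
    then have lo1: "lo = 1" using endpoint[OF lo(1)] lohi hin lh(1) by auto
    show False
    proof (cases "c hi \<in> \<Union>I")
      case True
      have "c t \<notin> \<Union>I" if "0 < t" "t < hi" for t using inner[of t] loN lo1 that by (cases "t = lo") auto
      moreover have "\<exists>A\<in>I. c 0 \<in> A \<and> c hi \<in> A" using True root by auto
      ultimately have "odd (hi - 0)" using linI[of 0 hi] True rootU lohi hin by auto
      then show False using par lo1 lohi by auto
    next
      case False
      then have hn: "Suc hi = n" using endpoint[OF hi] hin lohi lh(1) by auto
      obtain A where A: "A \<in> I" using \<open>I \<noteq> {}\<close> by blast
      have "first A = lo \<or> first A = hi \<or> lo < first A \<and> first A < hi"
        using first(1,2)[OF A] hn lo1 by linarith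
      then show False using inner loN False first(3)[OF A] A by blast
    qed
  qed
qed

text \<open>Away from the root a vertex lies in at most one clique, so the absence of triangles
  allows it at most one clique neighbour in the hole, its mate. Apart from the edges between mates,
  the hole consists of rim segments with mated ends and unmated inner vertices.\<close>

lemma no_hole_off_root:
  assumes Y: "Y \<subseteq> {..<n}" "odd (card Y)" "0 \<notin> Y"
    and two: "\<And>i. i \<in> Y \<Longrightarrow> \<exists>j k. j \<noteq> k \<and> {x \<in> Y. adj c I (c i) (c x)} = {j, k}"
    and tri_free: "\<And>i j k. i \<in> Y \<Longrightarrow> j \<in> Y \<Longrightarrow> k \<in> Y \<Longrightarrow> adj c I (c i) (c j) \<Longrightarrow> adj c I (c j) (c k) \<Longrightarrow>
      adj c I (c i) (c k) \<Longrightarrow> False"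
    and conn: "\<And>Z. Z \<subseteq> Y \<Longrightarrow> Z \<noteq> {} \<Longrightarrow> (\<And>x y. x \<in> Z \<Longrightarrow> y \<in> Y \<Longrightarrow> adj c I (c x) (c y) \<Longrightarrow> y \<in> Z) \<Longrightarrow> Z = Y"
  shows False
proof -
  have pos: "0 < i" "i < n" if "i \<in> Y" for i using that Y by (auto intro: gr0I)
  have finY: "finite Y" using Y(1) finite_subset by auto
  define mate where "mate i j \<longleftrightarrow> i \<in> Y \<and> j \<in> Y \<and> i \<noteq> j \<and> (\<exists>A\<in>I. c i \<in> A \<and> c j \<in> A)" for i j
  define mated where "mated i \<longleftrightarrow> (\<exists>j. mate i j)" for i
  have mate_sym: "mate i j \<Longrightarrow> mate j i" for i j unfolding mate_def by blast
  have cneq: "c i \<noteq> c j" if "i \<in> Y" "j \<in> Y" "i \<noteq> j" for i j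
    using that pos[OF that(1)] pos[OF that(2)] by (simp add: c_eq_iff)
  have mate_adj: "adj c I (c i) (c j)" if "mate i j" for i j
    using that cneq[of i j] unfolding mate_def adj_def by auto
  have near: "j = Suc i \<or> i = Suc j \<or> mate i j" if ij: "i \<in> Y" "j \<in> Y" "adj c I (c i) (c j)" for i j
  proof -
    have "i \<noteq> j" using ij(3) adj_irrefl by auto
    then show ?thesis
      using adj_near[of i j] adj_near[of j i] adj_sym[OF ij(3)] ij pos unfolding mate_def
      by (cases i j rule: linorder_cases) auto
  qed
  have mate_uniq: "j = k" if m: "mate i j" "mate i k" for i j k
  proof (rule ccontr)
    assume "j \<noteq> k"
    obtain A B where AB: "A \<in> I" "c i \<in> A" "c j \<in> A" "B \<in> I" "c i \<in> B" "c k \<in> B"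
      using m unfolding mate_def by blast
    have "i \<in> Y" "j \<in> Y" "k \<in> Y" using m unfolding mate_def by auto
    moreover have "A = B" using unique[of A B i] AB pos[OF \<open>i \<in> Y\<close>] by blast
    ultimately have "mate j k" using AB \<open>j \<noteq> k\<close> unfolding mate_def by blast
    then show False
      using tri_free[of i j k] mate_adj[OF m(1)] mate_adj[OF m(2)] mate_adj[of j k] \<open>i \<in> Y\<close> \<open>j \<in> Y\<close> \<open>k \<in> Y\<close>
      by blast
  qed
  have not_rim_mate: "\<not> mate i (Suc i)" "\<not> mate (Suc i) i" for i using indep unfolding mate_def by blast+
  have rim_edge: "adj c I (c i) (c (Suc i))" for i unfolding adj_def rim_adj_def by auto
  have nbrs: "\<exists>j k. j \<noteq> k \<and> (\<forall>x. x \<in> Y \<and> adj c I (c i) (c x) \<longleftrightarrow> x = j \<or> x = k)" if i: "i \<in> Y" for i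
    using two[OF i] by (metis (mono_tags, lifting) insert_iff mem_Collect_eq singletonD)
  have end_mated: "mated i" if i: "i \<in> Y" and e: "e = Suc i \<or> i = Suc e" "e \<notin> Y" for i e
  proof (rule ccontr)
    assume "\<not> mated i"
    obtain j k where jk: "j \<noteq> k" "\<forall>x. x \<in> Y \<and> adj c I (c i) (c x) \<longleftrightarrow> x = j \<or> x = k" using nbrs[OF i] by blast
    have "x \<noteq> e \<and> (x = Suc i \<or> i = Suc x)" if "x = j \<or> x = k" for x
      using near[OF i, of x] that jk(2) \<open>\<not> mated i\<close> e(2) unfolding mated_def by blast
    then have "j \<noteq> e \<and> (j = Suc i \<or> i = Suc j)" "k \<noteq> e \<and> (k = Suc i \<or> i = Suc k)" by blast+
    then show False using jk(1) e(1) by auto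
  qed
  \<comment> \<open>A position of the hole without a rim neighbour in it would need two
    mates.\<close>
  have not_isolated: "Suc i \<in> Y" if i: "i \<in> Y" "i - 1 \<notin> Y" for i
  proof (rule ccontr)
    assume n: "Suc i \<notin> Y"
    obtain j k where jk: "j \<noteq> k" "\<forall>x. x \<in> Y \<and> adj c I (c i) (c x) \<longleftrightarrow> x = j \<or> x = k" using nbrs[OF i(1)] by blast
    have "mate i x" if "x = j \<or> x = k" for x
    proof -
      have "x \<in> Y" "adj c I (c i) (c x)" using jk(2) that by blast+
      then show ?thesis using near[OF i(1), of x] n i by auto
    qed
    then show False using mate_uniq[of i j k] jk(1) by blast
  qed
  have inner: "\<not> mated t" if t: "t \<in> Y" "Suc t \<in> Y" "t - 1 \<in> Y" for t
  proof
    assume "mated t"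
    then obtain m where m: "mate t m" unfolding mated_def by blast
    obtain j k where jk: "\<forall>x. x \<in> Y \<and> adj c I (c t) (c x) \<longleftrightarrow> x = j \<or> x = k" using nbrs[OF t(1)] by blast
    have t0: "Suc (t - 1) = t" using pos[OF t(1)] by simp
    have "adj c I (c t) (c (t - 1))" using adj_sym[OF rim_edge[of "t - 1"]] t0 by simp
    then have "t - 1 = j \<or> t - 1 = k" "Suc t = j \<or> Suc t = k" using jk t rim_edge[of t] by blast+
    moreover have "m = j \<or> m = k" using jk mate_adj[OF m] m unfolding mate_def by blast
    moreover have "m \<noteq> Suc t" "m \<noteq> t - 1" using m not_rim_mate[of t] not_rim_mate[of "t - 1"] t0 by auto
    ultimately show False using t0 by auto
  qed
  define seg where "seg lo hi \<longleftrightarrow> 0 < lo \<and> lo < hi \<and> {lo..hi} \<subseteq> Y \<and> lo - 1 \<notin> Y \<and> Suc hi \<notin> Y" for lo hi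
  have seg_ex: "\<exists>lo hi. seg lo hi \<and> lo \<le> i \<and> i \<le> hi" if i: "i \<in> Y" for i
  proof -
    obtain lo hi where lh: "0 < lo" "lo \<le> i" "i \<le> hi" "{lo..hi} \<subseteq> Y" "lo - 1 \<notin> Y" "Suc hi \<notin> Y"
      using interval_ex[OF i Y(3) finY] .
    then have "lo \<in> Y" by auto
    then have "Suc lo \<in> Y" using not_isolated lh by blast
    then have "lo < hi" using lh by (metis le_antisym le_trans nat_less_le)
    then show ?thesis using lh unfolding seg_def by blast
  qed
  have seg_mated: "mated lo" "mated hi" "lo \<in> Y" "hi \<in> Y" if "seg lo hi" for lo hi
  proof -
    have "lo < hi" "{lo..hi} \<subseteq> Y" using that unfolding seg_def by blast+
    then show Y: "lo \<in> Y" "hi \<in> Y" by auto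
    show "mated lo" "mated hi"
      using that end_mated[OF Y(1), of "lo - 1"] end_mated[OF Y(2), of "Suc hi"] unfolding seg_def by auto
  qed
  have seg_inner: "t \<in> Y" "\<not> mated t" if s: "seg lo hi" and t: "lo < t" "t < hi" for lo hi t
  proof -
    have "{t - 1, t, Suc t} \<subseteq> {lo..hi}" using t by auto
    then have "t - 1 \<in> Y" "t \<in> Y" "Suc t \<in> Y" using s unfolding seg_def by blast+
    then show "t \<in> Y" "\<not> mated t" using inner by blast+
  qed
  \<comment> \<open>An inner vertex of a segment may lie in a clique, but not in one containing a
    mated vertex \<open>y\<close> of the hole: it would then be a mate of \<open>y\<close>.\<close>
  have mated_out: "c t \<notin> A" if s: "seg lo hi" "lo < t" "t < hi" and A: "A \<in> I" "y \<in> Y" "c y \<in> A" "mated y" for lo hi t A y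
  proof
    assume "c t \<in> A"
    have "y \<noteq> t" using seg_inner[OF s] A by blast
    then have "mate t y" using seg_inner[OF s] A \<open>c t \<in> A\<close> unfolding mate_def by blast
    then show False using seg_inner[OF s] unfolding mated_def by blast
  qed
  have mated_clique: "\<exists>A\<in>I. c i \<in> A" if "mated i" for i using that unfolding mated_def mate_def by blast
  have ends_differ: "A \<noteq> B" and seg_even: "even (hi - lo)"
    if s: "seg lo hi" and A: "A \<in> I" "c lo \<in> A" and B: "B \<in> I" "c hi \<in> B" for lo hi A B
  proof -
    have lh: "lo < hi" "hi \<le> n" "lo \<in> Y" "hi \<in> Y" using s seg_mated(3,4)[OF s] pos unfolding seg_def by (auto simp: less_imp_le)
    have out: "c t \<notin> A" "c t \<notin> B" if "lo < t" "t < hi" for t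
      using mated_out[OF s that A(1) lh(3) A(2)] mated_out[OF s that B(1) lh(4) B(2)] seg_mated[OF s] by auto
    \<comment> \<open>Other cliques may have vertices inside the segment, so the parity is taken
      from the subfamily consisting of \<open>A\<close> and \<open>B\<close> only.\<close>
    have "lin n c {A, B}" using lin_sub A B by auto
    then have par: "odd (hi - lo) \<longleftrightarrow> (\<exists>X\<in>{A, B}. c lo \<in> X \<and> c hi \<in> X)"
      using lh A B out unfolding lin_def by auto
    show ne: "A \<noteq> B"
    proof
      assume "A = B"
      then have m: "mate lo hi" using A B lh unfolding mate_def by auto
      \<comment> \<open>If the ends are mates, the segment closed by their edge is already the whole
        hole. It has \<open>hi - lo + 1\<close> vertices, an even number because the gap is
        odd.\<close>
      have "{lo..hi} = Y"
      proof (rule conn)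
        show "{lo..hi} \<subseteq> Y" using s unfolding seg_def by blast
        show "{lo..hi} \<noteq> {}" using lh by auto
        fix x y assume x: "x \<in> {lo..hi}" and y: "y \<in> Y" "adj c I (c x) (c y)"
        have "x \<in> Y" using x s unfolding seg_def by blast
        from near[OF this y] consider "y = Suc x \<or> x = Suc y" | "mate x y" by blast
        then show "y \<in> {lo..hi}"
        proof cases
          case 1
          have "y \<noteq> Suc hi" "y \<noteq> lo - 1" using y(1) s unfolding seg_def by auto
          then show ?thesis using 1 x by auto
        next
          case 2
          then have "mated x" unfolding mated_def by blast
          then have "x = lo \<or> x = hi" using seg_inner[OF s, of x] x by fastforce
          then have "y = hi \<or> y = lo" using mate_uniq[OF 2] m mate_sym[OF m] by blast
          then show ?thesis using lh by auto
        qed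
      qed
      then have "card Y = Suc (hi - lo)" using lh by auto
      then show False using Y(2) par A B \<open>A = B\<close> by auto
    qed
    have "c hi \<notin> A" "c lo \<notin> B" using unique[OF A(1) B(1)] A B ne pos lh by blast+
    then show "even (hi - lo)" using par A B by auto
  qed
  have "Y \<noteq> {}" using Y(2) by auto
  \<comment> \<open>Only cliques that contribute an edge to the hole are compared. The one with
    least \<open>first\<close> is the outermost, so the segments leaving it end in later
    cliques.\<close>
  define U where "U = {A \<in> I. \<exists>i\<in>Y. c i \<in> A \<and> mated i}"
  have "U \<noteq> {}"
  proof -
    obtain i where "i \<in> Y" using \<open>Y \<noteq> {}\<close> by blast
    then obtain lo hi where "seg lo hi" using seg_ex by blast
    then show ?thesis using seg_mated[of lo hi] mated_clique unfolding U_def by blast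
  qed
  then obtain A where A: "A \<in> U" and least: "\<And>B. B \<in> U \<Longrightarrow> first A \<le> first B"
    using ex_has_least_nat[of "\<lambda>A. A \<in> U" _ first] by blast
  have UI: "B \<in> I" if "B \<in> U" for B using that unfolding U_def by blast
  define link where "link a b \<longleftrightarrow> seg (min a b) (max a b)" for a b
  have link_ex: "\<exists>b. link a b" if a: "a \<in> Y" "mated a" for a
  proof -
    obtain lo hi where s: "seg lo hi" "lo \<le> a" "a \<le> hi" using seg_ex[OF a(1)] by blast
    then have "a = lo \<or> a = hi" using seg_inner(2)[OF s(1), of a] a by fastforce
    moreover have "lo < hi" using s(1) unfolding seg_def by blast
    ultimately have "link a hi \<or> link a lo" using s(1) unfolding link_def by auto
    then show ?thesis by blast
  qed
  have link_sym: "link a b \<Longrightarrow> link b a" for a b unfolding link_def by (simp add: min.commute max.commute)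
  have link_mated: "mated a" "a \<in> Y" if "link a b" for a b
    using seg_mated[OF that[unfolded link_def]] by (auto simp: min_def max_def split: if_splits)
  have link_differ: "X \<noteq> Z" if l: "link a b" and X: "X \<in> I" "c a \<in> X" "Z \<in> I" "c b \<in> Z" for a b X Z
    using ends_differ[OF l[unfolded link_def], of X Z] ends_differ[OF l[unfolded link_def], of Z X] X
    by (cases "a \<le> b") (auto simp: min_def max_def)
  have link_even: "even (max a b - min a b)" if l: "link a b" for a b
  proof -
    obtain X Z where "X \<in> I" "c (min a b) \<in> X" "Z \<in> I" "c (max a b) \<in> Z"
      using mated_clique seg_mated[OF l[unfolded link_def]] by metis
    then show ?thesis using seg_even[OF l[unfolded link_def]] by blast
  qed
  obtain a where a: "a \<in> Y" "c a \<in> A" "mated a" using A unfolding U_def by blast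
  then obtain a' where m: "mate a a'" unfolding mated_def by blast
  have a': "a' \<in> Y" "a \<noteq> a'" "mated a'" using m mate_sym[OF m] unfolding mate_def mated_def by blast+
  have "c a' \<in> A"
  proof -
    obtain B where "B \<in> I" "c a \<in> B" "c a' \<in> B" using m unfolding mate_def by blast
    then show ?thesis using unique[of A B a] a UI[OF A] pos[OF a(1)] by blast
  qed
  obtain b b' where b: "link a b" and b': "link a' b'" using link_ex a a' by blast
  have bY: "b \<in> Y" "mated b" "b' \<in> Y" "mated b'" using link_mated link_sym b b' by blast+
  obtain B B' where B: "B \<in> I" "c b \<in> B" and B': "B' \<in> I" "c b' \<in> B'" using mated_clique bY by blast
  have BU: "B \<in> U" "B' \<in> U" using B B' bY unfolding U_def by blast+
  have AB: "A \<noteq> B" "A \<noteq> B'"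
    using link_differ[OF b UI[OF A] a(2) B] link_differ[OF b' UI[OF A] \<open>c a' \<in> A\<close> B'] by blast+
  have lt: "first A < first B" "first A < first B'"
    using least BU first_inj[OF UI[OF A]] B B' AB by (metis le_neq_implies_less)+
  \<comment> \<open>Were the far ends of the two segments in different cliques, the earlier of these
    would separate the ends of the segment leading to the later one; but no clique with a mated
    vertex meets the inside of a segment.\<close>
  have skip: "\<not> first X < first Z"
    if l: "link p q" and pq: "c p \<in> A" "Z \<in> I" "c q \<in> Z" and X: "X \<in> I" "y \<in> Y" "c y \<in> X" "mated y" "first A < first X" for p q X Z y
  proof
    assume "first X < first Z"
    then have XZ: "first X < first Z" .
    have p: "p \<in> Y" and q: "q \<in> Y" using link_mated(2)[OF l] link_mated(2)[OF link_sym[OF l]] by simp_all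
    obtain t where t: "min p q < t" "t < max p q" "c t \<in> X"
      using between[OF UI[OF A] X(1) pq(2) X(5) XZ pos[OF p] pq(1) pos[OF q] pq(3)] by blast
    then show False using mated_out[OF l[unfolded link_def] t(1,2) X(1) _ X(3)] X link_mated by blast
  qed
  have "B = B'"
    using skip[OF b' \<open>c a' \<in> A\<close> B' B(1) bY(1) B(2) bY(2) lt(1)] skip[OF b a(2) B B'(1) bY(3) B'(2) bY(4) lt(2)]
      first_inj[OF B(1) B'(1)] by linarith
  \<comment> \<open>Segments with a common position coincide by maximality. This would give
    \<open>a = b'\<close>, a vertex in both \<open>A\<close> and \<open>B'\<close>.\<close>
  have disj: "{min a b..max a b} \<inter> {min a' b'..max a' b'} = {}"
  proof (rule ccontr)
    assume "\<not> ?thesis"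
    then obtain x where "x \<in> {min a b..max a b}" "x \<in> {min a' b'..max a' b'}" by blast
    then have x: "min a b \<le> x" "x \<le> max a b" "min a' b' \<le> x" "x \<le> max a' b'"
      by (simp_all only: atLeastAtMost_iff)
    have eq: "l = l' \<and> h = h'" if "seg l h" "seg l' h'" "l \<le> x" "x \<le> h" "l' \<le> x" "x \<le> h'" for l h l' h'
    proof -
      have in_seg: "t \<in> Y" if "seg l h" "l \<le> t" "t \<le> h" for l h t using that unfolding seg_def by auto
      have out: "l - 1 \<notin> Y" "l' - 1 \<notin> Y" "Suc h \<notin> Y" "Suc h' \<notin> Y" using that(1,2) unfolding seg_def by blast+
      have "\<not> l < l'" using in_seg[OF that(1), of "l' - 1"] out that(3-6) by linarith
      moreover have "\<not> l' < l" using in_seg[OF that(2), of "l - 1"] out that(3-6) by linarith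
      moreover have "\<not> h < h'" using in_seg[OF that(2), of "Suc h"] out that(3-6) by linarith
      moreover have "\<not> h' < h" using in_seg[OF that(1), of "Suc h'"] out that(3-6) by linarith
      ultimately show ?thesis by auto
    qed
    have "min a b = min a' b' \<and> max a b = max a' b'" using eq[OF b[unfolded link_def] b'[unfolded link_def]] x by blast
    then have "a = b'" using a'(2) by (auto simp: min_def max_def split: if_splits)
    then show False using unique[of A B' a] a UI[OF A] B' AB pos[OF a(1)] by blast
  qed
  have "b \<noteq> b'" using disj by (auto simp: min_def max_def split: if_splits)
  have mb: "mate b b'" using \<open>b \<noteq> b'\<close> bY B B' \<open>B = B'\<close> unfolding mate_def by blast
  have "{min a b..max a b} \<union> {min a' b'..max a' b'} = Y"
  proof (rule conn)
    show "{min a b..max a b} \<union> {min a' b'..max a' b'} \<subseteq> Y"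
      using b b' unfolding link_def seg_def by blast
    show "{min a b..max a b} \<union> {min a' b'..max a' b'} \<noteq> {}" by auto
    have cl: "y \<in> {min p q..max p q} \<or> x = p \<and> mate p y \<or> x = q \<and> mate q y"
      if l: "link p q" and x: "x \<in> {min p q..max p q}" and y: "y \<in> Y" "adj c I (c x) (c y)" for p q x y
    proof -
      have s: "seg (min p q) (max p q)" using l unfolding link_def .
      have "x \<in> Y" using x s unfolding seg_def by blast
      from near[OF this y] consider "y = Suc x \<or> x = Suc y" | "mate x y" by blast
      then show ?thesis
      proof cases
        case 1
        have "y \<noteq> Suc (max p q)" "y \<noteq> min p q - 1" using y(1) s unfolding seg_def by auto
        then show ?thesis using 1 x by auto
      next
        case 2
        then have "mated x" unfolding mated_def by blast
        then have "x = min p q \<or> x = max p q" using seg_inner[OF s, of x] x by fastforce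
        then show ?thesis using 2 by (auto simp: min_def max_def split: if_splits)
      qed
    qed
    fix x y assume x: "x \<in> {min a b..max a b} \<union> {min a' b'..max a' b'}" and y: "y \<in> Y" "adj c I (c x) (c y)"
    have m': "mate a y \<Longrightarrow> y = a'" "mate a' y \<Longrightarrow> y = a" "mate b y \<Longrightarrow> y = b'" "mate b' y \<Longrightarrow> y = b"
      using mate_uniq m mb mate_sym by blast+
    have "y \<in> {min a b..max a b} \<or> y \<in> {min a' b'..max a' b'} \<or> y = a' \<or> y = a \<or> y = b' \<or> y = b"
      using x cl[OF b _ y] cl[OF b' _ y] m' by blast
    then show "y \<in> {min a b..max a b} \<union> {min a' b'..max a' b'}" by auto
  qed
  then have "card Y = card {min a b..max a b} + card {min a' b'..max a' b'}"
    using card_Un_disjoint[OF _ _ disj] by auto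
  also have "\<dots> = Suc (max a b - min a b) + Suc (max a' b' - min a' b')"
    by (simp only: card_atLeastAtMost Suc_diff_le[OF min.coboundedI1[OF max.cobounded1]])
  finally have "even (card Y)" using link_even[OF b] link_even[OF b'] by (simp only: even_add even_Suc)
  then show False using Y(2) by blast
qed

theorem hole_free:
  assumes "I \<noteq> {}"
  shows "\<not> ohole (adj c I) vs"
proof
  assume h: "ohole (adj c I) vs"
  have "symp (adj c I)" "irreflp (adj c I)" using adj_sym adj_irrefl by (auto intro: sympI irreflpI)
  note H = ohole_neighbours[OF h this]
  have X: "set vs \<subseteq> range c"
  proof
    fix v assume "v \<in> set vs"
    then obtain u where "adj c I v u" using H(1) by blast
    then show "v \<in> range c" using sub unfolding adj_def rim_adj_def by (auto simp: doubleton_eq_iff)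
  qed
  define Y where "Y = {i. i < n \<and> c i \<in> set vs}"
  have img: "c ` Y = set vs"
  proof -
    have "v \<in> c ` Y" if "v \<in> set vs" for v
    proof -
      obtain i where "v = c i" using X \<open>v \<in> set vs\<close> by blast
      then have "v = c (i mod n)" "i mod n < n" using n_ge by (simp_all add: c_mod)
      then show ?thesis using that unfolding Y_def by blast
    qed
    then show ?thesis unfolding Y_def by blast
  qed
  have inj: "inj_on c Y" unfolding Y_def by (rule inj_onI) (simp add: c_eq_iff)
  have YX: "i \<in> Y \<Longrightarrow> c i \<in> set vs" for i unfolding Y_def by simp
  have "card Y = length vs"
    using card_image[OF inj] distinct_card[of vs] h unfolding img ohole_def by simp
  then have odd: "odd (card Y)" using h unfolding ohole_def by simp
  have Yn: "Y \<subseteq> {..<n}" unfolding Y_def by auto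
  have two: "\<exists>j k. j \<noteq> k \<and> {x \<in> Y. adj c I (c i) (c x)} = {j, k}" if i: "i \<in> Y" for i
  proof -
    obtain u w where uw: "u \<noteq> w" "{x \<in> set vs. adj c I (c i) x} = {u, w}" using H(1)[OF YX[OF i]] by blast
    then have "u \<in> c ` Y" "w \<in> c ` Y" unfolding img by blast+
    then obtain j k where jk: "j \<in> Y" "k \<in> Y" "u = c j" "w = c k" by blast
    have "{x \<in> Y. adj c I (c i) (c x)} = {x \<in> Y. c x \<in> {u, w}}" unfolding uw(2)[symmetric] using YX by blast
    also have "\<dots> = {j, k}"
    proof -
      have "c x \<in> {u, w} \<longleftrightarrow> x \<in> {j, k}" if "x \<in> Y" for x
        using inj_on_eq_iff[OF inj that jk(1)] inj_on_eq_iff[OF inj that jk(2)] jk(3,4) by simp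
      then show ?thesis using jk(1,2) by blast
    qed
    finally have "{x \<in> Y. adj c I (c i) (c x)} = {j, k}" .
    moreover have "j \<noteq> k" using uw(1) jk(3,4) by auto
    ultimately show ?thesis by metis
  qed
  have tri_free: False if "i \<in> Y" "j \<in> Y" "k \<in> Y" "adj c I (c i) (c j)" "adj c I (c j) (c k)" "adj c I (c i) (c k)" for i j k
    using H(2)[OF YX YX YX] that by blast
  have conn: "Z = Y" if Z: "Z \<subseteq> Y" "Z \<noteq> {}" "\<And>x y. x \<in> Z \<Longrightarrow> y \<in> Y \<Longrightarrow> adj c I (c x) (c y) \<Longrightarrow> y \<in> Z" for Z
  proof -
    have "c ` Z = set vs"
    proof (rule H(3))
      show "c ` Z \<subseteq> set vs" "c ` Z \<noteq> {}" using Z YX by auto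
      fix x y assume "x \<in> c ` Z" "y \<in> set vs" "adj c I x y"
      then show "y \<in> c ` Z" using Z(3) unfolding img[symmetric] by blast
    qed
    then show ?thesis using Z(1) inj inj_on_image_eq_iff[OF inj Z(1) subset_refl] img by blast
  qed
  show False
  proof (cases "0 \<in> Y")
    case True
    show False by (rule no_hole_at_root[OF Yn odd True two tri_free conn assms])
  next
    case False
    show False by (rule no_hole_off_root[OF Yn odd False two tri_free conn])
  qed
qed

end

context sun
begin

theorem hole_free_if_npos:
  assumes np: "\<And>F. F \<subseteq> I \<Longrightarrow> F \<noteq> {} \<Longrightarrow> npos n c F" and "I \<noteq> {}"
  shows "\<not> ohole (adj c I) vs"
proof -
  obtain \<xi> where "\<xi> \<in> range c" and xi: "\<And>A. A \<in> I \<Longrightarrow> \<xi> \<in> A"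
    using np[OF subset_refl \<open>I \<noteq> {}\<close>, unfolded npos_def, THEN conjunct2, THEN conjunct2, THEN conjunct1] by blast
  then obtain k where k: "\<xi> = c k" by blast
  interpret r: sun n "\<lambda>i. c (i + k)" I by (rule rotate_sun)
  interpret R: rooted n "\<lambda>i. c (i + k)" I
  proof
    show "A \<in> I \<Longrightarrow> c (0 + k) \<in> A" for A using xi k by simp
    show "lin n (\<lambda>i. c (i + k)) F" if F: "F \<subseteq> I" "F \<noteq> {}" for F
      by (rule r.npos_imp_lin) (use np[OF F] npos_rotate xi k F in auto)
  qed
  show ?thesis using R.hole_free[OF \<open>I \<noteq> {}\<close>] unfolding adj_rotate .
qed

end

section \<open>Multisuns as cyclic enumerations\<close>

definition arc :: "(nat \<Rightarrow> 'a) \<Rightarrow> nat \<Rightarrow> nat \<Rightarrow> 'a list" where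
  "arc c i d = map (\<lambda>j. c (i + j)) [0..<Suc d]"

lemma arc_simps:
  "length (arc c i d) = Suc d" "j \<le> d \<Longrightarrow> arc c i d ! j = c (i + j)" "arc c i d \<noteq> []"
  "hd (arc c i d) = c i" "last (arc c i d) = c (i + d)"
  unfolding arc_def by (auto simp: hd_map last_map simp del: upt_Suc)

lemma set_inner_arc: "set (butlast (tl (arc c i d))) = {c (i + t) |t. 0 < t \<and> t < d}"
proof (cases d)
  case (Suc e)
  have "tl [0..<Suc d] = [1..<Suc d]" by (simp add: upt_rec[of 0] del: upt_Suc)
  moreover have "butlast [1..<Suc d] = [1..<d]" using Suc by simp
  ultimately have "butlast (tl (arc c i d)) = map (\<lambda>j. c (i + j)) [1..<d]"
    unfolding arc_def by (metis map_butlast map_tl)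
  then show ?thesis by auto
qed (auto simp: arc_def)

context rim
begin

lemma c_Suc_cancel: "c (Suc i) = c (Suc j) \<longleftrightarrow> c i = c j"
proof -
  have "(i + 1) mod n = (j + 1) mod n \<longleftrightarrow> i mod n = j mod n" by (simp add: nat_mod_eq_iff)
  then show ?thesis by (simp add: c_eq_iff)
qed

lemma distinct_arc:
  assumes "d < n"
  shows "distinct (arc c i d)"
proof -
  have "arc c i d ! j \<noteq> arc c i d ! k" if "j < k" "k \<le> d" for j k
    using c_neq[of "i + j" "i + k"] that assms by (simp add: arc_simps)
  then show ?thesis
    unfolding distinct_conv_nth arc_simps by (metis less_Suc_eq_le linorder_neqE_nat)
qed

text \<open>The first edge fixes a direction, and a path with distinct vertices cannot turn
  back.\<close>

lemma path_is_arc: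
  assumes "distinct P" "2 \<le> length P" and adjP: "\<And>i. Suc i < length P \<Longrightarrow> rim_adj c (P ! i) (P ! Suc i)"
  shows "\<exists>i d. 0 < d \<and> d < n \<and> (P = arc c i d \<or> P = rev (arc c i d))"
proof -
  define m where "m = length P"
  have ne: "P ! j \<noteq> P ! k" if "j \<noteq> k" "j < m" "k < m" for j k
    using assms(1) that unfolding m_def by (simp add: nth_eq_iff_index_eq)
  have m: "2 \<le> m" using assms(2) unfolding m_def .
  have st: "\<exists>k. P ! i = c k \<and> P ! Suc i = c (Suc k) \<or> P ! i = c (Suc k) \<and> P ! Suc i = c k" if "Suc i < m" for i
    using adjP[of i] that unfolding m_def rim_adj_def by (auto simp: doubleton_eq_iff)
  obtain k where k: "P ! 0 = c k \<and> P ! 1 = c (Suc k) \<or> P ! 0 = c (Suc k) \<and> P ! 1 = c k"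
    using st[of 0] m by auto
  have bound: "m - 1 < n" if "\<And>j. j < m \<Longrightarrow> P ! j = f j" "f n = f 0" for f
  proof (rule ccontr)
    assume "\<not> m - 1 < n"
    then have "n < m" "0 < m" using m by auto
    then show False using that ne[of 0 n] n_ge by auto
  qed
  from k show ?thesis
  proof
    assume k: "P ! 0 = c k \<and> P ! 1 = c (Suc k)"
    have P: "P ! j = c (k + j)" if "j < m" for j
      using that
    proof (induction j rule: less_induct)
      case (less j)
      consider "j = 0" | "j = 1" | i where "j = Suc (Suc i)" by (metis One_nat_def not0_implies_Suc)
      then show ?case
      proof cases
        case 3
        have IH: "P ! i = c (k + i)" "P ! Suc i = c (Suc (k + i))" using less.IH[of i] less.IH[of "Suc i"] less.prems 3 by auto
        obtain l where "P ! Suc i = c l \<and> P ! j = c (Suc l) \<or> P ! Suc i = c (Suc l) \<and> P ! j = c l"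
          using st[of "Suc i"] less.prems 3 by auto
        then show ?thesis
        proof
          assume "P ! Suc i = c l \<and> P ! j = c (Suc l)"
          then show ?thesis using IH 3 c_Suc_cancel[of l "Suc (k + i)"] by simp
        next
          assume "P ! Suc i = c (Suc l) \<and> P ! j = c l"
          then have "P ! j = P ! i" using IH c_Suc_cancel[of l "k + i"] by simp
          then show ?thesis using ne[of j i] less.prems 3 by simp
        qed
      qed (use k in auto)
    qed
    then have "P = arc c k (m - 1)"
      by (intro nth_equalityI) (use m in \<open>auto simp: arc_simps m_def[symmetric]\<close>)
    then show ?thesis using bound[of "\<lambda>j. c (k + j)", OF P] m by (intro exI[of _ k] exI[of _ "m - 1"]) auto
  next
    assume k: "P ! 0 = c (Suc k) \<and> P ! 1 = c k"
    \<comment> \<open>The added multiple of \<open>n\<close> keeps \<open>e - j\<close> from being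
      truncated at zero for \<open>j < m\<close>.\<close>
    define e where "e = Suc k + m * n"
    have "m * 1 \<le> m * n" by (rule mult_le_mono2) (use n_ge in simp)
    then have em: "m \<le> e" unfolding e_def by linarith
    have P: "P ! j = c (e - j)" if "j < m" for j
      using that
    proof (induction j rule: less_induct)
      case (less j)
      consider "j = 0" | "j = 1" | i where "j = Suc (Suc i)" by (metis One_nat_def not0_implies_Suc)
      then show ?case
      proof cases
        case 1
        then show ?thesis using k c_add_mult[of "Suc k" m] unfolding e_def by simp
      next
        case 2
        then show ?thesis using k c_add_mult[of k m] unfolding e_def by simp
      next
        case 3
        have IH: "P ! i = c (e - i)" "P ! Suc i = c (e - Suc i)" using less.IH[of i] less.IH[of "Suc i"] less.prems 3 by auto
        have ee: "e - i = Suc (e - Suc i)" "e - Suc i = Suc (e - j)" using em less.prems 3 by auto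
        obtain l where "P ! Suc i = c l \<and> P ! j = c (Suc l) \<or> P ! Suc i = c (Suc l) \<and> P ! j = c l"
          using st[of "Suc i"] less.prems 3 by auto
        then show ?thesis
        proof
          assume "P ! Suc i = c l \<and> P ! j = c (Suc l)"
          then have "P ! j = P ! i" using IH(1)[unfolded ee(1)] IH(2) c_Suc_cancel[of l "e - Suc i"] by simp
          then show ?thesis using ne[of j i] less.prems 3 by simp
        next
          assume "P ! Suc i = c (Suc l) \<and> P ! j = c l"
          then show ?thesis using IH(2)[unfolded ee(2)] c_Suc_cancel[of l "e - j"] by simp
        qed
      qed
    qed
    have "P = rev (arc c (e - (m - 1)) (m - 1))"
    proof (intro nth_equalityI)
      fix j assume "j < length P"
      then have "j < m" unfolding m_def .
      then have "rev (arc c (e - (m - 1)) (m - 1)) ! j = c (e - (m - 1) + (m - 1 - j))"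
        by (simp add: rev_nth arc_simps)
      also have "e - (m - 1) + (m - 1 - j) = e - j" using em \<open>j < m\<close> by simp
      finally show "P ! j = rev (arc c (e - (m - 1)) (m - 1)) ! j" using P \<open>j < m\<close> by simp
    qed (use m in \<open>auto simp: arc_simps m_def[symmetric]\<close>)
    moreover have "m - 1 < n"
    proof (rule bound[of "\<lambda>j. c (e - j)", OF P])
      show "c (e - n) = c (e - 0)"
      proof -
        have "1 * n \<le> m * n" by (rule mult_le_mono1) (use m in simp)
        then have "n \<le> e" unfolding e_def by linarith
        then show ?thesis using c_add_n(1)[of "e - n"] by simp
      qed
    qed auto
    ultimately show ?thesis using m by (intro exI[of _ "e - (m - 1)"] exI[of _ "m - 1"]) auto
  qed
qed

end

section \<open>From vertex lists to periodic enumerations\<close>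

definition rim_fun :: "'a list \<Rightarrow> nat \<Rightarrow> 'a" where
  "rim_fun cs i = cs ! (i mod length cs)"

lemma rim_rim_fun:
  assumes "distinct cs" "odd (length cs)" "3 \<le> length cs"
  shows "rim (length cs) (rim_fun cs)"
proof
  have "0 < length cs" using assms by (cases cs) auto
  then show "rim_fun cs i = rim_fun cs j \<longleftrightarrow> i mod length cs = j mod length cs" for i j
    unfolding rim_fun_def using assms(1) by (simp add: nth_eq_iff_index_eq)
qed (use assms in auto)

lemma range_rim_fun:
  assumes "cs \<noteq> []"
  shows "range (rim_fun cs) = set cs"
proof
  show "range (rim_fun cs) \<subseteq> set cs" using assms unfolding rim_fun_def by auto
  show "set cs \<subseteq> range (rim_fun cs)"
  proof
    fix x assume "x \<in> set cs"
    then obtain i where "i < length cs" "x = cs ! i" by (metis in_set_conv_nth)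
    then have "x = rim_fun cs i" unfolding rim_fun_def by simp
    then show "x \<in> range (rim_fun cs)" by blast
  qed
qed

lemma cycle_edges_rim_adj: "cs \<noteq> [] \<Longrightarrow> {u, v} \<in> cycle_edges cs \<longleftrightarrow> rim_adj (rim_fun cs) u v"
proof -
  assume "cs \<noteq> []"
  have "rim_adj (rim_fun cs) u v \<longleftrightarrow> (\<exists>i. {u, v} = {cs ! (i mod length cs), cs ! (Suc (i mod length cs) mod length cs)})"
    unfolding rim_adj_def rim_fun_def by (simp add: mod_Suc_eq)
  also have "\<dots> \<longleftrightarrow> (\<exists>i<length cs. {u, v} = {cs ! i, cs ! (Suc i mod length cs)})"
    using \<open>cs \<noteq> []\<close> by (metis length_greater_0_conv mod_less mod_less_divisor)
  finally show ?thesis unfolding cycle_edges_def by auto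
qed

lemma rim_path_iff_arc:
  assumes "3 \<le> length cs"
  shows "rim_path cs P \<longleftrightarrow> (\<exists>i d. 0 < d \<and> d < length cs \<and> (P = arc (rim_fun cs) i d \<or> P = rev (arc (rim_fun cs) i d)))"
proof
  assume "rim_path cs P"
  then obtain i l where il: "2 \<le> l" "l \<le> length cs"
    "P = map (\<lambda>j. cs ! ((i + j) mod length cs)) [0..<l] \<or> P = rev (map (\<lambda>j. cs ! ((i + j) mod length cs)) [0..<l])"
    unfolding rim_path_def by blast
  moreover have "map (\<lambda>j. cs ! ((i + j) mod length cs)) [0..<l] = arc (rim_fun cs) i (l - 1)"
    using il unfolding arc_def rim_fun_def by simp
  ultimately show "\<exists>i d. 0 < d \<and> d < length cs \<and> (P = arc (rim_fun cs) i d \<or> P = rev (arc (rim_fun cs) i d))"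
    by (intro exI[of _ i] exI[of _ "l - 1"]) auto
next
  assume "\<exists>i d. 0 < d \<and> d < length cs \<and> (P = arc (rim_fun cs) i d \<or> P = rev (arc (rim_fun cs) i d))"
  then obtain i d where d: "0 < d" "d < length cs" "P = arc (rim_fun cs) i d \<or> P = rev (arc (rim_fun cs) i d)" by blast
  have "arc (rim_fun cs) i d = map (\<lambda>j. cs ! ((i mod length cs + j) mod length cs)) [0..<Suc d]"
    unfolding arc_def rim_fun_def by (simp add: mod_add_left_eq)
  moreover have "i mod length cs < length cs" using assms by (intro mod_less_divisor) auto
  ultimately show "rim_path cs P" using d unfolding rim_path_def
    by (intro exI[of _ "i mod length cs"] conjI exI[of _ "Suc d"]) auto
qed

text \<open>\<open>N_conditions\<close> picks its own vertex list for the rim. Rim paths depend only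
  on the edge set of the cycle, so any two lists, whatever their start and direction, give the same
  conditions.\<close>

lemma rim_path_cong:
  assumes "distinct cs" "distinct ds" "odd (length cs)" "length ds = length cs" "3 \<le> length cs"
    and eq: "cycle_edges cs = cycle_edges ds" and p: "rim_path cs P"
  shows "rim_path ds P"
proof -
  interpret c: rim "length cs" "rim_fun cs" by (rule rim_rim_fun) (use assms in auto)
  interpret d: rim "length ds" "rim_fun ds" by (rule rim_rim_fun) (use assms in auto)
  have ne: "cs \<noteq> []" "ds \<noteq> []" using assms by auto
  have adj_eq: "rim_adj (rim_fun ds) = rim_adj (rim_fun cs)"
    using cycle_edges_rim_adj[OF ne(1)] cycle_edges_rim_adj[OF ne(2)] eq by (auto simp: fun_eq_iff)
  obtain i d where d: "0 < d" "d < length cs" "P = arc (rim_fun cs) i d \<or> P = rev (arc (rim_fun cs) i d)"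
    using p rim_path_iff_arc assms by blast
  have step: "rim_adj (rim_fun cs) (arc (rim_fun cs) i d ! j) (arc (rim_fun cs) i d ! Suc j)" if "Suc j \<le> d" for j
    using that unfolding rim_adj_def by (auto simp: arc_simps)
  have len: "length P = Suc d" using d by (auto simp: arc_simps)
  have "rim_adj (rim_fun ds) (P ! j) (P ! Suc j)" if j: "Suc j < length P" for j
    unfolding adj_eq using d(3)
  proof
    assume "P = arc (rim_fun cs) i d"
    then show "rim_adj (rim_fun cs) (P ! j) (P ! Suc j)" using step j len by auto
  next
    assume P: "P = rev (arc (rim_fun cs) i d)"
    have "P ! j = arc (rim_fun cs) i d ! Suc (d - Suc j)" "P ! Suc j = arc (rim_fun cs) i d ! (d - Suc j)"
      using j len unfolding P by (simp_all add: rev_nth arc_simps(1) Suc_diff_Suc)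
    then show "rim_adj (rim_fun cs) (P ! j) (P ! Suc j)" using step[of "d - Suc j"] j len rim_adj_sym by fastforce
  qed
  moreover have "distinct P" using d c.distinct_arc by auto
  ultimately show ?thesis
    using d.path_is_arc[of P] rim_path_iff_arc[of ds P] len d(1) assms by auto
qed

lemma path_between_iff:
  assumes "3 \<le> length cs"
  shows "path_between cs F X Y P \<longleftrightarrow> (\<exists>i d. 0 < d \<and> d < length cs \<and>
    (P = arc (rim_fun cs) i d \<or> P = rev (arc (rim_fun cs) i d)) \<and>
    (rim_fun cs i \<in> X \<and> rim_fun cs (i + d) \<in> Y \<or> rim_fun cs i \<in> Y \<and> rim_fun cs (i + d) \<in> X) \<and>
    (\<forall>t. 0 < t \<and> t < d \<longrightarrow> rim_fun cs (i + t) \<notin> \<Union>F))"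
proof -
  have inner: "set (butlast (tl (rev xs))) = set (butlast (tl xs))" for xs :: "'a list"
    by (metis butlast_rev butlast_tl rev_rev_ident set_rev)
  define G where "G i d \<longleftrightarrow> 0 < d \<and> d < length cs \<and> (P = arc (rim_fun cs) i d \<or> P = rev (arc (rim_fun cs) i d))" for i d
  define R where "R i d \<longleftrightarrow>
    (rim_fun cs i \<in> X \<and> rim_fun cs (i + d) \<in> Y \<or> rim_fun cs i \<in> Y \<and> rim_fun cs (i + d) \<in> X) \<and>
    (\<forall>t. 0 < t \<and> t < d \<longrightarrow> rim_fun cs (i + t) \<notin> \<Union>F)" for i d
  define L where "L \<longleftrightarrow> ((hd P \<in> X \<and> last P \<in> Y) \<or> (hd P \<in> Y \<and> last P \<in> X)) \<and>
    (\<forall>x\<in>set (butlast (tl P)). \<forall>K\<in>F. x \<notin> K)"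
  have "L \<longleftrightarrow> R i d" if "G i d" for i d
  proof -
    have "P = arc (rim_fun cs) i d \<or> P = rev (arc (rim_fun cs) i d)" using that unfolding G_def by blast
    then show ?thesis
    proof
      assume "P = arc (rim_fun cs) i d"
      then show ?thesis unfolding L_def R_def by (auto simp: arc_simps set_inner_arc)
    next
      assume "P = rev (arc (rim_fun cs) i d)"
      then show ?thesis unfolding L_def R_def by (auto simp: arc_simps set_inner_arc inner hd_rev last_rev)
    qed
  qed
  then have "(\<exists>i d. G i d) \<and> L \<longleftrightarrow> (\<exists>i d. G i d \<and> R i d)" by blast
  then show ?thesis
    unfolding path_between_def rim_path_iff_arc[OF assms] G_def R_def L_def by (simp only: conj_assoc)
qed

lemma N_conditions_iff_npos:
  assumes r: "is_rim V E cs" and o: "odd (length cs)" and s: "sun (length cs) (rim_fun cs) (inscribed V E)"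
  shows "N_conditions V E \<longleftrightarrow> npos (length cs) (rim_fun cs) (inscribed V E)"
proof -
  interpret sun "length cs" "rim_fun cs" "inscribed V E" by (rule s)
  define F where "F = inscribed V E"
  note [simp] = F_def[symmetric]
  have h: "distinct cs" "set cs = V" "3 \<le> length cs" "cycle_edges cs = rim_edges V E"
    using r unfolding is_rim_def hamiltonian_list_def by auto
  have ne: "cs \<noteq> []" using h by auto
  show ?thesis
  proof
    assume np: "npos (length cs) (rim_fun cs) (inscribed V E)"
    then obtain \<xi> where xi: "\<xi> \<in> range (rim_fun cs)" "\<And>A. A \<in> F \<Longrightarrow> \<xi> \<in> A" "\<And>A B. A \<in> F \<Longrightarrow> B \<in> F \<Longrightarrow> A \<noteq> B \<Longrightarrow> A \<inter> B = {\<xi>}"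
      using npos_common[OF np] unfolding F_def[symmetric] by blast
    have card: "\<forall>A\<in>F. odd (card A)" using npos_card[OF np] by simp
    have len: "P = arc (rim_fun cs) i d \<or> P = rev (arc (rim_fun cs) i d) \<Longrightarrow> length P = Suc d" for P i d
      by (auto simp: arc_simps)
    have n1: "even (length P) \<and> length P \<ge> 4" if A: "A \<in> F" and P: "path_between cs F A A P" for A P
    proof -
      obtain i d where d: "0 < d" "d < length cs" "length P = Suc d" "rim_fun cs i \<in> A" "rim_fun cs (i + d) \<in> A"
        "\<forall>t. 0 < t \<and> t < d \<longrightarrow> rim_fun cs (i + t) \<notin> \<Union>F"
        using P len unfolding path_between_iff[OF h(3)] by blast
      have g: "gap (rim_fun cs) F i d" using d A unfolding gap_def by auto
      have "odd d" using npos_odd[OF np, of A i d] g d A by simp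
      moreover have "d \<noteq> 1" using indep[of A i] d A by auto
      ultimately show ?thesis using d(3) by presburger
    qed
    have n5: "odd (length P)" if A: "A \<in> F" "B \<in> F" "A \<noteq> B" and P: "path_between cs F (A - B) (B - A) P" for A B P
    proof -
      obtain i d where d: "0 < d" "d < length cs" "length P = Suc d"
        "rim_fun cs i \<in> A - B \<and> rim_fun cs (i + d) \<in> B - A \<or> rim_fun cs i \<in> B - A \<and> rim_fun cs (i + d) \<in> A - B"
        "\<forall>t. 0 < t \<and> t < d \<longrightarrow> rim_fun cs (i + t) \<notin> \<Union>F"
        using P len unfolding path_between_iff[OF h(3)] by blast
      have g: "gap (rim_fun cs) F i d" using d A unfolding gap_def by auto
      \<comment> \<open>The path may be traversed in either direction, hence both orders of the two
        cliques.\<close>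
      have "even d" using npos_even[OF np, of A B i d] npos_even[OF np, of B A i d] g d A by auto
      then show ?thesis using d(3) by simp
    qed
    have n4: "even (length P)" if A: "A \<in> F" and P: "path_between cs F A {\<xi>} P" for A P
      using n1[OF A, of P] P xi(2)[OF A] unfolding path_between_def by blast
    have n3: "\<exists>\<xi>\<in>set cs. (\<forall>A\<in>F. \<xi> \<in> A) \<and> (\<forall>A\<in>F. \<forall>B\<in>F. A \<noteq> B \<longrightarrow> A \<inter> B = {\<xi>}) \<and>
        (\<forall>A\<in>F. \<forall>P. path_between cs F A {\<xi>} P \<longrightarrow> even (length P))"
      using xi n4 range_rim_fun[OF ne] by (intro bexI[of _ \<xi>] conjI ballI allI impI) auto
    show "N_conditions V E"
      unfolding N_conditions_def F_def[symmetric]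
      by (intro exI[of _ cs] conjI r card n3 ballI allI impI) (fact n1[THEN conjunct1] n1[THEN conjunct2] n5)+
  next
    assume "N_conditions V E"
    then obtain ds where ds: "is_rim V E ds"
      and n1: "\<forall>A\<in>F. \<forall>P. path_between ds F A A P \<longrightarrow> even (length P) \<and> length P \<ge> 4"
      and n2: "\<forall>A\<in>F. odd (card A)"
      and n3: "\<exists>\<xi>\<in>set ds. (\<forall>A\<in>F. \<xi> \<in> A) \<and> (\<forall>A\<in>F. \<forall>B\<in>F. A \<noteq> B \<longrightarrow> A \<inter> B = {\<xi>}) \<and>
        (\<forall>A\<in>F. \<forall>P. path_between ds F A {\<xi>} P \<longrightarrow> even (length P))"
      and n5: "\<forall>A\<in>F. \<forall>B\<in>F. A \<noteq> B \<longrightarrow> (\<forall>P. path_between ds F (A - B) (B - A) P \<longrightarrow> odd (length P))"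
      unfolding N_conditions_def F_def[symmetric] by (elim exE conjE) (rule that)
    have hd: "distinct ds" "set ds = V" "cycle_edges ds = rim_edges V E"
      using ds unfolding is_rim_def hamiltonian_list_def by auto
    have "length ds = length cs" using hd h by (metis distinct_card)
    then have tr: "path_between ds F X Y P" if "path_between cs F X Y P" for X Y P
      using that rim_path_cong[of cs ds P] h hd o unfolding path_between_def by auto
    have arcp: "path_between cs F X Y (arc (rim_fun cs) i d)"
      if "gap (rim_fun cs) F i d" "d < length cs" "rim_fun cs i \<in> X" "rim_fun cs (i + d) \<in> Y" for i d X Y
      unfolding path_between_iff[OF h(3)] using that unfolding gap_def by blast
    show "npos (length cs) (rim_fun cs) (inscribed V E)"
      unfolding npos_def F_def[symmetric]
    proof (intro conjI n2 ballI allI impI)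
      fix A i d assume A: "A \<in> F" "gap (rim_fun cs) F i d \<and> d < length cs \<and> rim_fun cs i \<in> A \<and> rim_fun cs (i + d) \<in> A"
      then have "even (length (arc (rim_fun cs) i d))" using n1 tr[OF arcp] by blast
      then show "odd d" by (simp add: arc_simps)
    next
      show "\<exists>\<xi>\<in>range (rim_fun cs). \<forall>A\<in>F. \<xi> \<in> A \<and> (\<forall>B\<in>F. A \<noteq> B \<longrightarrow> A \<inter> B = {\<xi>})"
      proof -
        from n3 obtain \<xi> where "\<xi> \<in> set ds" "\<forall>A\<in>F. \<xi> \<in> A" "\<forall>A\<in>F. \<forall>B\<in>F. A \<noteq> B \<longrightarrow> A \<inter> B = {\<xi>}" by blast
        then show ?thesis using hd(2) h(2) range_rim_fun[OF ne] by (intro bexI[of _ \<xi>]) simp_all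
      qed
    next
      fix A B i d assume A: "A \<in> F" "B \<in> F" "A \<noteq> B \<and> gap (rim_fun cs) F i d \<and> d < length cs \<and> rim_fun cs i \<in> A - B \<and> rim_fun cs (i + d) \<in> B - A"
      then have "path_between ds F (A - B) (B - A) (arc (rim_fun cs) i d)" using tr[OF arcp] by blast
      then have "odd (length (arc (rim_fun cs) i d))" using n5[rule_format, of A B] A by simp
      then show "even d" by (simp add: arc_simps)
    qed
  qed
qed

section \<open>Odd holes and sub-multisuns in terms of adjacency\<close>

lemma has_odd_hole_iff:
  assumes adj: "\<And>u v. {u, v} \<in> E \<longleftrightarrow> R u v" and irr: "\<And>u. \<not> R u u" and inV: "\<And>u v. R u v \<Longrightarrow> u \<in> V"
  shows "has_odd_hole V E \<longleftrightarrow> (\<exists>vs. ohole R vs)"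
proof -
  have mod_iff: "j = Suc i mod m \<longleftrightarrow> (if Suc i = m then j = 0 else j = Suc i)" if "i < m" for i j m :: nat
    using that by auto
  have "odd_hole V E vs \<longleftrightarrow> ohole R vs" for vs
  proof
    assume o: "odd_hole V E vs"
    have "R (vs ! i) (vs ! j) \<longleftrightarrow> j = Suc i \<or> i = 0 \<and> Suc j = length vs" if "i < j" "j < length vs" for i j
      using o that mod_iff[of i "length vs" j] mod_iff[of j "length vs" i] unfolding odd_hole_def adj by auto
    then show "ohole R vs" using o unfolding odd_hole_def ohole_def by blast
  next
    assume o: "ohole R vs"
    have sym: "R u v \<longleftrightarrow> R v u" for u v unfolding adj[symmetric] by (simp add: insert_commute)
    have lt: "R (vs ! i) (vs ! j) \<longleftrightarrow> j = Suc i mod length vs \<or> i = Suc j mod length vs"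
      if "i < j" "j < length vs" for i j
    proof -
      have "R (vs ! i) (vs ! j) \<longleftrightarrow> j = Suc i \<or> i = 0 \<and> Suc j = length vs" using o that unfolding ohole_def by blast
      then show ?thesis using that o mod_iff[of i "length vs" j] mod_iff[of j "length vs" i] unfolding ohole_def by auto
    qed
    have all: "R (vs ! i) (vs ! j) \<longleftrightarrow> j = Suc i mod length vs \<or> i = Suc j mod length vs"
      if "i < length vs" "j < length vs" for i j
    proof (cases i j rule: linorder_cases)
      case less then show ?thesis using lt that by blast
    next
      case equal
      moreover have "Suc i mod length vs \<noteq> i" using that o unfolding ohole_def by (auto simp: mod_Suc)
      ultimately show ?thesis using irr by auto
    next
      case greater then show ?thesis using lt[of j i] that sym by blast
    qed
    moreover have "set vs \<subseteq> V"
    proof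
      fix v assume "v \<in> set vs"
      then obtain i where i: "i < length vs" "v = vs ! i" by (metis in_set_conv_nth)
      then have "Suc i mod length vs < length vs" by (intro mod_less_divisor) auto
      then show "v \<in> V" using all[OF i(1), of "Suc i mod length vs"] i inV by blast
    qed
    ultimately show "odd_hole V E vs" using o unfolding odd_hole_def ohole_def adj by blast
  qed
  then show ?thesis unfolding has_odd_hole_def by blast
qed

lemma maximal_clique_ex:
  assumes "finite V" "clique V E C"
  obtains K where "maximal_clique V E K" "C \<subseteq> K"
proof -
  have "finite {K. clique V E K \<and> C \<subseteq> K}"
    by (rule finite_subset[of _ "Pow V"]) (use assms in \<open>auto simp: clique_def\<close>)
  then obtain K where "K \<in> {K. clique V E K \<and> C \<subseteq> K}" "\<forall>K'\<in>{K. clique V E K \<and> C \<subseteq> K}. K \<subseteq> K' \<longrightarrow> K = K'"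
    using finite_has_maximal[of "{K. clique V E K \<and> C \<subseteq> K}"] assms(2) by blast
  then show ?thesis using that[of K] unfolding maximal_clique_def by auto
qed

text \<open>Sub-multisuns are indexed by the surviving cliques instead of the deleted ones. The
  graph itself is then the case where all survive, and a property of the graph and all its
  sub-multisuns is one over all nonempty subfamilies.\<close>

definition keep :: "'a set \<Rightarrow> 'a set set \<Rightarrow> 'a set set \<Rightarrow> 'a set set" where
  "keep V E F = E - {e. \<exists>K\<in>inscribed V E - F. e \<subseteq> K}"

lemma keep_all: "keep V E (inscribed V E) = E"
  unfolding keep_def by auto

lemma sub_multisun_iff:
  "sub_multisun V E E' \<longleftrightarrow> (\<exists>F. F \<subset> inscribed V E \<and> F \<noteq> {} \<and> E' = keep V E F)"
proof
  assume "sub_multisun V E E'"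
  then obtain S where S: "S \<subseteq> inscribed V E" "S \<noteq> {}" "S \<noteq> inscribed V E" "E' = E - {e. \<exists>K\<in>S. e \<subseteq> K}"
    unfolding sub_multisun_def by blast
  then show "\<exists>F. F \<subset> inscribed V E \<and> F \<noteq> {} \<and> E' = keep V E F"
    unfolding keep_def by (intro exI[of _ "inscribed V E - S"]) (auto simp: double_diff)
next
  assume "\<exists>F. F \<subset> inscribed V E \<and> F \<noteq> {} \<and> E' = keep V E F"
  then obtain F where "F \<subset> inscribed V E" "F \<noteq> {}" "E' = keep V E F" by blast
  then show "sub_multisun V E E'"
    unfolding keep_def sub_multisun_def by (intro exI[of _ "inscribed V E - F"]) auto
qed

lemma sub_multisun_all:
  assumes "inscribed V E \<noteq> {}"
  shows "P E \<and> (\<forall>E'. sub_multisun V E E' \<longrightarrow> P E') \<longleftrightarrow> (\<forall>F. F \<subseteq> inscribed V E \<and> F \<noteq> {} \<longrightarrow> P (keep V E F))"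
  unfolding sub_multisun_iff using keep_all[of V E] assms by (metis psubset_eq subset_refl)

section \<open>Maximal cliques of a multisun\<close>

locale multisun_graph =
  fixes V :: "'a set" and E :: "'a set set" and cs :: "'a list"
  assumes ms: "multisun V E" and r: "is_rim V E cs"
begin

abbreviation "I \<equiv> inscribed V E"
abbreviation "c \<equiv> rim_fun cs"
abbreviation "n \<equiv> length cs"

lemma cs: "distinct cs" "set cs = V" "3 \<le> n" "cycle_edges cs = rim_edges V E" "odd n" "cs \<noteq> []"
  using r ms distinct_card[of cs] unfolding is_rim_def hamiltonian_list_def multisun_def by auto

lemma finite_V: "finite V"
  using cs(2) by auto

lemma inscribed_ne: "I \<noteq> {}"
  using ms unfolding multisun_def by blast

lemma rim_edge: "{u, v} \<in> rim_edges V E \<longleftrightarrow> rim_adj c u v"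
  using cycle_edges_rim_adj[OF cs(6)] cs(4) by simp

text \<open>Every vertex is on the rim, so a clique with at most one vertex extends to a rim edge
  and is not maximal. Thus a maximal clique whose size is not two has at least three
  vertices.\<close>

lemma small_clique:
  assumes "C \<subseteq> V" "card C \<le> 1"
  obtains R where "R \<in> rim_edges V E" "C \<subseteq> R"
proof -
  interpret rim n c by (rule rim_rim_fun) (use cs in auto)
  have "\<exists>v. C \<subseteq> {v} \<and> v \<in> V"
  proof (cases "C = {}")
    case True then show ?thesis using cs by (metis empty_subsetI list.set_sel(1))
  next
    case False
    moreover have "finite C" by (rule finite_subset[OF assms(1) finite_V])
    ultimately have "card C = 1" using assms(2) card_0_eq[of C] by linarith
    then show ?thesis using assms(1) by (metis card_1_singletonE insert_subset subset_refl)
  qed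
  then obtain v where v: "C \<subseteq> {v}" "v \<in> V" by blast
  then obtain i where "v = c i" using range_rim_fun[OF cs(6)] cs(2) by blast
  then have "rim_adj c v (c (Suc i))" unfolding rim_adj_def by blast
  then show ?thesis using that[of "{v, c (Suc i)}"] rim_edge v by blast
qed

lemma rim_edgeD: "R \<in> rim_edges V E \<Longrightarrow> maximal_clique V E R \<and> card R = 2"
  unfolding rim_edges_def by simp

lemma inscribedD:
  assumes "A \<in> I"
  shows "maximal_clique V E A" "clique V E A" "A \<subseteq> V" "3 \<le> card A"
proof -
  show m: "maximal_clique V E A" "clique V E A" "A \<subseteq> V"
    using assms unfolding inscribed_def maximal_clique_def clique_def by auto
  have "card A \<noteq> 2" using assms unfolding inscribed_def by auto
  moreover have "\<not> card A \<le> 1"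
  proof
    assume "card A \<le> 1"
    then obtain R where R: "R \<in> rim_edges V E" "A \<subseteq> R" using small_clique m(3) by blast
    then have "R = A" using m(1) rim_edgeD[OF R(1)] unfolding maximal_clique_def by blast
    then show False using rim_edgeD[OF R(1)] \<open>card A \<le> 1\<close> by simp
  qed
  ultimately show "3 \<le> card A" by linarith
qed

lemma edge_ne: "{u, v} \<in> E \<Longrightarrow> u \<noteq> v \<and> u \<in> V \<and> v \<in> V"
proof -
  assume "{u, v} \<in> E"
  moreover have "simple_graph V E" using ms unfolding multisun_def by simp
  ultimately obtain x y where "{u, v} = {x, y}" "x \<noteq> y" "x \<in> V" "y \<in> V"
    unfolding simple_graph_def by meson
  then show ?thesis by (auto simp: doubleton_eq_iff)
qed

lemma cliqueD: "clique V E K \<Longrightarrow> x \<in> K \<Longrightarrow> y \<in> K \<Longrightarrow> x \<noteq> y \<Longrightarrow> {x, y} \<in> E"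
  and clique_sub: "clique V E K \<Longrightarrow> K \<subseteq> V"
  unfolding clique_def by simp_all

text \<open>Nonadjacent vertices \<open>x\<close> of \<open>A\<close> and \<open>y\<close> of
  \<open>B\<close> would form a diamond with \<open>u\<close> and \<open>v\<close>. So the union is
  a clique, and maximality makes it equal to both.\<close>

lemma meet:
  assumes A: "maximal_clique V E A" and B: "maximal_clique V E B"
    and uv: "u \<in> A" "u \<in> B" "v \<in> A" "v \<in> B" "u \<noteq> v"
  shows "A = B"
proof -
  have cl: "clique V E A" "clique V E B" using A B unfolding maximal_clique_def by auto
  have cross: "{x, y} \<in> E" if "x \<in> A" "y \<in> B" "x \<noteq> y" for x y
  proof (rule ccontr)
    assume no: "{x, y} \<notin> E"
    have "x \<notin> B" "y \<notin> A" using cliqueD[OF cl(2), of x y] cliqueD[OF cl(1), of x y] that no by blast+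
    then have ne: "x \<noteq> u" "x \<noteq> v" "y \<noteq> u" "y \<noteq> v" using uv by auto
    have "{u, v} \<in> E" "{u, x} \<in> E" "{u, y} \<in> E" "{v, x} \<in> E" "{v, y} \<in> E"
      using cliqueD[OF cl(1)] cliqueD[OF cl(2)] uv ne that by simp_all
    moreover have "u \<in> V" "v \<in> V" "x \<in> V" "y \<in> V" using clique_sub[OF cl(1)] clique_sub[OF cl(2)] uv that by auto
    moreover have "distinct [u, v, x, y]" using ne uv that by auto
    ultimately have "\<not> diamond_free V E" using no unfolding diamond_free_def by blast
    then show False using ms unfolding multisun_def by blast
  qed
  have "{x, y} \<in> E" if "x \<in> A \<union> B" "y \<in> A \<union> B" "x \<noteq> y" for x y
  proof -
    have "{y, x} = {x, y}" by auto
    then show ?thesis using that cliqueD[OF cl(1), of x y] cliqueD[OF cl(2), of x y] cross[of x y] cross[of y x] by auto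
  qed
  then have "clique V E (A \<union> B)" using clique_sub[OF cl(1)] clique_sub[OF cl(2)] unfolding clique_def by simp
  then show ?thesis using A B unfolding maximal_clique_def by (metis Un_upper1 Un_upper2)
qed

text \<open>The rim list in the definition of a multisun may differ from \<open>cs\<close>, but the
  maximal cliques of size two are the edges of either.\<close>

lemma indep:
  assumes "A \<in> I" "u \<in> A" "v \<in> A"
  shows "\<not> rim_adj c u v"
proof -
  obtain ds where "is_rim V E ds" "\<forall>K\<in>I. \<forall>u\<in>K. \<forall>v\<in>K. {u, v} \<notin> cycle_edges ds"
    using ms unfolding multisun_def by blast
  then have "{u, v} \<notin> rim_edges V E" using assms unfolding is_rim_def by blast
  then show ?thesis using rim_edge by blast
qed

lemma edge_iff: "{u, v} \<in> E \<longleftrightarrow> adj c I u v"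
proof
  assume e: "{u, v} \<in> E"
  have uv: "u \<noteq> v" "u \<in> V" "v \<in> V" using edge_ne[OF e] by auto
  have "{v, u} = {u, v}" by auto
  then have "clique V E {u, v}" using e uv unfolding clique_def by simp
  then obtain K where K: "maximal_clique V E K" "{u, v} \<subseteq> K" using maximal_clique_ex[OF finite_V] by blast
  show "adj c I u v"
  proof (cases "card K = 2")
    case True
    then have "K = {u, v}" using K(2) uv card_subset_eq[of K "{u, v}"] card_ge_0_finite[of K] by auto
    then have "{u, v} \<in> rim_edges V E" using K True unfolding rim_edges_def by blast
    then show ?thesis using rim_edge unfolding adj_def by blast
  next
    case False
    then have "K \<in> I" using K unfolding inscribed_def by blast
    then show ?thesis using K uv unfolding adj_def by blast
  qed
next
  assume "adj c I u v"
  then consider "rim_adj c u v" | A where "A \<in> I" "u \<in> A" "v \<in> A" "u \<noteq> v" unfolding adj_def by blast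
  then show "{u, v} \<in> E"
  proof cases
    case 1
    then have "{u, v} \<in> rim_edges V E" using rim_edge by blast
    then have "clique V E {u, v}" "card {u, v} = 2" using rim_edgeD unfolding maximal_clique_def by blast+
    then show ?thesis unfolding clique_def by (cases "u = v") auto
  next
    case 2
    then show ?thesis using inscribedD(2) unfolding clique_def by blast
  qed
qed

lemma sun: "sun n c I"
proof -
  interpret rim n c by (rule rim_rim_fun) (use cs in auto)
  show ?thesis
  proof
    show "A \<subseteq> range c" "3 \<le> card A" if "A \<in> I" for A
      using inscribedD[OF that] range_rim_fun[OF cs(6)] cs(2) by auto
    show "A = B" if "A \<in> I" "B \<in> I" "u \<in> A" "u \<in> B" "v \<in> A" "v \<in> B" "u \<noteq> v" for A B u v
      using meet[OF inscribedD(1) inscribedD(1)] that by blast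
    show "c (Suc i) \<notin> A" if "A \<in> I" "c i \<in> A" for A i
      using indep[OF that, of "c (Suc i)"] unfolding rim_adj_def by blast
    fix u v w
    assume *: "adj c I u v" "adj c I v w" "adj c I u w" "u \<noteq> v" "v \<noteq> w" "u \<noteq> w"
    then have e: "{u, v} \<in> E" "{v, w} \<in> E" "{u, w} \<in> E" unfolding edge_iff by simp_all
    moreover have "{v, u} = {u, v}" "{w, v} = {v, w}" "{w, u} = {u, w}" by auto
    moreover have "u \<in> V" "v \<in> V" "w \<in> V" using edge_ne[OF e(1)] edge_ne[OF e(2)] by simp_all
    ultimately have "clique V E {u, v, w}" unfolding clique_def by simp
    then obtain K where K: "maximal_clique V E K" "{u, v, w} \<subseteq> K" using maximal_clique_ex[OF finite_V] by blast
    then have "K \<subseteq> V" unfolding maximal_clique_def clique_def by simp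
    then have "finite K" by (rule finite_subset[OF _ finite_V])
    then have "3 \<le> card K" using card_mono[OF _ K(2)] * by auto
    then have "K \<in> I" using K(1) unfolding inscribed_def by auto
    then show "\<exists>A\<in>I. u \<in> A \<and> v \<in> A \<and> w \<in> A" using K(2) by auto
  qed
qed

section \<open>Deleting the edges of inscribed cliques\<close>

context
  fixes F assumes F: "F \<subseteq> I"
begin

lemma keep_edge: "{u, v} \<in> keep V E F \<longleftrightarrow> adj c F u v"
proof
  assume k: "{u, v} \<in> keep V E F"
  then have "adj c I u v" using edge_iff unfolding keep_def by blast
  then show "adj c F u v" using k unfolding adj_def keep_def by blast
next
  assume a: "adj c F u v"
  then have e: "{u, v} \<in> E" using F unfolding edge_iff adj_def by blast
  have "\<not> {u, v} \<subseteq> K" if "K \<in> I - F" for K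
  proof
    assume "{u, v} \<subseteq> K"
    then have "\<not> rim_adj c u v" using indep[of K u v] that by blast
    then obtain A where "A \<in> F" "u \<in> A" "v \<in> A" "u \<noteq> v" using a unfolding adj_def by blast
    then show False using meet[OF inscribedD(1) inscribedD(1), of A K u v] that F \<open>{u, v} \<subseteq> K\<close> by blast
  qed
  then show "{u, v} \<in> keep V E F" using e unfolding keep_def by blast
qed

lemma keep_clique: "clique V (keep V E F) K \<Longrightarrow> clique V E K"
  unfolding clique_def keep_def by blast

lemma keep_cliqueI: "K \<in> rim_edges V E \<union> F \<Longrightarrow> clique V (keep V E F) K"
proof -
  assume K: "K \<in> rim_edges V E \<union> F"
  then have sub: "K \<subseteq> V" using rim_edgeD inscribedD(3) F unfolding maximal_clique_def clique_def by blast
  have "{u, v} \<in> keep V E F" if "u \<in> K" "v \<in> K" "u \<noteq> v" for u v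
  proof (cases "K \<in> F")
    case True
    then show ?thesis using that unfolding keep_edge adj_def by blast
  next
    case False
    then have "K \<in> rim_edges V E" using K by blast
    moreover have "K = {u, v}"
      using rim_edgeD[OF calculation] that by (metis card_2_iff doubleton_eq_iff insertE singletonD)
    ultimately show ?thesis using rim_edge unfolding keep_edge adj_def by blast
  qed
  then show ?thesis using sub unfolding clique_def by blast
qed

text \<open>No new maximal clique arises. One that is maximal after the deletion has two vertices,
  as smaller ones extend to rim edges. The edge between them survives, so no maximal clique of the
  original graph around it is a deleted one.\<close>

lemma keep_maximal_clique: "maximal_clique V (keep V E F) K \<longleftrightarrow> K \<in> rim_edges V E \<union> F"
proof
  assume K: "K \<in> rim_edges V E \<union> F"
  then have "maximal_clique V E K" using rim_edgeD inscribedD(1) F by blast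
  then show "maximal_clique V (keep V E F) K"
    using keep_cliqueI[OF K] keep_clique unfolding maximal_clique_def by blast
next
  assume m: "maximal_clique V (keep V E F) K"
  then have cl: "clique V (keep V E F) K" unfolding maximal_clique_def by blast
  then obtain K1 where K1: "maximal_clique V E K1" "K \<subseteq> K1"
    using maximal_clique_ex[OF finite_V keep_clique] by blast
  have small: "\<not> card K \<le> 1"
  proof
    assume "card K \<le> 1"
    moreover have "K \<subseteq> V" using cl unfolding clique_def by blast
    ultimately obtain R where R: "R \<in> rim_edges V E" "K \<subseteq> R" using small_clique by blast
    then have "R = K" using m keep_cliqueI[of R] unfolding maximal_clique_def by blast
    then show False using rim_edgeD[OF R(1)] \<open>card K \<le> 1\<close> by simp
  qed
  then obtain u v where uv: "u \<in> K" "v \<in> K" "u \<noteq> v"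
    by (metis card_le_Suc0_iff_eq One_nat_def card.infinite le0)
  have "K1 \<in> rim_edges V E \<union> F"
  proof (rule ccontr)
    assume "K1 \<notin> rim_edges V E \<union> F"
    then have "K1 \<in> I - F" using K1(1) unfolding rim_edges_def inscribed_def by blast
    moreover have "{u, v} \<in> keep V E F" using cl uv unfolding clique_def by blast
    ultimately show False using uv K1(2) unfolding keep_def by blast
  qed
  moreover have "K1 = K" using m keep_cliqueI[OF calculation] K1(2) unfolding maximal_clique_def by blast
  ultimately show "K \<in> rim_edges V E \<union> F" by simp
qed

lemma inscribed_keep: "inscribed V (keep V E F) = F"
proof -
  have "card K \<noteq> 2" if "K \<in> F" for K using inscribedD(4)[of K] that F by auto
  then show ?thesis using rim_edgeD unfolding inscribed_def keep_maximal_clique by auto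
qed

lemma rim_edges_keep: "rim_edges V (keep V E F) = rim_edges V E"
proof -
  have "card K \<noteq> 2" if "K \<in> F" for K using inscribedD(4)[of K] that F by auto
  then show ?thesis using rim_edgeD unfolding rim_edges_def[of V "keep V E F"] keep_maximal_clique by auto
qed

lemma is_rim_keep: "is_rim V (keep V E F) cs"
  using r unfolding is_rim_def rim_edges_keep .

lemma N_conditions_keep: "N_conditions V (keep V E F) \<longleftrightarrow> npos n c F"
  using N_conditions_iff_npos[OF is_rim_keep cs(5)] sun.subset_sun[OF sun F] unfolding inscribed_keep by blast

lemma has_odd_hole_keep: "has_odd_hole V (keep V E F) \<longleftrightarrow> (\<exists>vs. ohole (adj c F) vs)"
proof (rule has_odd_hole_iff[OF keep_edge])
  have I: "adj c I u v" if "adj c F u v" for u v using that F unfolding adj_def by blast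
  show "\<not> adj c F u u" for u using I[of u u] edge_ne[of u u] unfolding edge_iff by blast
  show "u \<in> V" if "adj c F u v" for u v using I[OF that] edge_ne[of u v] unfolding edge_iff by blast
qed

end

lemma sunoid_iff: "sunoid V E \<longleftrightarrow> (\<forall>F. F \<subseteq> I \<and> F \<noteq> {} \<longrightarrow> npos n c F)"
  unfolding sunoid_def sub_multisun_all[OF inscribed_ne, of "N_conditions V"] using ms N_conditions_keep by auto

lemma HOH_free_iff: "HOH_free V E \<longleftrightarrow> (\<forall>F. F \<subseteq> I \<and> F \<noteq> {} \<longrightarrow> (\<forall>vs. \<not> ohole (adj c F) vs))"
  unfolding HOH_free_def sub_multisun_all[OF inscribed_ne, of "\<lambda>E. \<not> has_odd_hole V E"]
  using has_odd_hole_keep by auto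

theorem sunoid_iff_HOH_free: "sunoid V E \<longleftrightarrow> HOH_free V E"
proof
  assume s: "sunoid V E"
  show "HOH_free V E" unfolding HOH_free_iff
  proof (intro allI impI, elim conjE)
    fix F vs assume F: "F \<subseteq> I" "F \<noteq> {}"
    interpret sun n c F by (rule sun.subset_sun[OF sun F(1)])
    show "\<not> ohole (adj c F) vs"
      by (rule hole_free_if_npos) (use s F in \<open>auto simp: sunoid_iff\<close>)
  qed
next
  assume h: "HOH_free V E"
  show "sunoid V E" unfolding sunoid_iff
  proof (intro allI impI, elim conjE)
    fix F assume F: "F \<subseteq> I" "F \<noteq> {}"
    interpret sun n c F by (rule sun.subset_sun[OF sun F(1)])
    show "npos n c F"
      by (rule npos_if_hole_free) (use h F in \<open>auto simp: HOH_free_iff\<close>)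
  qed
qed

end

section \<open>Words\<close>

text \<open>A normal form computed from the right. It is reachable by deletions and unchanged by
  each of them, which yields existence and uniqueness for the description in
  \<open>pattern\<close>.\<close>

fun reduce :: "letter list \<Rightarrow> letter list" where
  "reduce [] = []"
| "reduce (x # xs) = (case reduce xs of [] \<Rightarrow> [x]
    | y # ys \<Rightarrow> if x = Eps \<and> y = Eps then ys else x # y # ys)"

definition irreducible :: "letter list \<Rightarrow> bool" where
  "irreducible p \<longleftrightarrow> \<not> (\<exists>x y. p = x @ [Eps, Eps] @ y)"

lemma irreducible_Cons:
  "irreducible (x # xs) \<longleftrightarrow> irreducible xs \<and> \<not> (x = Eps \<and> xs \<noteq> [] \<and> hd xs = Eps)"
proof -
  have "(\<exists>a b. x # xs = a @ [Eps, Eps] @ b) \<longleftrightarrow>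
    (\<exists>b. x # xs = [Eps, Eps] @ b) \<or> (\<exists>a b. xs = a @ [Eps, Eps] @ b)"
    by (auto simp: Cons_eq_append_conv)
  moreover have "(\<exists>b. x # xs = [Eps, Eps] @ b) \<longleftrightarrow> x = Eps \<and> xs \<noteq> [] \<and> hd xs = Eps"
    by (cases xs) auto
  ultimately show ?thesis unfolding irreducible_def by blast
qed

lemma irreducible_reduce: "irreducible (reduce xs)"
proof (induction xs)
  case Nil then show ?case by (simp add: irreducible_def)
next
  case (Cons x xs)
  moreover have "irreducible []" by (simp add: irreducible_def)
  ultimately show ?case by (cases "reduce xs") (simp_all add: irreducible_Cons)
qed

lemma reduce_irreducible: "irreducible xs \<Longrightarrow> reduce xs = xs"
  by (induction xs) (auto simp: irreducible_Cons split: list.split)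

lemma reduce_eps_step: "eps_step u v \<Longrightarrow> reduce u = reduce v"
proof -
  have "reduce (x @ Eps # Eps # y) = reduce (x @ y)" for x y
  proof (induction x)
    case Nil
    show ?case using irreducible_reduce[of y]
      by (cases "reduce y") (auto simp: irreducible_Cons split: list.split)
  qed auto
  then show "eps_step u v \<Longrightarrow> reduce u = reduce v" unfolding eps_step_def by auto
qed

lemma eps_step_Cons: "eps_step\<^sup>*\<^sup>* u v \<Longrightarrow> eps_step\<^sup>*\<^sup>* (x # u) (x # v)"
proof (induction rule: rtranclp_induct)
  case (step y z)
  then have "eps_step (x # y) (x # z)" unfolding eps_step_def by (metis append_Cons)
  then show ?case using step by (meson rtranclp.rtrancl_into_rtrancl)
qed simp

lemma eps_steps_reduce: "eps_step\<^sup>*\<^sup>* xs (reduce xs)"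
proof (induction xs)
  case (Cons x xs)
  have "eps_step\<^sup>*\<^sup>* (x # reduce xs) (reduce (x # xs))"
  proof (cases "reduce xs")
    case (Cons y ys)
    have "eps_step (Eps # Eps # ys) ys" unfolding eps_step_def by (metis append_Cons append_Nil)
    then show ?thesis using Cons by auto
  qed simp
  then show ?case using eps_step_Cons[OF Cons.IH, of x] by (meson rtranclp_trans)
qed simp

lemma pattern_reduce: "pattern w = reduce w"
  unfolding pattern_def irreducible_def[symmetric]
proof (rule the_equality)
  fix p assume p: "eps_step\<^sup>*\<^sup>* w p \<and> irreducible p"
  have "reduce w = reduce p" using p[THEN conjunct1]
    by (induction rule: rtranclp_induct) (auto dest: reduce_eps_step)
  then show "p = reduce w" using reduce_irreducible p by simp
qed (use eps_steps_reduce irreducible_reduce in blast)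

lemma eps_steps_pattern: "eps_step\<^sup>*\<^sup>* w (pattern w)"
  unfolding pattern_reduce by (rule eps_steps_reduce)

lemma eps_step_rev: "eps_step u v \<Longrightarrow> eps_step (rev u) (rev v)"
  unfolding eps_step_def
proof (elim exE conjE)
  fix x y assume "u = x @ [Eps, Eps] @ y" "v = x @ y"
  then show "\<exists>x y. rev u = x @ [Eps, Eps] @ y \<and> rev v = x @ y"
    by (intro exI[of _ "rev y"] exI[of _ "rev x"]) simp
qed

lemma eps_steps_rev: "eps_step\<^sup>*\<^sup>* u v \<Longrightarrow> eps_step\<^sup>*\<^sup>* (rev u) (rev v)"
  by (induction rule: rtranclp_induct) (auto dest: eps_step_rev intro: rtranclp.rtrancl_into_rtrancl)

text \<open>Letters outside \<open>L\<close> are skipped; \<open>x\<close> is the last letter from \<open>L\<close> and \<open>p\<close> tells whether an odd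
  number of letters has been skipped since. Skipping \<open>\<epsilon>\<epsilon>\<close> therefore changes nothing.\<close>
primrec ok :: "letter set \<Rightarrow> letter \<Rightarrow> bool \<Rightarrow> letter list \<Rightarrow> bool" where
  "ok L x p [] = True"
| "ok L x p (y # ys) = (if y \<in> L then p = (x \<noteq> y \<and> x \<noteq> Sig \<and> y \<noteq> Sig) \<and> ok L y False ys
     else ok L x (\<not> p) ys)"

section \<open>Invariance of the word test\<close>

lemma ok_eps: "Eps \<notin> L \<Longrightarrow> ok L x p (a @ Eps # Eps # b) = ok L x p (a @ b)"
  by (induction a arbitrary: x p) auto

text \<open>The reading starts after \<open>Sig\<close> and the part before it moves to the end.
  With \<open>Sig\<close> supplied again at both ends by \<open>word_ok\<close>, this is the rim cut
  open at the common vertex, as in \<open>lin\<close>.\<close>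

definition cut_at_sig :: "letter list \<Rightarrow> letter list" where
  "cut_at_sig w = tl (dropWhile (\<lambda>x. x \<noteq> Sig) w) @ takeWhile (\<lambda>x. x \<noteq> Sig) w"

definition word_ok :: "letter set \<Rightarrow> letter list \<Rightarrow> bool" where
  "word_ok L w = ok L Sig False (cut_at_sig w @ [Sig])"

lemma cut_at_sig_split: "Sig \<notin> set a \<Longrightarrow> cut_at_sig (a @ Sig # b) = b @ a"
  unfolding cut_at_sig_def by (simp add: dropWhile_append takeWhile_append)

lemma count_list_1_split:
  assumes "count_list w x = 1"
  obtains a b where "w = a @ x # b" "x \<notin> set a" "x \<notin> set b"
proof -
  have "x \<in> set w" using assms by (metis count_list_0_iff zero_neq_one)
  then obtain a b where ab: "w = a @ x # b" "x \<notin> set a" by (metis split_list_first)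
  then have "count_list b x = 0" using assms by (simp add: count_list_0_iff)
  then show ?thesis using that ab by (simp add: count_list_0_iff)
qed

text \<open>The count of \<open>Sig\<close> and the set of letters are carried along because they
  later match the cliques of two graphs whose words have equivalent patterns.\<close>

lemma word_ok_eps:
  assumes "eps_step u v" "Eps \<notin> L" "count_list u Sig = 1"
  shows "word_ok L u = word_ok L v \<and> count_list v Sig = 1 \<and> set u - {Eps} = set v - {Eps}"
proof -
  obtain x y where xy: "u = x @ [Eps, Eps] @ y" "v = x @ y" using assms(1) unfolding eps_step_def by blast
  have "word_ok L u = word_ok L v"
  proof (cases "Sig \<in> set x")
    case True
    then obtain a b where x: "x = a @ Sig # b" "Sig \<notin> set a" by (metis split_list_first)
    then have "cut_at_sig u = (b @ Eps # Eps # y @ a)" "cut_at_sig v = b @ y @ a"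
      using cut_at_sig_split[of a] xy by simp_all
    then show ?thesis unfolding word_ok_def using ok_eps[OF assms(2), of Sig False b "y @ a @ [Sig]"] by simp
  next
    case False
    have "Sig \<in> set u" using assms(3) by (metis count_list_0_iff zero_neq_one)
    then have "Sig \<in> set y" using xy False by simp
    then obtain a b where y: "y = a @ Sig # b" "Sig \<notin> set a" by (metis split_list_first)
    then have "cut_at_sig u = (b @ x) @ Eps # Eps # a" "cut_at_sig v = b @ x @ a"
      using cut_at_sig_split[of "x @ [Eps, Eps] @ a" b] cut_at_sig_split[of "x @ a" b] xy False by simp_all
    then show ?thesis unfolding word_ok_def using ok_eps[OF assms(2), of Sig False "b @ x" "a @ [Sig]"] by simp
  qed
  moreover have "count_list v Sig = 1" using assms(3) xy by simp
  moreover have "set u - {Eps} = set v - {Eps}" using xy by auto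
  ultimately show ?thesis by blast
qed

lemma word_ok_eps_steps:
  assumes "eps_step\<^sup>*\<^sup>* u v" "Eps \<notin> L" "count_list u Sig = 1"
  shows "word_ok L u = word_ok L v \<and> count_list v Sig = 1 \<and> set u - {Eps} = set v - {Eps}"
  using assms(1)
proof (induction rule: rtranclp_induct)
  case (step y z)
  then show ?case using word_ok_eps[OF step(2) assms(2)] by simp
qed (use assms in simp)

text \<open>With a single \<open>Sig\<close>, cutting there forgets where the cyclic reading
  began.\<close>

lemma word_ok_rotate1:
  assumes "count_list w Sig = 1"
  shows "word_ok L (rotate1 w) = word_ok L w \<and> count_list (rotate1 w) Sig = 1"
proof -
  obtain a b where w: "w = a @ Sig # b" "Sig \<notin> set a" "Sig \<notin> set b" by (rule count_list_1_split[OF assms])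
  have "cut_at_sig (rotate1 w) = cut_at_sig w"
  proof (cases a)
    case Nil
    then show ?thesis using w cut_at_sig_split[of b "[]"] cut_at_sig_split[of "[]" b] by simp
  next
    case (Cons x a')
    then show ?thesis using w cut_at_sig_split[of a' "b @ [x]"] cut_at_sig_split[of a b] by simp
  qed
  moreover have "count_list (rotate1 w) Sig = count_list w Sig" by (cases w) auto
  ultimately show ?thesis using assms unfolding word_ok_def by simp
qed

lemma word_ok_rotate:
  assumes "count_list w Sig = 1"
  shows "word_ok L (rotate k w) = word_ok L w \<and> count_list (rotate k w) Sig = 1"
proof (induction k)
  case (Suc k)
  then show ?case using word_ok_rotate1[of "rotate k w"] by (simp add: rotate_def)
qed (use assms in simp)

lemma count_list_rotate: "count_list (rotate k w) x = count_list w x"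
proof (induction k)
  case (Suc k)
  have "count_list (rotate1 u) x = count_list u x" for u by (cases u) auto
  then show ?case using Suc by (simp add: rotate_def)
qed simp

text \<open>Unrolls the recursion of \<open>ok\<close> into positions, for comparison with
  \<open>lin\<close>: this part concerns the pending letter \<open>x\<close>, while
  \<open>pos_ok\<close> takes care of the pairs inside the remaining word.\<close>

definition first_ok :: "letter set \<Rightarrow> letter \<Rightarrow> bool \<Rightarrow> letter list \<Rightarrow> bool" where
  "first_ok L x p ys \<longleftrightarrow> (\<forall>j<length ys. ys ! j \<in> L \<and> (\<forall>t<j. ys ! t \<notin> L) \<longrightarrow>
     (p \<noteq> odd j) = (x \<noteq> ys ! j \<and> x \<noteq> Sig \<and> ys ! j \<noteq> Sig))"

definition pos_ok :: "letter set \<Rightarrow> letter list \<Rightarrow> bool" where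
  "pos_ok L zs \<longleftrightarrow> (\<forall>j<length zs. \<forall>i<j. zs ! i \<in> L \<and> zs ! j \<in> L \<and> (\<forall>t. i < t \<and> t < j \<longrightarrow> zs ! t \<notin> L) \<longrightarrow>
     even (j - i) = (zs ! i \<noteq> zs ! j \<and> zs ! i \<noteq> Sig \<and> zs ! j \<noteq> Sig))"

lemma pos_ok_Cons: "pos_ok L (y # ys) \<longleftrightarrow> (y \<in> L \<longrightarrow> first_ok L y False ys) \<and> pos_ok L ys"
proof -
  have shift: "(\<forall>t. Suc i < t \<and> t < Suc j \<longrightarrow> P t) \<longleftrightarrow> (\<forall>t. i < t \<and> t < j \<longrightarrow> P (Suc t))" for i j and P :: "nat \<Rightarrow> bool"
    by (auto simp: Suc_less_eq2)
  have shift0: "(\<forall>t. 0 < t \<and> t < Suc j \<longrightarrow> P t) \<longleftrightarrow> (\<forall>t<j. P (Suc t))" for j and P :: "nat \<Rightarrow> bool"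
    by (auto simp: gr0_conv_Suc)
  show ?thesis
    unfolding pos_ok_def first_ok_def by (simp add: All_less_Suc2 shift shift0) blast
qed

lemma first_ok_Cons:
  "first_ok L x p (y # ys) \<longleftrightarrow>
    (if y \<in> L then p = (x \<noteq> y \<and> x \<noteq> Sig \<and> y \<noteq> Sig) else first_ok L x (\<not> p) ys)"
  unfolding first_ok_def by (auto simp: All_less_Suc2)

lemma ok_iff: "ok L x p ys \<longleftrightarrow> first_ok L x p ys \<and> pos_ok L ys"
proof (induction ys arbitrary: x p)
  case Nil then show ?case by (simp add: first_ok_def pos_ok_def)
next
  case (Cons y ys)
  show ?case using Cons[of y False] Cons[of x "\<not> p"] by (auto simp: first_ok_Cons pos_ok_Cons)
qed

lemma ok_iff_pos_ok: "x \<in> L \<Longrightarrow> ok L x False ys \<longleftrightarrow> pos_ok L (x # ys)"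
  by (simp add: ok_iff pos_ok_Cons)

section \<open>Reversing and rotating the rim\<close>

lemma cycle_edges_rev: "cs \<noteq> [] \<Longrightarrow> cycle_edges (rev cs) = cycle_edges cs"
proof -
  have sub: "cycle_edges (rev cs) \<subseteq> cycle_edges cs" if "cs \<noteq> []" for cs :: "'a list"
  proof
    fix e assume "e \<in> cycle_edges (rev cs)"
    then obtain i where i: "i < length cs" "e = {rev cs ! i, rev cs ! (Suc i mod length cs)}"
      unfolding cycle_edges_def by auto
    show "e \<in> cycle_edges cs"
    proof (cases "Suc i = length cs")
      case True
      then have "length cs - Suc i = 0" "length cs - Suc 0 = i" "cs \<noteq> []" by auto
      then have "rev cs ! i = cs ! 0" "rev cs ! 0 = cs ! i" using i(1) rev_nth[of i cs] rev_nth[of 0 cs] by auto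
      then have "e = {cs ! i, cs ! (Suc i mod length cs)}" using i(2) True by auto
      then show ?thesis using i(1) unfolding cycle_edges_def by blast
    next
      case False
      define j where "j = length cs - Suc (Suc i)"
      have j: "Suc j < length cs" "length cs - Suc i = Suc j" using i(1) False unfolding j_def by auto
      have "e = {cs ! Suc j, cs ! j}" using i False j unfolding j_def by (auto simp: rev_nth)
      then have "e = {cs ! j, cs ! (Suc j mod length cs)}" using j by auto
      moreover have "j < length cs" using j(1) by simp
      ultimately show ?thesis unfolding cycle_edges_def by blast
    qed
  qed
  assume "cs \<noteq> []"
  then show ?thesis using sub[of cs] sub[of "rev cs"] by auto
qed

lemma is_rim_rev: "is_rim V E cs \<Longrightarrow> is_rim V E (rev cs)"
proof -
  assume r: "is_rim V E cs"
  then have "cs \<noteq> []" unfolding is_rim_def hamiltonian_list_def by auto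
  then show ?thesis using r cycle_edges_rev unfolding is_rim_def hamiltonian_list_def by auto
qed

lemma cycle_edges_rotate1: "cycle_edges (rotate1 cs) = cycle_edges cs"
proof (cases "cs = []")
  case False
  define n where "n = length cs"
  have n: "0 < n" using False unfolding n_def by simp
  have nth: "rotate1 cs ! i = cs ! (Suc i mod n)" if "i < n" for i
    using nth_rotate1[of i cs] that unfolding n_def by simp
  have "cycle_edges (rotate1 cs) = (\<lambda>i. {cs ! (Suc i mod n), cs ! (Suc (Suc i mod n) mod n)}) ` {..<n}"
  proof -
    have "length (rotate1 cs) = n" unfolding n_def by simp
    then have "cycle_edges (rotate1 cs) = (\<lambda>i. {rotate1 cs ! i, rotate1 cs ! (Suc i mod n)}) ` {..<n}"
      unfolding cycle_edges_def by auto
    also have "\<dots> = (\<lambda>i. {cs ! (Suc i mod n), cs ! (Suc (Suc i mod n) mod n)}) ` {..<n}"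
      using nth n by (intro image_cong) auto
    finally show ?thesis .
  qed
  also have "\<dots> = (\<lambda>i. {cs ! i, cs ! (Suc i mod n)}) ` ((\<lambda>i. Suc i mod n) ` {..<n})"
    by (simp add: image_image)
  also have "(\<lambda>i. Suc i mod n) ` {..<n} = {..<n}"
  proof -
    have "i \<in> (\<lambda>i. Suc i mod n) ` {..<n}" if "i < n" for i
    proof (cases i)
      case 0
      then have "i = Suc (n - 1) mod n" using n by simp
      then show ?thesis using n by (metis imageI lessThan_iff diff_less zero_less_one)
    next
      case (Suc k)
      then have "i = Suc k mod n" "k < n" using that by auto
      then show ?thesis by blast
    qed
    then show ?thesis using n by auto
  qed
  finally show ?thesis unfolding cycle_edges_def n_def[symmetric] by auto
qed simp

lemma is_rim_rotate: "is_rim V E cs \<Longrightarrow> is_rim V E (rotate k cs)"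
proof (induction k)
  case (Suc k)
  then show ?case using cycle_edges_rotate1[of "rotate k cs"] unfolding is_rim_def hamiltonian_list_def by (simp add: rotate_def)
qed simp

section \<open>Reading the N-conditions of subfamilies off the word\<close>

context multisun_graph
begin

lemma N_conditions_iff: "N_conditions V E \<longleftrightarrow> npos n c I"
  using N_conditions_keep[OF subset_refl] unfolding keep_all .

text \<open>Given two cliques, the common vertex carries \<open>Sig\<close>, and no other vertex
  does. Odd sizes and the common vertex pass from the whole family to \<open>F\<close>, so only the
  gap parities, in the form \<open>lin\<close>, have to be read off the word.\<close>

lemma word_characterisation:
  assumes np: "npos n c I" and inj: "inj_on f I" and two: "A0 \<in> I" "B0 \<in> I" "A0 \<noteq> B0"
    and w: "w = map (vertex_label V E f) cs"
  shows "count_list w Sig = 1"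
    and "set w - {Eps} = insert Sig (Let ` f ` I)"
    and "\<And>F. F \<subseteq> I \<Longrightarrow> F \<noteq> {} \<Longrightarrow> npos n c F \<longleftrightarrow> word_ok (insert Sig (Let ` f ` F)) w"
proof -
  define lab where "lab = vertex_label V E f"
  obtain \<xi> where xi_rim: "\<xi> \<in> range c" and xi_common: "\<forall>A\<in>I. \<xi> \<in> A \<and> (\<forall>B\<in>I. A \<noteq> B \<longrightarrow> A \<inter> B = {\<xi>})"
    using npos_common[OF np] by (rule bexE)
  have xi: "\<xi> \<in> V" "\<And>A. A \<in> I \<Longrightarrow> \<xi> \<in> A" "\<And>A B. A \<in> I \<Longrightarrow> B \<in> I \<Longrightarrow> A \<noteq> B \<Longrightarrow> A \<inter> B = {\<xi>}"
    using xi_rim xi_common range_rim_fun[OF cs(6)] cs(2) by simp_all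
  have lab_xi: "lab \<xi> = Sig"
  proof -
    have "{K \<in> I. \<xi> \<in> K} = I" using xi by blast
    moreover have "\<not> (\<exists>K. I = {K})" using two by blast
    ultimately show ?thesis using inscribed_ne unfolding lab_def vertex_label_def by simp
  qed
  have lab_in: "lab v = Let (f A)" if A: "A \<in> I" "v \<in> A" "v \<noteq> \<xi>" for v A
  proof -
    have "{K \<in> I. v \<in> K} = {A}" using A xi(3) by blast
    then show ?thesis unfolding lab_def vertex_label_def by simp
  qed
  have lab_out: "lab v = Eps" if "v \<notin> \<Union>I" for v
  proof -
    have "{K \<in> I. v \<in> K} = {}" using that by blast
    then show ?thesis unfolding lab_def vertex_label_def by simp
  qed
  have lab_sig: "lab v = Sig \<longleftrightarrow> v = \<xi>" for v
    using lab_xi lab_in[of _ v] lab_out[of v] by (cases "v = \<xi>"; cases "v \<in> \<Union>I") auto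
  obtain cs1 cs2 where split: "cs = cs1 @ \<xi> # cs2" using xi(1) cs(2) by (metis split_list)
  have nin: "\<xi> \<notin> set cs1" "\<xi> \<notin> set cs2" using cs(1) unfolding split by auto
  define ds where "ds = \<xi> # cs2 @ cs1"
  have ds: "ds = rotate (length cs1) cs" unfolding ds_def split by (simp add: rotate_append)
  have nsig: "Sig \<notin> lab ` set cs1" "Sig \<notin> lab ` set cs2" using nin lab_sig by force+
  have wsplit: "w = map lab cs1 @ Sig # map lab cs2" unfolding w split lab_def[symmetric] using lab_xi by simp
  show "count_list w Sig = 1" unfolding wsplit using nsig by (simp add: count_list_0_iff)
  have nonroot: "\<exists>v\<in>A. v \<noteq> \<xi>" if "A \<in> I" for A
  proof (rule ccontr)
    assume "\<not> ?thesis"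
    then have "A \<subseteq> {\<xi>}" by blast
    then have "card A \<le> 1" using card_mono[of "{\<xi>}" A] by simp
    then show False using inscribedD(4)[OF that] by simp
  qed
  have setw: "set w = lab ` V" unfolding w lab_def[symmetric] using cs(2) by simp
  show "set w - {Eps} = insert Sig (Let ` f ` I)"
  proof
    show "set w - {Eps} \<subseteq> insert Sig (Let ` f ` I)"
    proof
      fix x assume "x \<in> set w - {Eps}"
      then obtain v where v: "x = lab v" "lab v \<noteq> Eps" unfolding setw by blast
      then obtain A where "A \<in> I" "v \<in> A" using lab_out[of v] by blast
      then show "x \<in> insert Sig (Let ` f ` I)" using lab_in[of A v] lab_xi v by (cases "v = \<xi>") auto
    qed
    show "insert Sig (Let ` f ` I) \<subseteq> set w - {Eps}"
    proof
      fix x assume "x \<in> insert Sig (Let ` f ` I)"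
      then consider "x = Sig" | A where "A \<in> I" "x = Let (f A)" by blast
      then show "x \<in> set w - {Eps}"
      proof cases
        case 1
        then show ?thesis unfolding setw using lab_xi xi(1) by force
      next
        case 2
        obtain v where v: "v \<in> A" "v \<noteq> \<xi>" using nonroot[OF 2(1)] by blast
        then have "v \<in> V" using inscribedD(3)[OF 2(1)] by blast
        moreover have "x = lab v" using lab_in[OF 2(1) v] 2(2) by simp
        ultimately show ?thesis unfolding setw using 2(2) by auto
      qed
    qed
  qed
  interpret D: multisun_graph V E ds
    by unfold_locales (use ms is_rim_rotate[OF r] ds in auto)
  interpret S: sun D.n D.c I by (rule D.sun)
  have len: "length ds = n" unfolding ds by simp
  have D0: "D.c 0 = \<xi>" unfolding rim_fun_def ds_def by simp
  fix F assume F: "F \<subseteq> I" "F \<noteq> {}"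
  define L where "L = insert Sig (Let ` f ` F)"
  \<comment> \<open>Positions \<open>0\<close> and \<open>n\<close> are both the common vertex, so
    the word of the cut rim has \<open>n + 1\<close> letters and \<open>Sig\<close> at both
    ends.\<close>
  define zs where "zs = Sig # (map lab cs2 @ map lab cs1) @ [Sig]"
  have lz: "length zs = Suc n" using len unfolding zs_def ds_def by simp
  have zs: "zs ! i = lab (D.c i)" if "i \<le> n" for i
  proof (cases "i = n")
    case True
    then have "zs ! i = Sig" unfolding zs_def by (simp add: nth_append split)
    moreover have "D.c i = \<xi>" using True D0 S.c_add_n(3) len by simp
    ultimately show ?thesis using lab_xi by simp
  next
    case False
    then have i: "i < length ds" using that len by simp
    have "zs = map lab ds @ [Sig]" unfolding zs_def ds_def using lab_xi by simp
    then have "zs ! i = lab (ds ! i)" using i by (simp add: nth_append)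
    then show ?thesis using i unfolding rim_fun_def by simp
  qed
  have inL: "lab v \<in> L \<longleftrightarrow> v \<in> \<Union>F" for v
  proof (cases "v = \<xi>")
    case True
    then show ?thesis using lab_xi F xi(2) unfolding L_def by blast
  next
    case False
    show ?thesis
    proof
      assume "lab v \<in> L"
      then obtain A where A: "A \<in> F" "lab v = Let (f A)" using lab_sig False unfolding L_def by auto
      then obtain B where B: "B \<in> I" "v \<in> B" using lab_out[of v] by auto
      then have "f A = f B" using lab_in[OF B False] A by simp
      then have "A = B" using inj A(1) B(1) F(1) by (auto dest: inj_onD)
      then show "v \<in> \<Union>F" using A B by blast
    next
      assume "v \<in> \<Union>F"
      then obtain A where "A \<in> F" "v \<in> A" by blast
      then show "lab v \<in> L" using lab_in[of A v] False F(1) unfolding L_def by auto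
    qed
  qed
  have same: "(lab u \<noteq> lab v \<and> lab u \<noteq> Sig \<and> lab v \<noteq> Sig) \<longleftrightarrow> \<not> (\<exists>A\<in>F. u \<in> A \<and> v \<in> A)"
    if uv: "u \<in> \<Union>F" "v \<in> \<Union>F" for u v
  proof -
    obtain A B where A: "A \<in> F" "u \<in> A" and B: "B \<in> F" "v \<in> B" using uv by blast
    have AI: "A \<in> I" "B \<in> I" using A B F by blast+
    show ?thesis
    proof (cases "u = \<xi> \<or> v = \<xi>")
      case True
      then have "\<exists>A\<in>F. u \<in> A \<and> v \<in> A" using A B AI xi(2) by blast
      then show ?thesis using True lab_xi by auto
    next
      case False
      then have l: "lab u = Let (f A)" "lab v = Let (f B)" using lab_in A B AI by auto
      have "C = A" if "C \<in> F" "u \<in> C" for C using xi(3)[of C A] that A AI F False by blast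
      moreover have "C = B" if "C \<in> F" "v \<in> C" for C using xi(3)[of C B] that B AI F False by blast
      ultimately have "(\<exists>C\<in>F. u \<in> C \<and> v \<in> C) \<longleftrightarrow> A = B" using A B by blast
      also have "\<dots> \<longleftrightarrow> f A = f B" using inj AI by (auto dest: inj_onD)
      finally show ?thesis using l by simp
    qed
  qed
  have "lin n D.c F \<longleftrightarrow> pos_ok L zs"
  proof -
    have "(zs ! i \<in> L \<and> zs ! j \<in> L \<and> (\<forall>t. i < t \<and> t < j \<longrightarrow> zs ! t \<notin> L) \<longrightarrow>
          even (j - i) = (zs ! i \<noteq> zs ! j \<and> zs ! i \<noteq> Sig \<and> zs ! j \<noteq> Sig)) \<longleftrightarrow>
        (D.c i \<in> \<Union>F \<and> D.c j \<in> \<Union>F \<and> (\<forall>t. i < t \<and> t < j \<longrightarrow> D.c t \<notin> \<Union>F) \<longrightarrow>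
          odd (j - i) = (\<exists>A\<in>F. D.c i \<in> A \<and> D.c j \<in> A))"
      if ij: "i < j" "j \<le> n" for i j
    proof -
      have mem: "zs ! t \<in> L \<longleftrightarrow> D.c t \<in> \<Union>F" if "t \<le> j" for t
        using zs[of t] inL[of "D.c t"] that ij by simp
      then have "(\<forall>t. i < t \<and> t < j \<longrightarrow> zs ! t \<notin> L) \<longleftrightarrow> (\<forall>t. i < t \<and> t < j \<longrightarrow> D.c t \<notin> \<Union>F)"
        by (meson less_imp_le)
      moreover have "even (j - i) = (zs ! i \<noteq> zs ! j \<and> zs ! i \<noteq> Sig \<and> zs ! j \<noteq> Sig) \<longleftrightarrow>
          odd (j - i) = (\<exists>A\<in>F. D.c i \<in> A \<and> D.c j \<in> A)" if "D.c i \<in> \<Union>F" "D.c j \<in> \<Union>F"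
      proof -
        have "zs ! i = lab (D.c i)" "zs ! j = lab (D.c j)" using zs[of i] zs[of j] ij by simp_all
        then show ?thesis by (simp only: same[OF that]) blast
      qed
      ultimately show ?thesis using mem[of i] mem[of j] ij(1) by (simp only: less_imp_le order_refl) blast
    qed
    note eq = this
    define P where "P i j \<longleftrightarrow> (D.c i \<in> \<Union>F \<and> D.c j \<in> \<Union>F \<and> (\<forall>t. i < t \<and> t < j \<longrightarrow> D.c t \<notin> \<Union>F) \<longrightarrow>
        odd (j - i) = (\<exists>A\<in>F. D.c i \<in> A \<and> D.c j \<in> A))" for i j
    have "pos_ok L zs \<longleftrightarrow> (\<forall>j\<le>n. \<forall>i<j. P i j)"
      unfolding pos_ok_def lz less_Suc_eq_le P_def using eq by simp
    moreover have "lin n D.c F \<longleftrightarrow> (\<forall>i j. i < j \<longrightarrow> j \<le> n \<longrightarrow> P i j)"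
      unfolding lin_def P_def by (simp only: imp_conjL)
    ultimately show ?thesis by blast
  qed
  also have "pos_ok L zs \<longleftrightarrow> word_ok L w"
    unfolding word_ok_def wsplit zs_def using nsig cut_at_sig_split[of "map lab cs1" "map lab cs2"]
      ok_iff_pos_ok[of Sig L] by (simp add: L_def)
  finally have lw: "lin n D.c F \<longleftrightarrow> word_ok L w" .
  have root: "D.c 0 \<in> A" if "A \<in> F" for A using D0 xi(2) that F by auto
  have card: "odd (card A)" if "A \<in> F" for A using npos_card[OF np] that F by blast
  interpret SF: sun n D.c F using S.subset_sun[OF F(1)] len by simp
  have "npos n c F \<longleftrightarrow> npos n D.c F"
    using N_conditions_keep[OF F(1)] D.N_conditions_keep[OF F(1)] len by simp
  also have "\<dots> \<longleftrightarrow> lin n D.c F"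
    using SF.npos_imp_lin[OF _ root] SF.lin_imp_npos[OF subset_refl root _ card] by blast
  finally show "npos n c F \<longleftrightarrow> word_ok (insert Sig (Let ` f ` F)) w" using lw unfolding L_def by simp
qed

end

lemma vertex_label_Sig:
  assumes "vertex_label V E f v = Sig"
  shows "\<exists>A B. A \<in> inscribed V E \<and> B \<in> inscribed V E \<and> A \<noteq> B"
proof -
  define Ks where "Ks = {K \<in> inscribed V E. v \<in> K}"
  have "Ks \<noteq> {}" "\<not> (\<exists>K. Ks = {K})"
    using assms unfolding vertex_label_def Ks_def[symmetric] Let_def by (auto split: if_splits)
  then obtain A where A: "A \<in> Ks" "Ks \<noteq> {A}" by blast
  then obtain B where "B \<in> Ks" "B \<noteq> A" by blast
  then show ?thesis using A unfolding Ks_def by blast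
qed

text \<open>The patterns of the two words agree up to rotation and reversal, and
  \<open>word_ok\<close> survives deletions and rotations. So a subfamily of one graph satisfies the
  conditions because the subfamily with the same letters does in the given sunoid.\<close>

theorem sunoid_if_sunword:
  assumes ms: "multisun V E" and N: "N_conditions V E" and w: "sword_rep V E w" and sw: "sunword w"
  shows "sunoid V E"
proof -
  obtain cs0 f where cs0: "is_rim V E cs0" and f: "inj_on f (inscribed V E)"
    and w0: "w = map (vertex_label V E f) cs0" using w unfolding sword_rep_def by blast
  obtain V' :: "nat set" and E' w' where so: "sunoid V' E'" and sw': "sword_rep V' E' w'" and "word_approx w' w"
    using sw unfolding sunword_def by blast
  then obtain k where k: "pattern w = rotate k (pattern w') \<or> pattern w = rev (rotate k (pattern w'))"
    unfolding word_approx_def cyc_equiv_def by blast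
  \<comment> \<open>A reversal is undone by listing the rim of the graph backwards, so only a
    rotation remains.\<close>
  have "\<exists>cs w1. is_rim V E cs \<and> w1 = map (vertex_label V E f) cs \<and> eps_step\<^sup>*\<^sup>* w1 (rotate k (pattern w'))"
    using k
  proof
    assume "pattern w = rotate k (pattern w')"
    then show ?thesis using cs0 w0 eps_steps_pattern[of w] by metis
  next
    assume "pattern w = rev (rotate k (pattern w'))"
    then have "eps_step\<^sup>*\<^sup>* (rev w) (rotate k (pattern w'))" using eps_steps_rev[OF eps_steps_pattern[of w]] by simp
    then show ?thesis using is_rim_rev[OF cs0] w0 by (metis rev_map)
  qed
  then obtain cs w1 where cs: "is_rim V E cs" and w1: "w1 = map (vertex_label V E f) cs"
    and step: "eps_step\<^sup>*\<^sup>* w1 (rotate k (pattern w'))" by blast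
  interpret G: multisun_graph V E cs by unfold_locales (use ms cs in auto)
  have npI: "npos G.n G.c G.I" using N G.N_conditions_iff by blast
  show ?thesis
  proof (cases "\<exists>A B. A \<in> G.I \<and> B \<in> G.I \<and> A \<noteq> B")
    case False
    \<comment> \<open>With one inscribed clique the whole family is the only nonempty subfamily, and
      its N-conditions are given.\<close>
    then have "F = G.I" if "F \<subseteq> G.I" "F \<noteq> {}" for F using that by blast
    then show ?thesis unfolding G.sunoid_iff using npI by metis
  next
    case True
    then obtain A0 B0 where AB: "A0 \<in> G.I" "B0 \<in> G.I" "A0 \<noteq> B0" by blast
    note W = G.word_characterisation[OF npI f AB w1]
    define p' where "p' = pattern w'"
    have s1: "word_ok L w1 = word_ok L (rotate k p') \<and> count_list (rotate k p') Sig = 1 \<and>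
      set w1 - {Eps} = set (rotate k p') - {Eps}" if "Eps \<notin> L" for L
      using word_ok_eps_steps[OF step that W(1)] unfolding p'_def .
    have p'1: "count_list p' Sig = 1" using s1[of "{}"] by (simp add: count_list_rotate)
    have w'1: "count_list w' Sig = 1"
    proof -
      have one: "eps_step u v \<Longrightarrow> count_list u Sig = count_list v Sig" for u v
        unfolding eps_step_def by auto
      have "count_list u Sig = count_list v Sig" if "eps_step\<^sup>*\<^sup>* u v" for u v
        using that by (induction rule: rtranclp_induct) (auto dest: one)
      then show ?thesis using eps_steps_pattern[of w'] p'1 unfolding p'_def by metis
    qed
    obtain cs' f' where cs': "is_rim V' E' cs'" and f': "inj_on f' (inscribed V' E')"
      and w': "w' = map (vertex_label V' E' f') cs'" using sw' unfolding sword_rep_def by blast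
    interpret G': multisun_graph V' E' cs' by unfold_locales (use so cs' in \<open>auto simp: sunoid_def\<close>)
    have np': "npos G'.n G'.c F" if "F \<subseteq> G'.I" "F \<noteq> {}" for F
      using so that unfolding G'.sunoid_iff by blast
    \<comment> \<open>An occurrence of \<open>Sig\<close> shows that the sunoid too has two
      inscribed cliques, so the characterisation applies to it.\<close>
    have "Sig \<in> set w'" using w'1 by (metis count_list_0_iff zero_neq_one)
    then obtain v where "vertex_label V' E' f' v = Sig" unfolding w' by (auto simp: eq_commute[of Sig])
    then obtain A1 B1 where AB': "A1 \<in> G'.I" "B1 \<in> G'.I" "A1 \<noteq> B1"
      using vertex_label_Sig by metis
    note W' = G'.word_characterisation[OF np'[OF subset_refl G'.inscribed_ne] f' AB' w']
    have s2: "word_ok L w' = word_ok L p' \<and> set w' - {Eps} = set p' - {Eps}" if "Eps \<notin> L" for L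
      using word_ok_eps_steps[OF eps_steps_pattern that w'1] unfolding p'_def by blast
    have tr: "word_ok L w1 = word_ok L w'" if "Eps \<notin> L" for L
      using s1[OF that] s2[OF that] word_ok_rotate[OF p'1] by simp
    have "insert Sig (Let ` f ` G.I) = insert Sig (Let ` f' ` G'.I)"
      using s1[of "{}"] s2[of "{}"] W(2) W'(2) by simp
    moreover have "Sig \<notin> Let ` X" for X by auto
    ultimately have "Let ` f ` G.I = Let ` f' ` G'.I" by (metis insert_ident)
    then have letters: "f ` G.I = f' ` G'.I" by (simp add: inj_image_eq_iff inj_def)
    show ?thesis unfolding G.sunoid_iff
    proof (intro allI impI, elim conjE)
      fix F assume F: "F \<subseteq> G.I" "F \<noteq> {}"
      define F' where "F' = {A \<in> G'.I. f' A \<in> f ` F}"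
      have "f ` F \<subseteq> f' ` G'.I" using image_mono[OF F(1), of f] letters by simp
      moreover have "h ` {A \<in> X. h A \<in> S} = S" if "S \<subseteq> h ` X" for h :: "nat set \<Rightarrow> nat" and X S
        using that by blast
      ultimately have "f' ` F' = f ` F" unfolding F'_def by blast
      moreover have "F' \<subseteq> G'.I" unfolding F'_def by blast
      moreover have "F' \<noteq> {}" using calculation F(2) by auto
      ultimately have "word_ok (insert Sig (Let ` f ` F)) w'" using W'(3)[of F'] np'[of F'] by simp
      moreover have "Eps \<notin> insert Sig (Let ` f ` F)" by auto
      ultimately have "word_ok (insert Sig (Let ` f ` F)) w1" using tr by blast
      then show "npos G.n G.c F" using W(3)[OF F] by blast
    qed
  qed
qed

section \<open>Copies of a multisun\<close>

lemma rim_fun_map: "cs \<noteq> [] \<Longrightarrow> rim_fun (map g cs) i = g (rim_fun cs i)"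
  unfolding rim_fun_def by simp

lemma cycle_edges_map: "cycle_edges (map g cs) = (`) g ` cycle_edges cs"
proof -
  have ce: "cycle_edges xs = (\<lambda>i. {xs ! i, xs ! (Suc i mod length xs)}) ` {..<length xs}" for xs :: "'x list"
    unfolding cycle_edges_def by auto
  have "Suc i mod length cs < length cs" if "i < length cs" for i
    using that by (intro mod_less_divisor) auto
  then show ?thesis unfolding ce image_image length_map by (intro image_cong refl) simp
qed

lemma npos_image:
  assumes inj: "inj_on g V" and rng: "range c \<subseteq> V" and F: "\<And>A. A \<in> F \<Longrightarrow> A \<subseteq> V" and np: "npos n c F"
  shows "npos n (\<lambda>i. g (c i)) ((`) g ` F)"
proof -
  have mem: "g (c i) \<in> g ` A \<longleftrightarrow> c i \<in> A" if "A \<in> F" for i A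
    using inj_on_image_mem_iff[OF inj _ F[OF that]] rng by blast
  have U: "g (c i) \<in> \<Union>((`) g ` F) \<longleftrightarrow> c i \<in> \<Union>F" for i using mem by auto
  have gap_eq: "gap (\<lambda>i. g (c i)) ((`) g ` F) i d \<longleftrightarrow> gap c F i d" for i d unfolding gap_def U ..
  obtain \<xi> where xi: "\<xi> \<in> range c" "\<forall>A\<in>F. \<xi> \<in> A \<and> (\<forall>B\<in>F. A \<noteq> B \<longrightarrow> A \<inter> B = {\<xi>})"
    using npos_common[OF np] by blast
  show ?thesis unfolding npos_def gap_eq
  proof (intro conjI ballI allI impI)
    show "odd d" if h: "A' \<in> (`) g ` F" "gap c F i d \<and> d < n \<and> g (c i) \<in> A' \<and> g (c (i + d)) \<in> A'" for A' i d
    proof -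
      obtain A where "A \<in> F" "A' = g ` A" using h(1) by blast
      then show ?thesis using npos_odd[OF np, of A i d] h(2) mem by simp
    qed
    show "odd (card A')" if h: "A' \<in> (`) g ` F" for A'
    proof -
      obtain A where A: "A \<in> F" "A' = g ` A" using h by blast
      then have "card A' = card A" using card_image[OF inj_on_subset[OF inj F[OF A(1)]]] by simp
      then show ?thesis using npos_card[OF np] A by simp
    qed
    show "\<exists>\<xi>\<in>range (\<lambda>i. g (c i)). \<forall>A\<in>(`) g ` F. \<xi> \<in> A \<and> (\<forall>B\<in>(`) g ` F. A \<noteq> B \<longrightarrow> A \<inter> B = {\<xi>})"
    proof (intro bexI[of _ "g \<xi>"] ballI conjI impI)
      show "g \<xi> \<in> range (\<lambda>i. g (c i))" using xi(1) by blast
      fix A' assume "A' \<in> (`) g ` F"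
      then obtain A where A: "A \<in> F" "A' = g ` A" by blast
      then show "g \<xi> \<in> A'" using xi by blast
      fix B' assume "B' \<in> (`) g ` F" "A' \<noteq> B'"
      then obtain B where B: "B \<in> F" "B' = g ` B" "A \<noteq> B" using A by blast
      have "A' \<inter> B' = g ` (A \<inter> B)" using inj_on_image_Int[OF inj F[OF A(1)] F[OF B(1)]] A B by simp
      also have "A \<inter> B = {\<xi>}" using xi A B by blast
      finally show "A' \<inter> B' = {g \<xi>}" by simp
    qed
    show "even d" if h: "A' \<in> (`) g ` F" "B' \<in> (`) g ` F"
      "A' \<noteq> B' \<and> gap c F i d \<and> d < n \<and> g (c i) \<in> A' - B' \<and> g (c (i + d)) \<in> B' - A'" for A' B' i d
    proof -
      obtain A B where "A \<in> F" "A' = g ` A" "B \<in> F" "B' = g ` B" using h(1,2) by blast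
      then show ?thesis using npos_even[OF np, of A B i d] h(3) mem by auto
    qed
  qed
qed

text \<open>A sunword must come from a graph on natural numbers; renaming the vertices injectively
  provides one for a sunoid over any type.\<close>

locale multisun_copy = multisun_graph V E cs for V :: "'a set" and E :: "'a set set" and cs :: "'a list" +
  fixes g :: "'a \<Rightarrow> 'b"
  assumes inj: "inj_on g V"
begin

abbreviation "V' \<equiv> g ` V"
abbreviation "E' \<equiv> (`) g ` E"

lemma inj_eq: "u \<in> V \<Longrightarrow> v \<in> V \<Longrightarrow> g u = g v \<longleftrightarrow> u = v"
  using inj by (auto dest: inj_onD)

lemma image_eq: "A \<subseteq> V \<Longrightarrow> B \<subseteq> V \<Longrightarrow> g ` A = g ` B \<longleftrightarrow> A = B"
  using inj_on_image_eq_iff[OF inj] .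

lemma edge_sub: "e \<in> E \<Longrightarrow> e \<subseteq> V"
  using ms unfolding multisun_def simple_graph_def by fastforce

lemma copy_edge: "u \<in> V \<Longrightarrow> v \<in> V \<Longrightarrow> {g u, g v} \<in> E' \<longleftrightarrow> {u, v} \<in> E"
proof
  assume uv: "u \<in> V" "v \<in> V" "{g u, g v} \<in> E'"
  then obtain e where e: "e \<in> E" "g ` {u, v} = g ` e" by auto
  then have "{u, v} = e" using image_eq[of "{u, v}" e] edge_sub uv by auto
  then show "{u, v} \<in> E" using e by simp
next
  assume "{u, v} \<in> E"
  then have "g ` {u, v} \<in> E'" by blast
  then show "{g u, g v} \<in> E'" by simp
qed

lemma copy_clique: "K \<subseteq> V \<Longrightarrow> clique V' E' (g ` K) \<longleftrightarrow> clique V E K"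
proof -
  assume K: "K \<subseteq> V"
  have "(g u \<noteq> g v \<longrightarrow> {g u, g v} \<in> E') \<longleftrightarrow> (u \<noteq> v \<longrightarrow> {u, v} \<in> E)" if "u \<in> K" "v \<in> K" for u v
  proof -
    have "u \<in> V" "v \<in> V" using that K by auto
    then show ?thesis using inj_eq copy_edge by simp
  qed
  then show ?thesis using K unfolding clique_def ball_simps by (simp add: image_mono)
qed

lemma copy_maximal_clique: "maximal_clique V' E' K' \<longleftrightarrow> K' \<in> (`) g ` {K. maximal_clique V E K}"
proof
  assume m: "maximal_clique V' E' K'"
  then have "K' \<subseteq> V'" unfolding maximal_clique_def clique_def by simp
  then obtain K where K: "K \<subseteq> V" "K' = g ` K" by (metis subset_imageE)
  have "K1 = K" if K1: "clique V E K1" "K \<subseteq> K1" for K1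
  proof -
    have sub: "K1 \<subseteq> V" using clique_sub[OF K1(1)] .
    then have "g ` K1 = g ` K"
      using m K(2) copy_clique[OF sub] K1 image_mono[OF K1(2), of g] unfolding maximal_clique_def by simp
    then show ?thesis using image_eq sub K(1) by simp
  qed
  moreover have "clique V E K" using m copy_clique[OF K(1)] K(2) unfolding maximal_clique_def by simp
  ultimately have "maximal_clique V E K" unfolding maximal_clique_def by blast
  then show "K' \<in> (`) g ` {K. maximal_clique V E K}" using K(2) by blast
next
  assume "K' \<in> (`) g ` {K. maximal_clique V E K}"
  then obtain K where m: "maximal_clique V E K" and K': "K' = g ` K" by blast
  then have cl: "clique V E K" unfolding maximal_clique_def by simp
  note K = clique_sub[OF cl]
  have "K1' = g ` K" if K1': "clique V' E' K1'" "g ` K \<subseteq> K1'" for K1'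
  proof -
    have "K1' \<subseteq> V'" using K1'(1) unfolding clique_def by simp
    then obtain K1 where K1: "K1 \<subseteq> V" "K1' = g ` K1" by (metis subset_imageE)
    then have "clique V E K1" using copy_clique K1'(1) by simp
    moreover have "K \<subseteq> K1"
    proof
      fix x assume "x \<in> K"
      then have "x \<in> V" "g x \<in> g ` K1" using K K1'(2) K1(2) by auto
      then show "x \<in> K1" using inj_on_image_mem_iff[OF inj _ K1(1)] by simp
    qed
    ultimately have "K1 = K" using m unfolding maximal_clique_def by blast
    then show ?thesis using K1 by simp
  qed
  then show "maximal_clique V' E' K'" using copy_clique[OF K] cl unfolding K' maximal_clique_def by blast
qed

lemma card_copy: "maximal_clique V E K \<Longrightarrow> card (g ` K) = card K"
proof -
  assume "maximal_clique V E K"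
  then have "K \<subseteq> V" unfolding maximal_clique_def clique_def by simp
  then show ?thesis by (intro card_image inj_on_subset[OF inj])
qed

lemma inscribed_copy: "inscribed V' E' = (`) g ` I"
  unfolding inscribed_def copy_maximal_clique using card_copy by auto

lemma rim_edges_copy: "rim_edges V' E' = (`) g ` rim_edges V E"
  unfolding rim_edges_def copy_maximal_clique using card_copy by auto

lemma is_rim_copy: "is_rim V' E' (map g cs)"
  unfolding is_rim_def hamiltonian_list_def rim_edges_copy cycle_edges_map
  using cs inj by (simp add: distinct_map)

lemma multisun_copy: "multisun V' E'"
  unfolding multisun_def
proof (intro conjI exI[of _ "map g cs"] is_rim_copy)
  show "simple_graph V' E'"
    unfolding simple_graph_def
  proof (intro conjI ballI)
    show "finite V'" using finite_V by simp
    fix e' assume "e' \<in> E'"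
    then obtain e where e: "e \<in> E" "e' = g ` e" by blast
    moreover have "simple_graph V E" using ms unfolding multisun_def by simp
    ultimately obtain u v where uv: "e = {u, v}" "u \<noteq> v" "u \<in> V" "v \<in> V" unfolding simple_graph_def by meson
    then show "\<exists>u v. e' = {u, v} \<and> u \<noteq> v \<and> u \<in> V' \<and> v \<in> V'"
      using e inj_eq by (intro exI[of _ "g u"] exI[of _ "g v"]) auto
  qed
  have "diamond_free V E" using ms unfolding multisun_def by simp
  then show "diamond_free V' E'"
    unfolding diamond_free_def by (simp add: copy_edge inj_eq)
  show "odd (card V')" using ms card_image[OF inj] unfolding multisun_def by simp
  show "inscribed V' E' \<noteq> {}" unfolding inscribed_copy using inscribed_ne by simp
  show "\<forall>K\<in>inscribed V' E'. \<forall>u\<in>K. \<forall>v\<in>K. {u, v} \<notin> cycle_edges (map g cs)"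
    unfolding inscribed_copy cycle_edges_map
  proof (intro ballI)
    fix K' u' v' assume "K' \<in> (`) g ` I" "u' \<in> K'" "v' \<in> K'"
    then obtain K u v where K: "K \<in> I" "u \<in> K" "v \<in> K" "u' = g u" "v' = g v" by blast
    then have uv: "{u, v} \<subseteq> V" using inscribedD(3) by blast
    have "{u, v} \<notin> cycle_edges cs" using indep[OF K(1-3)] rim_edge cs(4) by simp
    moreover have "e \<subseteq> V" if "e \<in> cycle_edges cs" for e
      using that rim_edgeD[of e] cs(4) unfolding maximal_clique_def clique_def by simp
    ultimately have "g ` {u, v} \<noteq> g ` e" if "e \<in> cycle_edges cs" for e
      using image_eq[OF uv, of e] that by auto
    then show "{u', v'} \<notin> (`) g ` cycle_edges cs" using K(4,5) by auto
  qed
qed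

lemma sunoid_copy:
  assumes "sunoid V E"
  shows "sunoid V' E'"
proof -
  interpret C: multisun_graph V' E' "map g cs"
    by unfold_locales (use multisun_copy is_rim_copy in auto)
  have rf: "rim_fun (map g cs) = (\<lambda>i. g (c i))" using rim_fun_map[OF cs(6)] by blast
  show ?thesis unfolding C.sunoid_iff
  proof (intro allI impI, elim conjE)
    fix F' assume F': "F' \<subseteq> C.I" "F' \<noteq> {}"
    then obtain F where F: "F \<subseteq> I" "F' = (`) g ` F" unfolding inscribed_copy by (metis subset_imageE)
    then have "npos n c F" using assms F' unfolding sunoid_iff by blast
    then have "npos n (\<lambda>i. g (c i)) ((`) g ` F)"
      by (rule npos_image[OF inj, rotated -1]) (use range_rim_fun[OF cs(6)] cs(2) inscribedD(3) F(1) in auto)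
    then show "npos C.n C.c F'" unfolding rf F(2) by simp
  qed
qed

text \<open>A copied clique inherits the letter of its original, so the word itself is preserved and
  not just its pattern.\<close>

lemma vertex_label_copy:
  assumes "v \<in> V"
  shows "vertex_label V' E' (f \<circ> inv_into I ((`) g)) (g v) = vertex_label V E f v"
proof -
  have injI: "inj_on ((`) g) I" using image_eq inscribedD(3) by (intro inj_onI) blast
  define Ks where "Ks = {K \<in> I. v \<in> K}"
  have "{K \<in> inscribed V' E'. g v \<in> K} = (`) g ` Ks"
    unfolding inscribed_copy Ks_def using inj_on_image_mem_iff[OF inj assms] inscribedD(3) by blast
  moreover have "(\<exists>K. (`) g ` Ks = {K}) \<longleftrightarrow> (\<exists>K. Ks = {K})"
  proof -
    have "card ((`) g ` Ks) = card Ks"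
      by (rule card_image[OF inj_on_subset[OF injI]]) (auto simp: Ks_def)
    then show ?thesis by (metis card_1_singleton_iff One_nat_def)
  qed
  moreover have "(f \<circ> inv_into I ((`) g)) (the_elem ((`) g ` Ks)) = f (the_elem Ks)" if "Ks = {K}" for K
  proof -
    have "K \<in> I" using that unfolding Ks_def by blast
    then show ?thesis using that inv_into_f_f[OF injI] by simp
  qed
  ultimately show ?thesis unfolding vertex_label_def Let_def Ks_def[symmetric] by auto
qed

lemma sword_rep_copy:
  assumes "inj_on f I"
  shows "sword_rep V' E' (map (vertex_label V E f) cs)"
proof -
  have injI: "inj_on ((`) g) I" using image_eq inscribedD(3) by (intro inj_onI) blast
  have "inj_on (f \<circ> inv_into I ((`) g)) (inscribed V' E')"
    unfolding inscribed_copy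
    by (rule comp_inj_on) (simp_all add: inj_on_inv_into inv_into_image_cancel[OF injI] assms)
  moreover have "map (vertex_label V E f) cs = map (vertex_label V' E' (f \<circ> inv_into I ((`) g))) (map g cs)"
    using vertex_label_copy cs(2) by auto
  ultimately show ?thesis unfolding sword_rep_def using is_rim_copy by blast
qed

end

lemma sunword_if_sunoid:
  assumes s: "sunoid V E"
  shows "\<exists>w. sword_rep V E w \<and> sunword w"
proof -
  have ms: "multisun V E" using s unfolding sunoid_def by simp
  then obtain cs where cs: "is_rim V E cs" unfolding multisun_def by blast
  interpret multisun_graph V E cs by unfold_locales (use ms cs in auto)
  obtain g :: "'a \<Rightarrow> nat" where "inj_on g V" using finite_imp_inj_to_nat_seg[OF finite_V] by blast
  then interpret multisun_copy V E cs g by unfold_locales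
  have "I \<subseteq> Pow V" using inscribedD(3) by blast
  then have "finite I" using finite_V by (metis finite_Pow_iff finite_subset)
  then obtain f :: "'a set \<Rightarrow> nat" where f: "inj_on f I" using finite_imp_inj_to_nat_seg by blast
  define w where "w = map (vertex_label V E f) cs"
  have "word_approx w w" unfolding word_approx_def cyc_equiv_def by (metis rotate0 id_apply)
  then have "sunword w"
    unfolding sunword_def using sunoid_copy[OF s] sword_rep_copy[OF f] unfolding w_def by blast
  moreover have "sword_rep V E w" unfolding sword_rep_def w_def using r f by blast
  ultimately show ?thesis by blast
qed

theorem theorem7:
  fixes V :: "'a set" and E :: "'a set set"
  assumes "multisun V E"
  shows "(sunoid V E \<longleftrightarrow> (N_conditions V E \<and> (\<exists>w. sword_rep V E w \<and> sunword w)))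
       \<and> (sunoid V E \<longleftrightarrow> HOH_free V E)"
proof
  show "sunoid V E \<longleftrightarrow> (N_conditions V E \<and> (\<exists>w. sword_rep V E w \<and> sunword w))"
    using sunword_if_sunoid sunoid_if_sunword[OF assms] unfolding sunoid_def by blast
  obtain cs where "is_rim V E cs" using assms unfolding multisun_def by blast
  then interpret multisun_graph V E cs by unfold_locales (use assms in auto)
  show "sunoid V E \<longleftrightarrow> HOH_free V E" by (rule sunoid_iff_HOH_free)
qed

end
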